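(* Let $g$ satisfy conditions (g), (g$_1$), (g$_2$), (g$_3$) listed in the context, let $u$ be a nonnegative bounded weak solution in $\Omega$ to $$\operatorname{div}\Big(g(x,|\nabla u|)\frac{\nabla u}{|\nabla u|}\Big)=0,$$ let $x_0\in\Omega$, and let $\rho_0$ be a sufficiently small positive number such that $B_{8\rho_0}(x_0)\subset\Omega$. There exist positive numbers $c,\beta$ depending only on the data $M:=\operatorname{ess\,sup}_\Omega|u|$, $n,p,q,c_1,c_2(M)$ such that if $$\Lambda(c,\beta,r)\leqslant \tfrac32\,\Lambda(c,\beta,2r)\quad\text{for all } 0<r\leqslant\rho/2<\rho_0/2,$$ and additionally $$\int_0\Lambda(-c,\beta,r)\,\frac{dr}{r}=+\infty\quad\text{and}\quad \lim_{r\to0} r\,\Lambda(c,\beta,r)=0,$$ then $u$ is continuous at $x_0$. Here $\Lambda(c,\beta,r):=\exp\big(c\exp(\beta\lambda(r))\big)$ for $c,\beta\in\mathbb{R}$. In particular, if $0<L<1/\beta$, then for the function $\lambda(r)=L\ln\ln\ln r^{-1}$, $r\in(0,e^{-e})$, one has $\Lambda(c,\beta,r)\leqslant \tfrac32\,\Lambda(c,\beta,2r)$ for all $0<r\leqslant\rho/2<\rho_0/2$ (with $\rho_0$ sufficiently small), $\int_0\Lambda(-c,\beta,r)\,\frac{dr}{r}=+\infty$ and $\lim_{r\to0} r\,\Lambda(c,\beta,r)=0$.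
   Context: $\Omega$ is a bounded domain in $\mathbb{R}^n$, $n\geqslant 2$; $\mathbb{R}_+:=[0,+\infty)$; $B_r(x_0)$ is the ball of radius $r$ centered at $x_0$. The notation $\int_0 f(r)\,dr$ means the integral over a right neighbourhood of $0$. The function $g:\Omega\times\mathbb{R}_+\to\mathbb{R}_+$ satisfies: (g) $g(\cdot,v)\in L^1(\Omega)$ for all $v\in\mathbb{R}_+$; for almost all $x\in\Omega$, $g(x,\cdot)$ is continuous and non-decreasing, $\lim_{v\to+0}g(x,v)=0$ and $\lim_{v\to+\infty}g(x,v)=+\infty$. (g$_1$) There exist $c_1>0$, $q>1$, $b_0\geqslant0$ such that $\frac{g(x,w)}{g(x,v)}\leqslant c_1\left(\frac{w}{v}\right)^{q-1}$ for all $x\in\Omega$ and all $w\geqslant v\geqslant b_0$. (g$_2$) There exists $p>1$ such that $\frac{g(x,w)}{g(x,v)}\geqslant\left(\frac{w}{v}\right)^{p-1}$ for all $x\in\Omega$ and all $w\geqslant v>0$. (g$_3$) There are $r_*>0$ and a continuous, non-increasing function $\lambda:(0,r_* )\to\mathbb{R}_+$ such that for any $K>0$ there is $c_2(K)>0$ with the following property: for any ball $B_{8r}(x_0)\subset\Omega$ (with $r<r_*$), $g(x_1,v/r)\leqslant c_2(K)e^{\lambda(r)}g(x_2,v/r)$ for all $x_1,x_2\in B_r(x_0)$ and all $r\leqslant v\leqslant K$. Put $G(x,v):=g(x,v)v$ for $v\geqslant 0$. $W^{1,G}(\Omega)$ is the set of $u\in W^{1,1}(\Omega)$ with $\int_\Omega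 G(x,|\nabla u|)\,dx<+\infty$; $u\in W^{1,G}_{\rm loc}(\Omega)$ if $u\in W^{1,G}(E)$ for every open $E$ compactly contained in $\Omega$; $W^{1,G}_0(\Omega)$ is the set of $u\in W^{1,G}(\Omega)$ with compact support in $\Omega$. A function $u:\Omega\to\mathbb{R}$ is a bounded weak solution to the equation if $u\in W^{1,G}_{\rm loc}(\Omega)\cap L^\infty(\Omega)$ and $\int_\Omega g(x,|\nabla u|)\frac{\nabla u}{|\nabla u|}\cdot\nabla\varphi\,dx=0$ for any $\varphi\in W^{1,G}_0(\Omega)$; the integrand is understood as $0$ where $\nabla u=0$. Continuity at $x_0$ is meant, as usual, for functions defined up to null sets: the essential oscillation $\operatorname{ess\,sup}_{B_r(x_0)}u-\operatorname{ess\,inf}_{B_r(x_0)}u$ tends to $0$ as $r\to0$. *)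

theory Defs
  imports "HOL-Analysis.Analysis" "HOL-Probability.Essential_Supremum"
begin

definition domain_of_space :: "(real^'n) set \<Rightarrow> bool" where
  "domain_of_space \<Omega> \<longleftrightarrow> open \<Omega> \<and> connected \<Omega> \<and> \<Omega> \<noteq> {}"

subsection \<open>Essential bounds\<close>

definition ess_sup_on :: "(real^'n) set \<Rightarrow> (real^'n \<Rightarrow> real) \<Rightarrow> ereal" where
  "ess_sup_on E u = esssup (lebesgue_on E) (\<lambda>x. ereal (u x))"

definition ess_inf_on :: "(real^'n) set \<Rightarrow> (real^'n \<Rightarrow> real) \<Rightarrow> ereal" where
  "ess_inf_on E u = - ess_sup_on E (\<lambda>x. - u x)"

definition L_infinity :: "(real^'n) set \<Rightarrow> (real^'n \<Rightarrow> real) \<Rightarrow> bool" where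
  "L_infinity E u \<longleftrightarrow>
     u \<in> borel_measurable (lebesgue_on E) \<and> ess_sup_on E (\<lambda>x. \<bar>u x\<bar>) < \<infinity>"

definition ess_continuous_at :: "(real^'n \<Rightarrow> real) \<Rightarrow> real^'n \<Rightarrow> bool" where
  "ess_continuous_at u x0 \<longleftrightarrow>
     ((\<lambda>r. ess_sup_on (ball x0 r) u - ess_inf_on (ball x0 r) u) \<longlongrightarrow> 0) (at_right 0)"

subsection \<open>Weak gradients and Sobolev spaces\<close>

text \<open>\<open>k\<close>-fold continuous differentiability on the whole space, by recursion on
  the partial derivatives.\<close>

primrec Ck :: "nat \<Rightarrow> (real^'n \<Rightarrow> real) \<Rightarrow> bool" where
  "Ck 0 f \<longleftrightarrow> continuous_on UNIV f"
| "Ck (Suc k) f \<longleftrightarrow> (\<exists>Df :: real^'n \<Rightarrow> real^'n.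
     (\<forall>x. GDERIV f x :> Df x) \<and> (\<forall>i. Ck k (\<lambda>x. Df x $ i)))"

definition test_function :: "(real^'n) set \<Rightarrow> (real^'n \<Rightarrow> real) \<Rightarrow> bool" where
  "test_function \<Omega> \<psi> \<longleftrightarrow>
     (\<forall>k. Ck k \<psi>) \<and> (\<exists>K. compact K \<and> K \<subseteq> \<Omega> \<and> (\<forall>x. x \<notin> K \<longrightarrow> \<psi> x = 0))"

definition locally_integrable :: "(real^'n) set \<Rightarrow> (real^'n \<Rightarrow> 'b::euclidean_space) \<Rightarrow> bool" where
  "locally_integrable \<Omega> f \<longleftrightarrow> (\<forall>K. compact K \<and> K \<subseteq> \<Omega> \<longrightarrow> f absolutely_integrable_on K)"

text \<open>The weak gradient is a relation, since it is determined only up to null sets.\<close>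

definition weak_gradient ::
    "(real^'n) set \<Rightarrow> (real^'n \<Rightarrow> real) \<Rightarrow> (real^'n \<Rightarrow> real^'n) \<Rightarrow> bool" where
  "weak_gradient \<Omega> u Du \<longleftrightarrow>
     locally_integrable \<Omega> u \<and> locally_integrable \<Omega> Du \<and>
     (\<forall>\<psi> D\<psi>. test_function \<Omega> \<psi> \<and> (\<forall>x. GDERIV \<psi> x :> D\<psi> x) \<longrightarrow>
        (LINT x:\<Omega>|lebesgue. u x *\<^sub>R D\<psi> x) = - (LINT x:\<Omega>|lebesgue. \<psi> x *\<^sub>R Du x))"

definition G_of :: "('a \<Rightarrow> real \<Rightarrow> real) \<Rightarrow> 'a \<Rightarrow> real \<Rightarrow> real" where
  "G_of g x v = g x v * v"

definition W1G :: "(real^'n \<Rightarrow> real \<Rightarrow> real) \<Rightarrow> (real^'n) set \<Rightarrow> (real^'n \<Rightarrow> real) \<Rightarrow> bool" where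
  "W1G g E u \<longleftrightarrow> (\<exists>Du. weak_gradient E u Du \<and>
     u absolutely_integrable_on E \<and> Du absolutely_integrable_on E \<and>
     (\<integral>\<^sup>+x\<in>E. ennreal (G_of g x (norm (Du x))) \<partial>lebesgue) < \<infinity>)"

definition W1G_loc :: "(real^'n \<Rightarrow> real \<Rightarrow> real) \<Rightarrow> (real^'n) set \<Rightarrow> (real^'n \<Rightarrow> real) \<Rightarrow> bool" where
  "W1G_loc g \<Omega> u \<longleftrightarrow>
     (\<forall>E. open E \<and> compact (closure E) \<and> closure E \<subseteq> \<Omega> \<longrightarrow> W1G g E u)"

text \<open>Compact support is meant for classes modulo null sets.\<close>

definition W1G_0 :: "(real^'n \<Rightarrow> real \<Rightarrow> real) \<Rightarrow> (real^'n) set \<Rightarrow> (real^'n \<Rightarrow> real) \<Rightarrow> bool" where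
  "W1G_0 g \<Omega> \<phi> \<longleftrightarrow> W1G g \<Omega> \<phi> \<and>
     (\<exists>K. compact K \<and> K \<subseteq> \<Omega> \<and> (AE x in lebesgue. x \<in> \<Omega> - K \<longrightarrow> \<phi> x = 0))"

text \<open>Where \<open>Du x = 0\<close> the integrand is \<open>0\<close>, by \<open>a / 0 = 0\<close>. The choice of the
  representatives \<open>Du\<close> and \<open>D\<phi>\<close> is immaterial.\<close>

definition bounded_weak_solution ::
    "(real^'n \<Rightarrow> real \<Rightarrow> real) \<Rightarrow> (real^'n) set \<Rightarrow> (real^'n \<Rightarrow> real) \<Rightarrow> bool" where
  "bounded_weak_solution g \<Omega> u \<longleftrightarrow> W1G_loc g \<Omega> u \<and> L_infinity \<Omega> u \<and>
     (\<exists>Du. weak_gradient \<Omega> u Du \<and>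
       (\<forall>\<phi> D\<phi>. W1G_0 g \<Omega> \<phi> \<and> weak_gradient \<Omega> \<phi> D\<phi> \<longrightarrow>
         (LINT x:\<Omega>|lebesgue.
            g x (norm (Du x)) * (((1 / norm (Du x)) *\<^sub>R Du x) \<bullet> D\<phi> x)) = 0))"

subsection \<open>Structure conditions\<close>

definition cond_g :: "(real^'n) set \<Rightarrow> (real^'n \<Rightarrow> real \<Rightarrow> real) \<Rightarrow> bool" where
  "cond_g \<Omega> g \<longleftrightarrow>
     (\<forall>x\<in>\<Omega>. \<forall>v\<ge>0. g x v \<ge> 0) \<and>
     (\<forall>v\<ge>0. (\<lambda>x. g x v) absolutely_integrable_on \<Omega>) \<and>
     (AE x in lebesgue. x \<in> \<Omega> \<longrightarrow>
        continuous_on {0..} (g x) \<and> mono_on {0..} (g x) \<and>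
        (g x \<longlongrightarrow> 0) (at_right 0) \<and> filterlim (g x) at_top at_top)"

text \<open>The restriction \<open>v > 0\<close> matters only for \<open>b0 = 0\<close>, where \<open>w / v\<close> needs it. The
  quotients of values of \<open>g\<close> are genuine: \<open>cond_g2\<close> excludes \<open>g x v = 0\<close> for \<open>v > 0\<close>,
  as it would then read \<open>0 \<ge> (w / v) powr (p - 1) > 0\<close>.\<close>

definition cond_g1 ::
    "(real^'n) set \<Rightarrow> (real^'n \<Rightarrow> real \<Rightarrow> real) \<Rightarrow> real \<Rightarrow> real \<Rightarrow> real \<Rightarrow> bool" where
  "cond_g1 \<Omega> g c1 q b0 \<longleftrightarrow> c1 > 0 \<and> q > 1 \<and> b0 \<ge> 0 \<and>
     (\<forall>x\<in>\<Omega>. \<forall>v w. 0 < v \<and> b0 \<le> v \<and> v \<le> w \<longrightarrow>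
        g x w / g x v \<le> c1 * (w / v) powr (q - 1))"

definition cond_g2 :: "(real^'n) set \<Rightarrow> (real^'n \<Rightarrow> real \<Rightarrow> real) \<Rightarrow> real \<Rightarrow> bool" where
  "cond_g2 \<Omega> g p \<longleftrightarrow> p > 1 \<and>
     (\<forall>x\<in>\<Omega>. \<forall>v w. 0 < v \<and> v \<le> w \<longrightarrow> g x w / g x v \<ge> (w / v) powr (p - 1))"

definition cond_g3 ::
    "(real^'n) set \<Rightarrow> (real^'n \<Rightarrow> real \<Rightarrow> real) \<Rightarrow> real \<Rightarrow> (real \<Rightarrow> real) \<Rightarrow> (real \<Rightarrow> real) \<Rightarrow> bool"
  where
  "cond_g3 \<Omega> g rs lam c2 \<longleftrightarrow> rs > 0 \<and>
     continuous_on {0<..<rs} lam \<and> antimono_on {0<..<rs} lam \<and> (\<forall>r\<in>{0<..<rs}. lam r \<ge> 0) \<and>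
     (\<forall>K>0. c2 K > 0 \<and>
        (\<forall>x0 r. 0 < r \<and> r < rs \<and> ball x0 (8 * r) \<subseteq> \<Omega> \<longrightarrow>
           (\<forall>x1\<in>ball x0 r. \<forall>x2\<in>ball x0 r. \<forall>v. r \<le> v \<and> v \<le> K \<longrightarrow>
              g x1 (v / r) \<le> c2 K * exp (lam r) * g x2 (v / r))))"

subsection \<open>The function \<open>\<Lambda>\<close>\<close>

definition Lam :: "(real \<Rightarrow> real) \<Rightarrow> real \<Rightarrow> real \<Rightarrow> real \<Rightarrow> real" where
  "Lam lam c \<beta> r = exp (c * exp (\<beta> * lam r))"

definition Lam_doubling :: "(real \<Rightarrow> real) \<Rightarrow> real \<Rightarrow> real \<Rightarrow> real \<Rightarrow> bool" where
  "Lam_doubling lam c \<beta> \<rho>0 \<longleftrightarrow>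
     (\<forall>r \<rho>. 0 < r \<and> r \<le> \<rho> / 2 \<and> \<rho> / 2 < \<rho>0 / 2 \<longrightarrow>
        Lam lam c \<beta> r \<le> 3 / 2 * Lam lam c \<beta> (2 * r))"

text \<open>Divergence at \<open>0\<close> for nonnegative \<open>f\<close>: the integral over every sufficiently small
  right neighbourhood of \<open>0\<close> is infinite.\<close>

definition diverges_at_0 :: "(real \<Rightarrow> real) \<Rightarrow> bool" where
  "diverges_at_0 f \<longleftrightarrow>
     (\<forall>\<^sub>F \<epsilon> in at_right 0. (\<integral>\<^sup>+r\<in>{0<..<\<epsilon>}. ennreal (f r) \<partial>lborel) = \<infinity>)"

end

(*
  The functions \<Lambda> leave room for a doubly exponential loss in the oscillation, so De Giorgi's
  method in W^{1,1} suffices. Testing with (u-k)_+^2 \<zeta>^m and comparing g(x,.) with g(x0,.) by (g3)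
  at the single argument H/R (H the height above the level k) gives
    \<integral>_S |Du| <= T (H/R) |S| + T^(1-p) \<Gamma> (R/(b-a))^m (H/(l-k)) (H/R) |{u > k} \<inter> B_b|
  for T >= 1 and S \<subseteq> {u > l} \<inter> B_a, with \<Gamma> = C exp(2 \<lambda>(R)). Together with De Giorgi's isoperimetric
  inequality this reduces the oscillation on B_R by the factor 1 - 2^(-s-2) on B_{R/4}, where s is
  polynomial in \<Gamma>, as long as the oscillation is at least R (1 + b0) 2^(s+1). Hence the factor
  is at most 1 - \<Lambda>(-c,\<beta>,R); the divergence of the integral makes the product of these factors vanish,
  and r \<Lambda>(c,\<beta>,r) -> 0 takes care of small oscillations.

  Instead of Sobolev calculus, a weak gradient Du is characterised by
    u(x+h) - u(x) = \<integral>_0^1 Du(x+th) . h dt  for every h and almost every x,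
  which yields the chain rule and the isoperimetric inequality by one-dimensional arguments.
*)
theory Submission
  imports Defs "HOL-Real_Asymp.Real_Asymp"
begin

section \<open>Smooth cutoff functions\<close>

lemma Ck_SucD: "Ck (Suc k) f \<Longrightarrow> Ck k f"
proof (induction k arbitrary: f)
  case 0
  then obtain Df where "\<forall>x. GDERIV f x :> Df x" by auto
  then have "\<forall>x. isCont f x" unfolding gderiv_def using has_derivative_continuous by blast
  then show ?case by (simp add: continuous_at_imp_continuous_on)
next
  case (Suc k)
  then obtain Df where "\<forall>x. GDERIV f x :> Df x" "\<forall>i. Ck (Suc k) (\<lambda>x. Df x $ i)" by auto
  with Suc.IH show ?case by auto
qed

lemma Ck_const: "Ck k (\<lambda>x. c)"
proof (induction k arbitrary: c)
  case (Suc k)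
  then show ?case by (auto intro!: exI[of _ "\<lambda>x. 0"] GDERIV_const)
qed auto

lemma Ck_add: "Ck k f \<Longrightarrow> Ck k g \<Longrightarrow> Ck k (\<lambda>x. f x + g x)"
proof (induction k arbitrary: f g)
  case (Suc k)
  then obtain Df Dg where "\<forall>x. GDERIV f x :> Df x" "\<forall>i. Ck k (\<lambda>x. Df x $ i)"
    "\<forall>x. GDERIV g x :> Dg x" "\<forall>i. Ck k (\<lambda>x. Dg x $ i)" by auto
  with Suc.IH show ?case by (auto intro!: exI[of _ "\<lambda>x. Df x + Dg x"] GDERIV_add)
qed (auto intro: continuous_intros)

lemma Ck_mult: "Ck k f \<Longrightarrow> Ck k g \<Longrightarrow> Ck k (\<lambda>x. f x * g x)"
proof (induction k arbitrary: f g)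
  case (Suc k)
  then obtain Df Dg where D: "\<forall>x. GDERIV f x :> Df x" "\<forall>i. Ck k (\<lambda>x. Df x $ i)"
    "\<forall>x. GDERIV g x :> Dg x" "\<forall>i. Ck k (\<lambda>x. Dg x $ i)" by auto
  have "Ck k f" "Ck k g" using Suc.prems Ck_SucD by auto
  with D Suc.IH show ?case
    by (auto intro!: exI[of _ "\<lambda>x. f x *\<^sub>R Dg x + g x *\<^sub>R Df x"] GDERIV_mult Ck_add)
qed (auto intro: continuous_intros)

lemma Ck_prod: "finite S \<Longrightarrow> (\<And>i. i \<in> S \<Longrightarrow> Ck k (f i)) \<Longrightarrow> Ck k (\<lambda>x. \<Prod>i\<in>S. f i x)"
  by (induction S rule: finite_induct) (auto intro: Ck_const Ck_mult)

lemma Ck_sum: "finite S \<Longrightarrow> (\<And>i. i \<in> S \<Longrightarrow> Ck k (f i)) \<Longrightarrow> Ck k (\<lambda>x. \<Sum>i\<in>S. f i x)"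
  by (induction S rule: finite_induct) (auto intro: Ck_const Ck_add)

lemma Ck_power: "Ck k f \<Longrightarrow> Ck k (\<lambda>x. f x ^ m)"
  by (induction m) (auto intro: Ck_const Ck_mult)

lemma GDERIV_nth: "GDERIV (\<lambda>x. x $ i) x :> axis i (1::real)"
  unfolding gderiv_def by (simp add: inner_axis bounded_linear_imp_has_derivative bounded_linear_vec_nth)

lemma Ck_nth: "Ck k (\<lambda>x. x $ i)"
proof (cases k)
  case (Suc j)
  then show ?thesis
    by (auto intro!: exI[of _ "\<lambda>x. axis i 1"] GDERIV_nth Ck_const)
qed (auto intro: continuous_intros)

lemma Ck_inverse:
  assumes "\<And>x. f x \<noteq> 0"
  shows "Ck k f \<Longrightarrow> Ck k (\<lambda>x. inverse (f x))"
proof (induction k)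
  case (Suc k)
  then obtain Df where D: "\<forall>x. GDERIV f x :> Df x" "\<forall>i. Ck k (\<lambda>x. Df x $ i)" by auto
  have *: "Ck k (\<lambda>x. inverse (f x))" using Suc Ck_SucD by auto
  have "Ck k (\<lambda>x. (-1) * ((inverse (f x) * inverse (f x)) * Df x $ i))" for i
    using * D by (intro Ck_mult Ck_const) auto
  then show ?case using D assms
    by (auto intro!: exI[of _ "\<lambda>x. - (inverse (f x))\<^sup>2 *\<^sub>R Df x"] GDERIV_inverse simp: power2_eq_square)
qed (use assms in \<open>auto intro: continuous_intros\<close>)

text \<open>The powers of \<open>1 / t\<close> are included because derivatives of
  \<open>exp (- (1 / t))\<close> produce them: the linear span of the family is closed under
  differentiation, so one induction for all \<open>j\<close> at once gives smoothness.\<close>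

definition flat_exp :: "nat \<Rightarrow> real \<Rightarrow> real" where
  "flat_exp j t = (if t > 0 then (1 / t) ^ j * exp (- (1 / t)) else 0)"

lemma flat_exp_tendsto_0: "(flat_exp j \<longlongrightarrow> 0) (at 0)"
proof -
  have "((\<lambda>s::real. s ^ j / exp s) \<longlongrightarrow> 0) at_top" by (rule tendsto_power_div_exp_0)
  then have "((\<lambda>t::real. (inverse t) ^ j / exp (inverse t)) \<longlongrightarrow> 0) (at_right 0)"
    using filterlim_inverse_at_top_right by (rule filterlim_compose)
  moreover have "\<forall>\<^sub>F t in at_right 0. (inverse t) ^ j / exp (inverse t) = flat_exp j t"
    by (auto simp: eventually_at_right_field flat_exp_def exp_minus field_simps intro!: exI[of _ 1])
  ultimately have "(flat_exp j \<longlongrightarrow> 0) (at_right 0)" by (rule Lim_transform_eventually)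
  moreover have "\<forall>\<^sub>F t in at_left 0. 0 = flat_exp j t"
    by (auto simp: eventually_at_left_field flat_exp_def intro!: exI[of _ "-1"])
  then have "(flat_exp j \<longlongrightarrow> 0) (at_left 0)" by (rule Lim_transform_eventually[OF tendsto_const])
  ultimately show ?thesis by (simp add: filterlim_at_split)
qed

lemma DERIV_flat_exp: "DERIV (flat_exp j) t :> flat_exp (j + 2) t - j * flat_exp (j + 1) t"
proof -
  consider "t > 0" | "t < 0" | "t = 0" by linarith
  then show ?thesis
  proof cases
    case 1
    have "DERIV (\<lambda>t. (1 / t) ^ j * exp (- (1 / t))) t :> flat_exp (j + 2) t - j * flat_exp (j + 1) t"
    proof (cases j)
      case 0
      with 1 show ?thesis
        by (auto intro!: derivative_eq_intros simp: flat_exp_def field_simps power2_eq_square)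
    next
      case (Suc i)
      have "DERIV (\<lambda>t. (1 / t) ^ Suc i * exp (- (1 / t))) t :>
          (1 / t) ^ Suc i * (exp (- (1 / t)) * (1 / t\<^sup>2)) + (Suc i * ((1 / t) ^ i * (- 1 / t\<^sup>2))) * exp (- (1 / t))"
        using 1 by (auto simp del: power_Suc simp: power2_eq_square intro!: derivative_eq_intros)
      with 1 Suc show ?thesis
        by (simp add: flat_exp_def divide_inverse power2_eq_square algebra_simps)
    qed
    then show ?thesis
      by (rule has_field_derivative_transform_within_open[where S="{0<..}"])
        (use 1 in \<open>auto simp: flat_exp_def\<close>)
  next
    case 2
    have "DERIV (\<lambda>t. 0) t :> flat_exp (j + 2) t - j * flat_exp (j + 1) t"
      using 2 by (auto simp: flat_exp_def)
    then show ?thesis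
      by (rule has_field_derivative_transform_within_open[where S="{..<0}"])
        (use 2 in \<open>auto simp: flat_exp_def\<close>)
  next
    case 3
    \<comment> \<open>At 0 the difference quotient of a member is the next member of the family,
      whose limit is known.\<close>
    have "flat_exp (Suc j) = (\<lambda>h. (flat_exp j h - flat_exp j 0) / h)"
      by (auto simp: flat_exp_def fun_eq_iff)
    with flat_exp_tendsto_0[of "Suc j"] 3 show ?thesis
      by (simp add: has_field_derivative_iff flat_exp_def)
  qed
qed

lemma Ck_flat_exp:
  assumes "\<And>k. Ck k f"
  shows "Ck k (\<lambda>x. flat_exp j (f x))"
proof (induction k arbitrary: j)
  case 0
  have "continuous_on UNIV (flat_exp j)"
    by (meson DERIV_flat_exp DERIV_isCont continuous_at_imp_continuous_on)
  moreover have "continuous_on UNIV f" using assms[of 0] by simp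
  ultimately show ?case using continuous_on_compose2[of UNIV] by auto
next
  case (Suc k)
  obtain Df where D: "\<forall>x. GDERIV f x :> Df x" "\<forall>i. Ck k (\<lambda>x. Df x $ i)"
    using assms[of "Suc k"] by auto
  have "Ck k (\<lambda>x. (flat_exp (j + 2) (f x) + (- real j) * flat_exp (j + 1) (f x)) * Df x $ i)" for i
    using D Suc by (intro Ck_mult Ck_const Ck_add) auto
  moreover have "GDERIV (\<lambda>x. flat_exp j (f x)) x :>
      (flat_exp (j + 2) (f x) - j * flat_exp (j + 1) (f x)) *\<^sub>R Df x" for x
    using D DERIV_flat_exp by (intro GDERIV_DERIV_compose) auto
  ultimately show ?case
    by (auto intro!: exI[of _ "\<lambda>x. (flat_exp (j + 2) (f x) - j * flat_exp (j + 1) (f x)) *\<^sub>R Df x"])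
qed

text \<open>The standard smooth transition between the constants 0 and 1; the denominator is
  positive because \<open>t\<close> and \<open>1 - t\<close> are not both nonpositive.\<close>

definition smooth_step :: "real \<Rightarrow> real" where
  "smooth_step t = flat_exp 0 t * inverse (flat_exp 0 t + flat_exp 0 (1 - t))"

lemma flat_exp_0_sum_pos: "flat_exp 0 t + flat_exp 0 (1 - t) > 0"
  by (cases "t > 0"; cases "t < 1") (auto simp: flat_exp_def intro: add_pos_pos)

lemma smooth_step_simps:
  "t \<le> 0 \<Longrightarrow> smooth_step t = 0" "t \<ge> 1 \<Longrightarrow> smooth_step t = 1"
  "0 \<le> smooth_step t" "smooth_step t \<le> 1"
proof -
  have nn: "flat_exp 0 s \<ge> 0" for s by (simp add: flat_exp_def)
  show "t \<le> 0 \<Longrightarrow> smooth_step t = 0" "t \<ge> 1 \<Longrightarrow> smooth_step t = 1"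
    by (auto simp: smooth_step_def flat_exp_def)
  show "0 \<le> smooth_step t" "smooth_step t \<le> 1"
    using nn[of t] nn[of "1-t"] flat_exp_0_sum_pos[of t]
    by (auto simp: smooth_step_def field_simps)
qed

lemma Ck_smooth_step:
  assumes "\<And>k. Ck k f"
  shows "Ck k (\<lambda>x. smooth_step (f x))"
proof -
  have 1: "Ck k (\<lambda>x. 1 + (-1) * f x)" for k using assms by (intro Ck_add Ck_mult Ck_const)
  have "Ck k (\<lambda>x. flat_exp 0 (f x) * inverse (flat_exp 0 (f x) + flat_exp 0 (1 + (-1) * f x)))"
    by (intro Ck_mult Ck_inverse Ck_add Ck_flat_exp assms 1) (use flat_exp_0_sum_pos in \<open>simp add: less_le\<close>)
  then show ?thesis by (simp add: smooth_step_def)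
qed

text \<open>The derivative is continuous on \<open>{0..1}\<close> and vanishes outside, so
  compactness yields the bound. The lower bound 1 for \<open>B\<close> later keeps the ratio
  \<open>\<mu>\<close> of \<open>energy_estimate\<close> at least 1.\<close>

lemma smooth_step_derivative_bound:
  obtains \<theta>' B where "\<And>t. DERIV smooth_step t :> \<theta>' t" "\<And>t. \<bar>\<theta>' t\<bar> \<le> B" "B \<ge> (1::real)"
proof -
  define f where "f t = flat_exp 0 t + flat_exp 0 (1 - t)" for t
  define \<theta>' where "\<theta>' t = (flat_exp 2 t * f t - flat_exp 0 t * (flat_exp 2 t - flat_exp 2 (1 - t))) / (f t)\<^sup>2" for t
  have f0: "f t \<noteq> 0" for t using flat_exp_0_sum_pos[of t] by (simp add: f_def)
  have d: "DERIV (flat_exp 0) t :> flat_exp 2 t" for t using DERIV_flat_exp[of 0 t] by (simp add: numeral_2_eq_2)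
  have D: "DERIV smooth_step t :> \<theta>' t" for t
  proof -
    have 1: "DERIV f t :> flat_exp 2 t - flat_exp 2 (1 - t)"
      unfolding f_def by (auto intro!: derivative_eq_intros DERIV_chain2[where f="flat_exp 0"] d)
    have "smooth_step = (\<lambda>t. flat_exp 0 t / f t)" by (auto simp: smooth_step_def f_def divide_inverse)
    moreover have "DERIV (\<lambda>t. flat_exp 0 t / f t) t :> \<theta>' t"
      using f0 by (auto intro!: derivative_eq_intros d 1 simp: \<theta>'_def power2_eq_square)
    ultimately show ?thesis by simp
  qed
  have cf: "continuous_on A (flat_exp j)" for A j
    by (meson DERIV_flat_exp DERIV_isCont continuous_at_imp_continuous_on)
  have cc: "continuous_on A (\<lambda>t. flat_exp j (1 - t))" for A j
    by (rule continuous_on_compose2[OF cf[of UNIV]]) (auto intro: continuous_intros)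
  have "continuous_on {0..1} \<theta>'" unfolding \<theta>'_def using f0
    by (auto simp: f_def intro!: continuous_intros cf cc)
  then have "bounded (\<theta>' ` {0..1})" by (intro compact_imp_bounded compact_continuous_image) auto
  then obtain B where B: "\<And>t. t \<in> {0..1} \<Longrightarrow> \<bar>\<theta>' t\<bar> \<le> B" unfolding bounded_iff by (metis imageI real_norm_def)
  have out: "\<theta>' t = 0" if "t \<notin> {0..1}" for t
  proof (cases "t < 0")
    case True
    then show ?thesis by (simp add: \<theta>'_def flat_exp_def)
  next
    case False
    then have "t > 1" using that by auto
    then show ?thesis by (simp add: \<theta>'_def flat_exp_def f_def)
  qed
  have "\<bar>\<theta>' t\<bar> \<le> max 1 B" for t using B[of t] out[of t] by (cases "t \<in> {0..1}") auto
  then show ?thesis using that[OF D, of "max 1 B"] by auto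
qed

lemma Ck_dist_square: "Ck k (\<lambda>x. (dist x (a::real^'n))\<^sup>2)"
proof -
  have "Ck k (\<lambda>x. \<Sum>i\<in>(UNIV::'n set). (x $ i + - a $ i) ^ 2)"
    by (intro Ck_sum Ck_power Ck_add Ck_nth Ck_const) auto
  moreover have "(dist x a)\<^sup>2 = (\<Sum>i\<in>UNIV. (x $ i + - a $ i) ^ 2)" for x
    by (simp add: dist_norm norm_vec_def L2_set_def sum_nonneg)
  ultimately show ?thesis by simp
qed

lemma GDERIV_dist_square: "GDERIV (\<lambda>x. (dist x a)\<^sup>2) x :> 2 *\<^sub>R (x - a)"
  unfolding gderiv_def dist_norm power2_norm_eq_inner
  by (auto intro!: derivative_eq_intros simp: inner_commute algebra_simps)

text \<open>The constant \<open>B\<close> is independent of the radii, so it may enter the final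
  constants. The gradient is also required to vanish on the closed inner ball, boundary included,
  which makes a localised function keep its gradient there.\<close>

definition has_cutoffs :: "real^'n \<Rightarrow> real \<Rightarrow> bool" where
  "has_cutoffs x0 B \<longleftrightarrow> B \<ge> 1 \<and> (\<forall>a b. 0 < a \<and> a < b \<longrightarrow>
    (\<exists>\<zeta> D\<zeta>. (\<forall>k. Ck k \<zeta>) \<and> (\<forall>x. GDERIV \<zeta> x :> D\<zeta> x) \<and> (\<forall>x. 0 \<le> \<zeta> x \<and> \<zeta> x \<le> 1) \<and>
      (\<forall>x\<in>cball x0 a. \<zeta> x = 1 \<and> D\<zeta> x = 0) \<and> (\<forall>x. x \<notin> ball x0 b \<longrightarrow> \<zeta> x = 0 \<and> D\<zeta> x = 0) \<and>
      (\<forall>x. norm (D\<zeta> x) \<le> B / (b - a))))"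

text \<open>The step is composed with an affine function of the squared distance, which unlike the
  distance is smooth at the centre. The gradient is at most B * 2 b / (b^2 - a^2), and b \<le> b + a
  turns this into 2 B / (b - a).\<close>

lemma radial_cutoff:
  obtains B where "\<And>x0 :: real^'n. has_cutoffs x0 B"
proof -
  obtain \<theta>' B where \<theta>: "\<And>t. DERIV smooth_step t :> \<theta>' t" "\<And>t. \<bar>\<theta>' t\<bar> \<le> B" "B \<ge> (1::real)"
    using smooth_step_derivative_bound by metis
  have \<theta>0: "\<theta>' t = 0" if "t \<le> 0 \<or> t \<ge> 1" for t
  proof -
    from that show ?thesis
    proof
      assume "t \<le> 0"
      then have "smooth_step t \<le> smooth_step s" for s by (simp add: smooth_step_simps)
      then show ?thesis using DERIV_local_min[OF \<theta>(1), of 1 t] by auto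
    next
      assume "t \<ge> 1"
      then have "smooth_step s \<le> smooth_step t" for s by (simp add: smooth_step_simps)
      then show ?thesis using DERIV_local_max[OF \<theta>(1), of 1 t] by auto
    qed
  qed
  show ?thesis
  proof (rule that[of "2 * B"])
    fix x0 :: "real^'n"
    show "has_cutoffs x0 (2 * B)" unfolding has_cutoffs_def
    proof (intro conjI allI impI, goal_cases)
      case 1
      show ?case using \<theta>(3) by simp
    next
      case (2 a b)
      then have ab: "0 < a" "a < b" by auto
      then have pos: "b\<^sup>2 - a\<^sup>2 > 0" by (simp add: power_strict_mono)
      define s where "s x = b\<^sup>2 / (b\<^sup>2 - a\<^sup>2) + (- 1 / (b\<^sup>2 - a\<^sup>2)) * (dist x x0)\<^sup>2" for x
      have s_eq: "s x = (b\<^sup>2 - (dist x x0)\<^sup>2) / (b\<^sup>2 - a\<^sup>2)" for x by (simp add: s_def diff_divide_distrib)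
      define D where "D x = \<theta>' (s x) *\<^sub>R ((- 1 / (b\<^sup>2 - a\<^sup>2)) *\<^sub>R (2 *\<^sub>R (x - x0)))" for x
      have Cs: "Ck k s" for k unfolding s_def by (intro Ck_add Ck_mult Ck_const Ck_dist_square)
      have "GDERIV s x :> (- 1 / (b\<^sup>2 - a\<^sup>2)) *\<^sub>R (2 *\<^sub>R (x - x0))" for x
        unfolding s_def
        by (rule GDERIV_subst[OF GDERIV_add[OF GDERIV_const GDERIV_mult[OF GDERIV_const GDERIV_dist_square]]]) simp
      then have GD: "GDERIV (\<lambda>x. smooth_step (s x)) x :> D x" for x
        unfolding D_def by (rule GDERIV_DERIV_compose) (auto intro: \<theta>(1))
      have in_a: "s x \<ge> 1" if "x \<in> cball x0 a" for x
        using that pos ab by (simp add: s_eq dist_commute power_mono)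
      have out_b: "s x \<le> 0" if "x \<notin> ball x0 b" for x
        using that pos ab by (auto simp: s_eq dist_commute power_mono divide_le_0_iff)
      have bd: "norm (D x) \<le> 2 * B / (b - a)" for x
      proof (cases "x \<in> ball x0 b")
        case True
        have "norm (D x) = \<bar>\<theta>' (s x)\<bar> * (2 * norm (x - x0) / (b\<^sup>2 - a\<^sup>2))"
          using pos by (simp add: D_def abs_mult)
        also have "\<dots> \<le> B * (2 * b / (b\<^sup>2 - a\<^sup>2))"
          using True pos \<theta> by (intro mult_mono divide_right_mono) (auto simp: dist_norm norm_minus_commute)
        also have "\<dots> \<le> B * (2 * (b + a) / (b\<^sup>2 - a\<^sup>2))"
          using pos \<theta>(3) ab by (intro mult_left_mono divide_right_mono) auto
        also have "\<dots> = 2 * B / (b - a)"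
        proof -
          have "b\<^sup>2 - a\<^sup>2 = (b + a) * (b - a)" by (simp add: power2_eq_square square_diff_square_factored)
          then show ?thesis using ab by (simp add: divide_simps)
        qed
        finally show ?thesis .
    next
        case False
        then have "D x = 0" using out_b \<theta>0 by (simp add: D_def)
        then show ?thesis using ab \<theta>(3) by simp
      qed
      show ?case
        using Ck_smooth_step[OF Cs] GD bd in_a out_b \<theta>0
        by (intro exI[of _ "\<lambda>x. smooth_step (s x)"] exI[of _ D])
          (auto simp: smooth_step_simps D_def simp del: mem_ball mem_cball)
    qed
  qed
qed

text \<open>Products over the coordinates of steps of slope \<open>j\<close> at both faces. They
  vanish off the open box for every \<open>j\<close>, and at a point of the open box they are
  eventually 1. They transfer the test with smooth functions to boxes.\<close>

lemma box_bump_sequence: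
  fixes a b :: "real^'n"
  obtains \<psi> where "\<And>j k. Ck k (\<psi> j)" "\<And>j x. x \<notin> cbox a b \<Longrightarrow> \<psi> j x = 0" "\<And>j x. \<bar>\<psi> j x\<bar> \<le> 1"
    "\<And>x. (\<lambda>j::nat. \<psi> j x) \<longlonglongrightarrow> indicator (box a b) x"
proof -
  define \<psi> where "\<psi> (j::nat) x =
    (\<Prod>i\<in>UNIV. smooth_step (real j * (x $ i + - a $ i)) * smooth_step (real j * (b $ i + (-1) * x $ i)))" for j x
  have C: "Ck k (\<psi> j)" for j k
    unfolding \<psi>_def by (intro Ck_prod Ck_mult Ck_smooth_step Ck_add Ck_const Ck_nth) auto
  have z: "\<psi> j x = 0" if "x \<notin> box a b" for j x
  proof -
    from that obtain i where i: "x $ i \<le> a $ i \<or> x $ i \<ge> b $ i"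
      by (auto simp: mem_box_cart not_less)
    then have "real j * (x $ i + - a $ i) \<le> 0 \<or> real j * (b $ i + (-1) * x $ i) \<le> 0"
      by (auto simp: mult_le_0_iff)
    then show ?thesis unfolding \<psi>_def by (subst prod_zero_iff) (auto simp: smooth_step_simps intro!: exI[of _ i])
  qed
  have le: "\<bar>\<psi> j x\<bar> \<le> 1" for j x
    unfolding \<psi>_def abs_prod by (intro prod_le_1) (auto simp: abs_mult smooth_step_simps intro!: mult_le_one)
  have "(\<lambda>j. \<psi> j x) \<longlonglongrightarrow> indicator (box a b) x" for x
  proof (cases "x \<in> box a b")
    case False
    then show ?thesis by (simp add: z)
  next
    case True
    have ev: "\<forall>\<^sub>F j in sequentially. real j * d \<ge> 1" if "d > 0" for d
    proof -
      obtain N :: nat where "1 / d < N" using reals_Archimedean2 by blast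
      then have "1 \<le> real j * d" if "j \<ge> N" for j
        using that \<open>d > 0\<close> by (smt (verit, best) divide_le_eq of_nat_le_iff)
      then show ?thesis by (auto simp: eventually_sequentially)
    qed
    have "\<forall>\<^sub>F j in sequentially. \<forall>i. real j * (x $ i + - a $ i) \<ge> 1 \<and> real j * (b $ i + (-1) * x $ i) \<ge> 1"
      using True by (auto intro!: eventually_all_finite eventually_conj ev simp: mem_box_cart)
    then have "\<forall>\<^sub>F j in sequentially. \<psi> j x = indicator (box a b) x"
      by eventually_elim (use True in \<open>simp add: \<psi>_def smooth_step_simps\<close>)
    then show ?thesis by (rule tendsto_eventually)
  qed
  then show ?thesis using that[of \<psi>] C le z box_subset_cbox[of a b] by blast
qed

section \<open>Weak gradients\<close>

text \<open>The gradient is given only pointwise. Uniqueness of derivatives identifies it with the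
  continuous one contained in \<open>Ck\<close>, and shows that it vanishes on the open complement
  of \<open>K\<close>.\<close>

lemma test_function_bounds:
  assumes "test_function \<Omega> \<psi>" "\<forall>x. GDERIV \<psi> x :> D\<psi> x"
  obtains K C where "compact K" "K \<subseteq> \<Omega>" "\<And>x. x \<notin> K \<Longrightarrow> \<psi> x = 0 \<and> D\<psi> x = 0"
    "C > 0" "\<And>x. \<bar>\<psi> x\<bar> \<le> C" "\<And>x. norm (D\<psi> x) \<le> C"
    "continuous_on UNIV \<psi>" "continuous_on UNIV D\<psi>"
proof -
  from assms obtain K where K: "compact K" "K \<subseteq> \<Omega>" "\<And>x. x \<notin> K \<Longrightarrow> \<psi> x = 0"
    and C: "\<And>k. Ck k \<psi>" by (auto simp: test_function_def)
  have D0: "D\<psi> x = 0" if "x \<notin> K" for x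
  proof -
    have "FDERIV \<psi> x :> (\<lambda>h. 0)"
      by (rule has_derivative_transform_within_open[of "\<lambda>x. 0" _ _ _ "- K"])
        (use K that in \<open>auto intro: compact_imp_closed\<close>)
    moreover have "FDERIV \<psi> x :> (\<lambda>h. h \<bullet> D\<psi> x)" using assms(2) by (simp add: gderiv_def)
    ultimately have "(\<lambda>h. h \<bullet> D\<psi> x) = (\<lambda>h. 0)" by (rule has_derivative_unique[symmetric])
    then have "D\<psi> x \<bullet> D\<psi> x = 0" by meson
    then show ?thesis by simp
  qed
  from C[of "Suc 0"] obtain Df where Df: "\<forall>x. GDERIV \<psi> x :> Df x" "\<forall>i. continuous_on UNIV (\<lambda>x. Df x $ i)"
    by auto
  have "Df = D\<psi>"
  proof
    fix x
    have "FDERIV \<psi> x :> (\<lambda>h. h \<bullet> Df x)" "FDERIV \<psi> x :> (\<lambda>h. h \<bullet> D\<psi> x)"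
      using Df assms(2) by (simp_all add: gderiv_def)
    then have "(\<lambda>h. h \<bullet> Df x) = (\<lambda>h. h \<bullet> D\<psi> x)" by (rule has_derivative_unique)
    then have "h \<bullet> Df x = h \<bullet> D\<psi> x" for h by meson
    then show "Df x = D\<psi> x" by (metis inner_commute vector_eq_rdot)
  qed
  with Df have cD: "continuous_on UNIV D\<psi>"
    using continuous_on_vec_lambda[of UNIV "\<lambda>i x. D\<psi> x $ i"] by simp
  have c: "continuous_on UNIV \<psi>" using C[of 0] by simp
  have "bounded (\<psi> ` K)" "bounded (D\<psi> ` K)"
    using c cD K(1) by (auto intro!: compact_imp_bounded compact_continuous_image intro: continuous_on_subset)
  then obtain C1 C2 where "\<And>x. x \<in> K \<Longrightarrow> \<bar>\<psi> x\<bar> \<le> C1" "\<And>x. x \<in> K \<Longrightarrow> norm (D\<psi> x) \<le> C2"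
    unfolding bounded_iff by (metis imageI real_norm_def)
  then have "\<bar>\<psi> x\<bar> \<le> \<bar>C1\<bar> + \<bar>C2\<bar> + 1" "norm (D\<psi> x) \<le> \<bar>C1\<bar> + \<bar>C2\<bar> + 1" for x
    using K(3)[of x] D0[of x] by (cases "x \<in> K"; force)+
  then show ?thesis using that[of K "\<bar>C1\<bar> + \<bar>C2\<bar> + 1"] K D0 c cD by force
qed

lemma integrable_bounded_scaleR:
  fixes f :: "'a::euclidean_space \<Rightarrow> 'b::euclidean_space" and \<psi> :: "'a \<Rightarrow> real"
  assumes "f absolutely_integrable_on K" "\<psi> \<in> borel_measurable borel"
    "\<And>x. x \<notin> K \<Longrightarrow> \<psi> x = 0" "\<And>x. \<bar>\<psi> x\<bar> \<le> C"
  shows "integrable lebesgue (\<lambda>x. \<psi> x *\<^sub>R f x)"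
proof -
  have f: "integrable lebesgue (\<lambda>x. indicator K x *\<^sub>R f x)"
    using assms(1) by (simp add: set_integrable_def)
  have eq: "\<psi> x *\<^sub>R f x = \<psi> x *\<^sub>R (indicator K x *\<^sub>R f x)" for x using assms(3)[of x] by (auto simp: indicator_def)
  have m: "\<psi> \<in> borel_measurable lebesgue" using assms(2) by (simp add: measurable_completion)
  show ?thesis
  proof (rule Bochner_Integration.integrable_bound[of _ "\<lambda>x. C *\<^sub>R (indicator K x *\<^sub>R f x)"])
    show "integrable lebesgue (\<lambda>x. C *\<^sub>R indicat_real K x *\<^sub>R f x)" using f by (rule integrable_scaleR_right)
    show "(\<lambda>x. \<psi> x *\<^sub>R f x) \<in> borel_measurable lebesgue"
      unfolding eq by (rule borel_measurable_scaleR[OF m borel_measurable_integrable[OF f]])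
    show "AE x in lebesgue. norm (\<psi> x *\<^sub>R f x) \<le> norm (C *\<^sub>R indicat_real K x *\<^sub>R f x)"
      unfolding eq norm_scaleR using order_trans[OF assms(4) abs_ge_self]
      by (intro AE_I2 mult_right_mono) auto
  qed
qed

lemma integrable_bounded_scaleR':
  fixes f :: "'a::euclidean_space \<Rightarrow> real" and \<psi> :: "'a \<Rightarrow> real^'n"
  assumes "f absolutely_integrable_on K" "\<psi> \<in> borel_measurable borel"
    "\<And>x. x \<notin> K \<Longrightarrow> \<psi> x = 0" "\<And>x. norm (\<psi> x) \<le> C"
  shows "integrable lebesgue (\<lambda>x. f x *\<^sub>R \<psi> x)"
proof -
  have f: "integrable lebesgue (\<lambda>x. indicator K x *\<^sub>R f x)"
    using assms(1) by (simp add: set_integrable_def)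
  have eq: "f x *\<^sub>R \<psi> x = (indicator K x *\<^sub>R f x) *\<^sub>R \<psi> x" for x using assms(3)[of x] by (auto simp: indicator_def)
  have m: "\<psi> \<in> borel_measurable lebesgue" using assms(2) by (simp add: measurable_completion)
  show ?thesis
  proof (rule Bochner_Integration.integrable_bound[of _ "\<lambda>x. C *\<^sub>R (indicator K x *\<^sub>R f x)"])
    show "integrable lebesgue (\<lambda>x. C *\<^sub>R indicat_real K x *\<^sub>R f x)" using f by (rule integrable_scaleR_right)
    show "(\<lambda>x. f x *\<^sub>R \<psi> x) \<in> borel_measurable lebesgue"
      unfolding eq by (rule borel_measurable_scaleR[OF borel_measurable_integrable[OF f] m])
    have "norm (\<psi> x) \<le> \<bar>C\<bar>" for x using order_trans[OF assms(4) abs_ge_self] .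
    then show "AE x in lebesgue. norm (f x *\<^sub>R \<psi> x) \<le> norm (C *\<^sub>R indicat_real K x *\<^sub>R f x)"
      unfolding eq norm_scaleR norm_mult by (intro AE_I2) (simp add: abs_mult mult.commute mult_right_mono)
  qed
qed

text \<open>Boxes form an intersection-stable generator of the Borel sets, so by Dynkin's lemma the
  integral vanishes over every Borel set; then \<open>f\<close> and 0 are densities of the same
  measure.\<close>

lemma AE_zero_of_box_integrals:
  fixes f :: "'a::euclidean_space \<Rightarrow> real"
  assumes f: "integrable lborel f" and z: "\<And>a b. (LINT x:box a b|lborel. f x) = 0"
  shows "AE x in lborel. f x = 0"
proof -
  have int: "set_integrable lborel A f" if "A \<in> sets borel" for A
    unfolding set_integrable_def using f that by (intro integrable_mult_indicator) auto
  let ?E = "range (\<lambda>(a, b). box a b::'a set)"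
  have S: "sigma_sets UNIV ?E = sets borel" by (simp add: borel_eq_box)
  \<comment> \<open>The complement case of the induction needs the integral over the whole space,
    obtained by exhausting it with boxes.\<close>
  have tot: "(LINT x|lborel. f x) = 0"
  proof -
    have "(\<lambda>n::nat. LINT x:box (- (real n *\<^sub>R One)) (real n *\<^sub>R One)|lborel. f x) \<longlonglongrightarrow>
       (LINT x:(\<Union>n. box (- (real n *\<^sub>R One)) (real n *\<^sub>R One))|lborel. f x)"
    proof (rule set_integral_cont_up)
      show "incseq (\<lambda>n::nat. box (- (real n *\<^sub>R One)) (real n *\<^sub>R One)::'a set)"
        unfolding incseq_def by (intro allI impI subset_box_imp) (auto simp: algebra_simps)
      show "set_integrable lborel (\<Union>n::nat. box (- (real n *\<^sub>R One)) (real n *\<^sub>R One)) f"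
        by (intro int) auto
    qed auto
    then have "(LINT x:UNIV|lborel. f x) = 0" by (simp add: z UN_box_eq_UNIV LIMSEQ_unique[OF tendsto_const] LIMSEQ_const_iff)
    then show ?thesis by (simp add: set_lebesgue_integral_def)
  qed
  have "(LINT x:A|lborel. f x) = 0" if "A \<in> sets borel" for A
  proof -
    have A: "A \<in> sigma_sets UNIV ?E" using that S by simp
    have I: "Int_stable ?E" by (auto simp: Int_stable_def box_Int_box)
    from I subset_Pow_Union[of ?E, THEN order_trans, OF Pow_mono, OF subset_UNIV] A show ?thesis
    proof (induction A rule: sigma_sets_induct_disjoint)
      case (compl A)
      then have A: "A \<in> sets borel" using S by simp
      have "(LINT x:A \<union> (UNIV - A)|lborel. f x) = (LINT x:A|lborel. f x) + (LINT x:UNIV - A|lborel. f x)"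
        using A by (intro set_integral_Un int) auto
      then show ?case using tot compl by (simp add: set_lebesgue_integral_def)
    next
      case (union A)
      then have A: "range A \<subseteq> sets borel" using S by auto
      have "(LINT x:(\<Union>i. A i)|lborel. f x) = (\<Sum>i. LINT x:A i|lborel. f x)"
        using A union(1) by (intro lebesgue_integral_countable_add int) (auto simp: disjoint_family_on_def)
      then show ?case using union by simp
    next
      case (basic A)
      then show ?case using z by auto
    qed (simp add: set_lebesgue_integral_def)
  qed
  then show ?thesis
    using density_unique_real[of lborel f "\<lambda>x. 0"] f by auto
qed

text \<open>Inside a closed box contained in \<Omega>, the smooth bumps converge to indicators of
  subboxes, dominated by the integrable restriction of \<open>f\<close>. Countably many such boxes
  cover \<Omega>.\<close>

lemma fundamental_lemma:
  fixes f :: "real^'n \<Rightarrow> real"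
  assumes "open \<Omega>" and f: "locally_integrable \<Omega> f"
    and z: "\<And>\<psi>. test_function \<Omega> \<psi> \<Longrightarrow> (LINT x|lebesgue. \<psi> x * f x) = 0"
  shows "AE x in lebesgue. x \<in> \<Omega> \<longrightarrow> f x = 0"
proof -
  have box: "AE x in lebesgue. x \<in> cbox c d \<longrightarrow> f x = 0" if cd: "cbox c d \<subseteq> \<Omega>" for c d
  proof -
    define h where "h x = indicator (box c d) x * f x" for x
    have hc: "integrable lebesgue (\<lambda>x. indicator (cbox c d) x *\<^sub>R f x)"
    proof -
      have "f absolutely_integrable_on cbox c d"
        using f cd compact_cbox unfolding locally_integrable_def by blast
      then show ?thesis unfolding set_integrable_def .
    qed
    have "integrable lebesgue (\<lambda>x. indicator (box c d) x *\<^sub>R (indicator (cbox c d) x *\<^sub>R f x))"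
      by (rule integrable_mult_indicator[OF _ hc]) simp
    moreover have "indicator (box c d) x *\<^sub>R (indicator (cbox c d) x *\<^sub>R f x) = h x" for x
      using box_subset_cbox[of c d] by (auto simp: h_def indicator_def)
    ultimately have h: "integrable lebesgue h" by simp
    then obtain h0 where h0: "h0 \<in> borel_measurable lborel" "AE x in lborel. h x = h0 x"
      using completion_ex_borel_measurable_real[OF borel_measurable_integrable[OF h]] by auto
    have AE0: "AE x in lebesgue. h x = h0 x" using h0(2) by (rule AE_completion)
    have h0i: "integrable lborel h0"
    proof -
      have "integrable lebesgue h0"
        using h AE0 h0(1) by (subst integrable_cong_AE[of _ _ h]) (auto simp: measurable_completion)
      then show ?thesis using h0(1) by (simp add: integrable_completion)
    qed
    have "(LINT x:box a b|lborel. h0 x) = 0" for a b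
    proof -
      have m: "(\<lambda>x. indicator (box a b) x *\<^sub>R h0 x) \<in> borel_measurable lborel"
        using h0(1) by measurable
      \<comment> \<open>An intersection of boxes is a box, so its bumps are supported in
        \<open>cbox c d\<close> and hence are test functions on \<Omega>.\<close>
      obtain a' b' where ab': "box a b \<inter> box c d = box a' b'" "cbox a b \<inter> cbox c d = cbox a' b'"
        using box_Int_box[of a b c d] Int_interval[of a b c d] by blast
      have mem: "x \<in> box a' b' \<longleftrightarrow> x \<in> box a b \<and> x \<in> box c d" for x using ab'(1) by blast
      have memc: "x \<in> cbox a' b' \<Longrightarrow> x \<in> cbox c d" for x using ab'(2) by blast
      obtain \<psi> where \<psi>: "\<And>j k. Ck k (\<psi> j)" "\<And>j x. x \<notin> cbox a' b' \<Longrightarrow> \<psi> j x = 0" "\<And>j x. \<bar>\<psi> j x\<bar> \<le> 1"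
        "\<And>x. (\<lambda>j::nat. \<psi> j x) \<longlonglongrightarrow> indicator (box a' b') x" using box_bump_sequence by metis
      have "(\<lambda>j. LINT x|lebesgue. \<psi> j x * f x) \<longlonglongrightarrow> (LINT x|lebesgue. indicator (box a' b') x * f x)"
      proof (rule integral_dominated_convergence[where w="\<lambda>x. norm (indicator (cbox c d) x *\<^sub>R f x)"])
        have eq: "\<psi> j x * f x = \<psi> j x * (indicator (cbox c d) x *\<^sub>R f x)" for j x
          using \<psi>(2)[of x j] memc by (cases "x \<in> cbox c d") auto
        have "\<psi> j \<in> borel_measurable lebesgue" for j
          using \<psi>(1)[of 0 j] by (auto intro!: measurable_completion borel_measurable_continuous_onI)
        then show "(\<lambda>x. \<psi> j x * f x) \<in> borel_measurable lebesgue" for j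
          unfolding eq using hc by (intro borel_measurable_times) auto
        have eq2: "indicator (box a' b') x * f x = indicator (box a' b') x * h x" for x
          by (simp add: h_def indicator_def mem)
        show "(\<lambda>x. indicator (box a' b') x * f x) \<in> borel_measurable lebesgue"
          unfolding eq2 using h by (intro borel_measurable_times borel_measurable_indicator) auto
        show "AE x in lebesgue. (\<lambda>j. \<psi> j x * f x) \<longlonglongrightarrow> indicator (box a' b') x * f x"
          using \<psi>(4) by (auto intro!: AE_I2 tendsto_mult)
        show "AE x in lebesgue. norm (\<psi> j x * f x) \<le> norm (indicator (cbox c d) x *\<^sub>R f x)" for j
          unfolding eq norm_mult using \<psi>(3) by (intro AE_I2 mult_left_le_one_le) auto
        show "integrable lebesgue (\<lambda>x. norm (indicator (cbox c d) x *\<^sub>R f x))" using hc by (rule integrable_norm)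
      qed
      moreover have "(LINT x|lebesgue. \<psi> j x * f x) = 0" for j
        using \<psi> cd ab'(2) by (intro z) (auto simp: test_function_def intro!: exI[of _ "cbox a' b'"])
      ultimately have 0: "(LINT x|lebesgue. indicator (box a' b') x * f x) = 0"
        by (simp add: LIMSEQ_const_iff)
      have "(LINT x:box a b|lborel. h0 x) = (LINT x|lebesgue. indicator (box a b) x *\<^sub>R h0 x)"
        unfolding set_lebesgue_integral_def by (rule integral_completion[OF m, symmetric])
      also have "\<dots> = (LINT x|lebesgue. indicator (box a' b') x * f x)"
      proof (rule integral_cong_AE)
        show "(\<lambda>x. indicat_real (box a b) x *\<^sub>R h0 x) \<in> borel_measurable lebesgue"
          using m by (rule measurable_completion)
        have eq2: "indicator (box a' b') x * f x = indicator (box a' b') x * h x" for x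
          by (simp add: h_def indicator_def mem)
        show "(\<lambda>x. indicator (box a' b') x * f x) \<in> borel_measurable lebesgue"
          unfolding eq2 using h by (intro borel_measurable_times borel_measurable_indicator) auto
        show "AE x in lebesgue. indicat_real (box a b) x *\<^sub>R h0 x = indicat_real (box a' b') x * f x"
          using AE0 by eventually_elim (auto simp: h_def indicator_def mem)
      qed
      finally show ?thesis using 0 by simp
    qed
    then have "AE x in lborel. h0 x = 0" using h0i by (rule AE_zero_of_box_integrals[rotated])
    then have "AE x in lebesgue. h0 x = 0" by (rule AE_completion)
    \<comment> \<open>\<open>h\<close> is cut off to the open box, and the faces of the box form a
      null set.\<close>
    moreover have "AE x in lebesgue. x \<notin> cbox c d - box c d"
      using AE_completion[OF AE_not_in[OF null_sets_cbox_Diff_box]] .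
    ultimately show ?thesis using AE0 by eventually_elim (auto simp: h_def)
  qed
  obtain \<D> where D: "countable \<D>" "\<D> \<subseteq> Pow \<Omega>" "\<And>X. X \<in> \<D> \<Longrightarrow> \<exists>a b. X = cbox a b" "\<Union>\<D> = \<Omega>"
    using open_countable_Union_open_cbox[OF assms(1)] by metis
  have "AE x in lebesgue. \<forall>X\<in>\<D>. x \<in> X \<longrightarrow> f x = 0"
  proof (subst AE_ball_countable[OF D(1)], intro ballI)
    fix X assume "X \<in> \<D>"
    then obtain a b where "X = cbox a b" "X \<subseteq> \<Omega>" using D by blast
    then show "AE x in lebesgue. x \<in> X \<longrightarrow> f x = 0" using box by auto
  qed
  then show ?thesis by eventually_elim (use D(4) in auto)
qed

lemma set_lebesgue_integral_absorb:
  fixes f :: "'a \<Rightarrow> 'b::{banach, second_countable_topology}"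
  assumes "\<And>x. x \<notin> A \<Longrightarrow> f x = 0"
  shows "(LINT x:A|M. f x) = (LINT x|M. f x)"
  unfolding set_lebesgue_integral_def using assms by (intro Bochner_Integration.integral_cong) (auto simp: indicator_def)

text \<open>A test function vanishes off a compact subset of \<Omega>, so the integrals may be taken
  over the whole space; integrability is recorded as well, because the Bochner integral of a
  function that is not integrable is 0.\<close>

lemma weak_gradientD:
  fixes u :: "real^'n \<Rightarrow> real"
  assumes wg: "weak_gradient \<Omega> u Du" and t: "test_function \<Omega> \<psi>" and d: "\<forall>x. GDERIV \<psi> x :> D\<psi> x"
  shows "integrable lebesgue (\<lambda>x. u x *\<^sub>R D\<psi> x)" "integrable lebesgue (\<lambda>x. \<psi> x *\<^sub>R Du x)"
    "(LINT x|lebesgue. u x *\<^sub>R D\<psi> x) = - (LINT x|lebesgue. \<psi> x *\<^sub>R Du x)"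
proof -
  obtain K C where K: "compact K" "K \<subseteq> \<Omega>" "\<And>x. x \<notin> K \<Longrightarrow> \<psi> x = 0 \<and> D\<psi> x = 0"
    "\<And>x. \<bar>\<psi> x\<bar> \<le> C" "\<And>x. norm (D\<psi> x) \<le> C"
    "continuous_on UNIV \<psi>" "continuous_on UNIV D\<psi>" using test_function_bounds[OF t d] by metis
  have i: "u absolutely_integrable_on K" "Du absolutely_integrable_on K"
    using wg K(1,2) unfolding weak_gradient_def locally_integrable_def by blast+
  show "integrable lebesgue (\<lambda>x. u x *\<^sub>R D\<psi> x)"
    by (rule integrable_bounded_scaleR'[OF i(1), where C=C]) (use K borel_measurable_continuous_onI in auto)
  show "integrable lebesgue (\<lambda>x. \<psi> x *\<^sub>R Du x)"
    by (rule integrable_bounded_scaleR[OF i(2), where C=C]) (use K borel_measurable_continuous_onI in auto)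
  have "(LINT x:\<Omega>|lebesgue. u x *\<^sub>R D\<psi> x) = - (LINT x:\<Omega>|lebesgue. \<psi> x *\<^sub>R Du x)"
    using wg t d by (auto simp: weak_gradient_def)
  moreover have "(LINT x:\<Omega>|lebesgue. u x *\<^sub>R D\<psi> x) = (LINT x|lebesgue. u x *\<^sub>R D\<psi> x)"
    by (rule set_lebesgue_integral_absorb) (use K in auto)
  moreover have "(LINT x:\<Omega>|lebesgue. \<psi> x *\<^sub>R Du x) = (LINT x|lebesgue. \<psi> x *\<^sub>R Du x)"
    by (rule set_lebesgue_integral_absorb) (use K in auto)
  ultimately show "(LINT x|lebesgue. u x *\<^sub>R D\<psi> x) = - (LINT x|lebesgue. \<psi> x *\<^sub>R Du x)" by simp
qed

lemma absolutely_integrable_UNIV_imp: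
  fixes f :: "real^'n \<Rightarrow> 'b::euclidean_space"
  assumes "integrable lebesgue f" shows "locally_integrable \<Omega> f" "S \<in> sets lebesgue \<Longrightarrow> f absolutely_integrable_on S"
proof -
  show *: "f absolutely_integrable_on S" if "S \<in> sets lebesgue" for S
    unfolding set_integrable_def by (rule integrable_mult_indicator[OF that assms])
  show "locally_integrable \<Omega> f"
    unfolding locally_integrable_def by (auto intro!: * lmeasurable_compact fmeasurableD)
qed

lemma weak_gradientI:
  fixes u :: "real^'n \<Rightarrow> real"
  assumes "locally_integrable \<Omega> u" "locally_integrable \<Omega> Du"
    and eq: "\<And>\<psi> D\<psi>. test_function UNIV \<psi> \<Longrightarrow> \<forall>x. GDERIV \<psi> x :> D\<psi> x \<Longrightarrow>
      (LINT x|lebesgue. u x *\<^sub>R D\<psi> x) = - (LINT x|lebesgue. \<psi> x *\<^sub>R Du x)"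
  shows "weak_gradient \<Omega> u Du"
  unfolding weak_gradient_def
proof (intro conjI allI impI, goal_cases)
  case (3 \<psi> D\<psi>)
  then have t: "test_function \<Omega> \<psi>" and d: "\<forall>x. GDERIV \<psi> x :> D\<psi> x" by auto
  obtain K where K: "compact K" "K \<subseteq> \<Omega>" "\<And>x. x \<notin> K \<Longrightarrow> \<psi> x = 0 \<and> D\<psi> x = 0"
    using test_function_bounds[OF t d] by metis
  from t have t': "test_function UNIV \<psi>" by (auto simp: test_function_def)
  have "(LINT x:\<Omega>|lebesgue. u x *\<^sub>R D\<psi> x) = (LINT x|lebesgue. u x *\<^sub>R D\<psi> x)"
    by (rule set_lebesgue_integral_absorb) (use K in auto)
  moreover have "(LINT x:\<Omega>|lebesgue. \<psi> x *\<^sub>R Du x) = (LINT x|lebesgue. \<psi> x *\<^sub>R Du x)"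
    by (rule set_lebesgue_integral_absorb) (use K in auto)
  ultimately show ?case using eq[OF t' d] by simp
qed (use assms(1,2) in auto)

text \<open>Leibniz rule, from testing the equation of \<open>u\<close> with
  \<open>\<zeta> x * \<psi> x\<close>. As \<zeta> has compact support in \<Omega>, the product is in
  effect extended by 0, so \<open>\<Omega>'\<close> is arbitrary; the localisation takes the whole
  space.\<close>

lemma weak_gradient_mult_test:
  fixes u :: "real^'n \<Rightarrow> real"
  assumes wg: "weak_gradient \<Omega> u Du" and t: "test_function \<Omega> \<zeta>" and d: "\<forall>x. GDERIV \<zeta> x :> D\<zeta> x"
  shows "integrable lebesgue (\<lambda>x. \<zeta> x * u x)" "integrable lebesgue (\<lambda>x. \<zeta> x *\<^sub>R Du x + u x *\<^sub>R D\<zeta> x)"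
    "weak_gradient \<Omega>' (\<lambda>x. \<zeta> x * u x) (\<lambda>x. \<zeta> x *\<^sub>R Du x + u x *\<^sub>R D\<zeta> x)"
proof -
  obtain K C where K: "compact K" "K \<subseteq> \<Omega>" "\<And>x. x \<notin> K \<Longrightarrow> \<zeta> x = 0 \<and> D\<zeta> x = 0"
    "\<And>x. \<bar>\<zeta> x\<bar> \<le> C" "\<And>x. norm (D\<zeta> x) \<le> C"
    "continuous_on UNIV \<zeta>" "continuous_on UNIV D\<zeta>" using test_function_bounds[OF t d] by metis
  have i: "u absolutely_integrable_on K" "Du absolutely_integrable_on K"
    using wg K(1,2) unfolding weak_gradient_def locally_integrable_def by blast+
  have "integrable lebesgue (\<lambda>x. \<zeta> x *\<^sub>R u x)"
    by (rule integrable_bounded_scaleR[OF i(1), where C=C]) (use K borel_measurable_continuous_onI in auto)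
  then show 1: "integrable lebesgue (\<lambda>x. \<zeta> x * u x)" by simp
  show 2: "integrable lebesgue (\<lambda>x. \<zeta> x *\<^sub>R Du x + u x *\<^sub>R D\<zeta> x)"
    using weak_gradientD(1,2)[OF wg t d] by simp
  show "weak_gradient \<Omega>' (\<lambda>x. \<zeta> x * u x) (\<lambda>x. \<zeta> x *\<^sub>R Du x + u x *\<^sub>R D\<zeta> x)"
  proof (rule weak_gradientI[OF absolutely_integrable_UNIV_imp(1)[OF 1] absolutely_integrable_UNIV_imp(1)[OF 2]])
    fix \<psi> :: "real^'n \<Rightarrow> real" and D\<psi> assume t': "test_function UNIV \<psi>" and d': "\<forall>x. GDERIV \<psi> x :> D\<psi> x"
    obtain K' C' where K': "\<And>x. \<bar>\<psi> x\<bar> \<le> C'" "\<And>x. norm (D\<psi> x) \<le> C'"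
      "continuous_on UNIV \<psi>" "continuous_on UNIV D\<psi>" using test_function_bounds[OF t' d'] by metis
    have t2: "test_function \<Omega> (\<lambda>x. \<zeta> x * \<psi> x)"
      using t t' by (auto simp: test_function_def intro: Ck_mult)
    have d2: "\<forall>x. GDERIV (\<lambda>x. \<zeta> x * \<psi> x) x :> \<zeta> x *\<^sub>R D\<psi> x + \<psi> x *\<^sub>R D\<zeta> x"
      using d d' by (intro allI GDERIV_mult) auto
    note w = weak_gradientD[OF wg t2 d2]
    have norm_le: "norm (\<psi> x *\<^sub>R D\<zeta> x) \<le> C' * C" for x
      using K'(1)[of x] K(5)[of x] by (auto intro!: mult_mono order_trans[OF abs_ge_zero K'(1)])
    have i1: "integrable lebesgue (\<lambda>x. u x *\<^sub>R (\<psi> x *\<^sub>R D\<zeta> x))"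
      by (rule integrable_bounded_scaleR'[OF i(1) _ _ norm_le])
        (use K K' in \<open>auto intro!: borel_measurable_continuous_onI continuous_on_scaleR\<close>)
    have "(LINT x|lebesgue. (\<zeta> x * u x) *\<^sub>R D\<psi> x) =
        (LINT x|lebesgue. u x *\<^sub>R (\<zeta> x *\<^sub>R D\<psi> x + \<psi> x *\<^sub>R D\<zeta> x) - u x *\<^sub>R (\<psi> x *\<^sub>R D\<zeta> x))"
      by (intro Bochner_Integration.integral_cong) (auto simp: algebra_simps)
    also have "\<dots> = - (LINT x|lebesgue. (\<zeta> x * \<psi> x) *\<^sub>R Du x) - (LINT x|lebesgue. u x *\<^sub>R (\<psi> x *\<^sub>R D\<zeta> x))"
      using w i1 by (subst Bochner_Integration.integral_diff) auto
    also have "\<dots> = - (LINT x|lebesgue. (\<zeta> x * \<psi> x) *\<^sub>R Du x + u x *\<^sub>R (\<psi> x *\<^sub>R D\<zeta> x))"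
      using w i1 by (subst Bochner_Integration.integral_add) auto
    also have "\<dots> = - (LINT x|lebesgue. \<psi> x *\<^sub>R (\<zeta> x *\<^sub>R Du x + u x *\<^sub>R D\<zeta> x))"
      by (intro arg_cong[where f=uminus] Bochner_Integration.integral_cong) (auto simp: algebra_simps)
    finally show "(LINT x|lebesgue. (\<zeta> x * u x) *\<^sub>R D\<psi> x) = - (LINT x|lebesgue. \<psi> x *\<^sub>R (\<zeta> x *\<^sub>R Du x + u x *\<^sub>R D\<zeta> x))" .
  qed
qed

lemma weak_gradient_subset:
  assumes "weak_gradient \<Omega> u Du" "\<Omega>' \<subseteq> \<Omega>"
  shows "weak_gradient \<Omega>' u Du"
  unfolding weak_gradient_def
proof (intro conjI allI impI, goal_cases)
  case (3 \<psi> D\<psi>)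
  then have t: "test_function \<Omega>' \<psi>" and d: "\<forall>x. GDERIV \<psi> x :> D\<psi> x" by auto
  obtain K where K: "compact K" "K \<subseteq> \<Omega>'" "\<And>x. x \<notin> K \<Longrightarrow> \<psi> x = 0 \<and> D\<psi> x = 0"
    using test_function_bounds[OF t d] by metis
  from t assms(2) have t': "test_function \<Omega> \<psi>" by (auto simp: test_function_def)
  have "(LINT x:\<Omega>'|lebesgue. u x *\<^sub>R D\<psi> x) = (LINT x|lebesgue. u x *\<^sub>R D\<psi> x)"
    by (rule set_lebesgue_integral_absorb) (use K in auto)
  moreover have "(LINT x:\<Omega>'|lebesgue. \<psi> x *\<^sub>R Du x) = (LINT x|lebesgue. \<psi> x *\<^sub>R Du x)"
    by (rule set_lebesgue_integral_absorb) (use K in auto)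
  ultimately show ?case using weak_gradientD(3)[OF assms(1) t' d] by simp
qed (use assms in \<open>auto simp: weak_gradient_def locally_integrable_def\<close>)

text \<open>The energy bound and the weak equation each come with a gradient of their own; this
  identifies the two.\<close>

lemma weak_gradient_unique:
  fixes u :: "real^'n \<Rightarrow> real"
  assumes "open \<Omega>" "weak_gradient \<Omega> u Du" "weak_gradient \<Omega> u Du'"
  shows "AE x in lebesgue. x \<in> \<Omega> \<longrightarrow> Du x = Du' x"
proof -
  have "AE x in lebesgue. x \<in> \<Omega> \<longrightarrow> (Du x - Du' x) $ i = 0" for i
  proof (rule fundamental_lemma[OF assms(1)])
    have "(\<lambda>x. Du x - Du' x) absolutely_integrable_on K" if "compact K" "K \<subseteq> \<Omega>" for K
      using assms(2,3) that unfolding weak_gradient_def locally_integrable_def by auto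
    then show "locally_integrable \<Omega> (\<lambda>x. (Du x - Du' x) $ i)"
      unfolding locally_integrable_def
      using absolutely_integrable_linear[OF _ bounded_linear_vec_nth[of i], unfolded o_def] by blast
    fix \<psi> assume t: "test_function \<Omega> \<psi>"
    then have "Ck (Suc 0) \<psi>" unfolding test_function_def by blast
    then obtain D\<psi> where d: "\<forall>x. GDERIV \<psi> x :> D\<psi> x" by auto
    note w = weak_gradientD[OF assms(2) t d] weak_gradientD[OF assms(3) t d]
    have int: "integrable lebesgue (\<lambda>x. \<psi> x *\<^sub>R (Du x - Du' x))"
      using w by (simp add: scaleR_diff_right)
    have "(LINT x|lebesgue. \<psi> x * (Du x - Du' x) $ i) = (LINT x|lebesgue. \<psi> x *\<^sub>R (Du x - Du' x)) $ i"
      using integral_bounded_linear[OF bounded_linear_vec_nth[of i] int] by simp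
    also have "(LINT x|lebesgue. \<psi> x *\<^sub>R (Du x - Du' x)) = 0"
      using w by (simp add: scaleR_diff_right)
    finally show "(LINT x|lebesgue. \<psi> x * (Du x - Du' x) $ i) = 0" by simp
  qed
  then have "AE x in lebesgue. \<forall>i. x \<in> \<Omega> \<longrightarrow> (Du x - Du' x) $ i = 0"
    by (subst AE_all_countable) blast
  then show ?thesis by eventually_elim (auto simp: vec_eq_iff)
qed

text \<open>Translations and Fubini are carried out in \<open>lborel\<close> and ask for Borel
  functions, whereas Sobolev functions are only Lebesgue measurable.\<close>

lemma borel_representative_real:
  fixes f :: "'a::euclidean_space \<Rightarrow> real"
  assumes "integrable lebesgue f"
  obtains f0 where "f0 \<in> borel_measurable borel" "integrable lborel f0" "AE x in lebesgue. f x = f0 x"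
proof -
  obtain f0 where h0: "f0 \<in> borel_measurable lborel" "AE x in lborel. f x = f0 x"
    using completion_ex_borel_measurable_real[OF borel_measurable_integrable[OF assms]] by auto
  have AE0: "AE x in lebesgue. f x = f0 x" using h0(2) by (rule AE_completion)
  have "integrable lebesgue f0"
    using assms AE0 h0(1) by (subst integrable_cong_AE[of _ _ f]) (auto simp: measurable_completion)
  then have "integrable lborel f0" using h0(1) by (simp add: integrable_completion)
  then show ?thesis using that AE0 h0(1) by auto
qed

lemma borel_representative_vec:
  fixes f :: "'a::euclidean_space \<Rightarrow> real^'n"
  assumes "integrable lebesgue f"
  obtains f0 where "f0 \<in> borel_measurable borel" "integrable lborel f0" "AE x in lebesgue. f x = f0 x"
proof -
  have "\<exists>f0. f0 \<in> borel_measurable borel \<and> integrable lborel f0 \<and> (AE x in lebesgue. f x $ i = f0 x)" for i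
    using borel_representative_real[OF integrable_bounded_linear[OF bounded_linear_vec_nth[of i] assms]] by metis
  then obtain h where h: "\<And>i. h i \<in> borel_measurable borel" "\<And>i. integrable lborel (h i)"
    "\<And>i. AE x in lebesgue. f x $ i = h i x" by metis
  define f0 where "f0 x = (\<chi> i. h i x)" for x
  have sum: "f0 x = (\<Sum>i\<in>UNIV. h i x *\<^sub>R axis i 1)" for x
    by (simp add: f0_def vec_eq_iff axis_def if_distrib cong: if_cong)
  have "f0 \<in> borel_measurable borel" unfolding sum[abs_def] using h(1)
    by (intro borel_measurable_sum borel_measurable_scaleR) auto
  moreover have "integrable lborel f0" unfolding sum[abs_def] using h(2)
    by (intro Bochner_Integration.integrable_sum integrable_scaleR_left) auto
  moreover have "AE x in lebesgue. \<forall>i. f x $ i = h i x" using h(3) by (simp add: AE_all_countable)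
  then have "AE x in lebesgue. f x = f0 x" by eventually_elim (simp add: f0_def vec_eq_iff)
  ultimately show ?thesis using that by blast
qed

section \<open>Integration along segments\<close>

lemma GDERIV_translate:
  assumes "GDERIV f (x - a) :> D" shows "GDERIV (\<lambda>x. f (x - a)) x :> D"
proof -
  have "((\<lambda>x. x - a) has_derivative (\<lambda>h. h)) (at x)" by (auto intro!: derivative_eq_intros)
  from has_derivative_compose[OF this, of f] assms show ?thesis by (simp add: gderiv_def)
qed

lemma Ck_translate: "Ck k f \<Longrightarrow> Ck k (\<lambda>x. f (x - a))"
proof (induction k arbitrary: f)
  case 0
  then show ?case by (auto intro!: continuous_on_compose2[of UNIV f] continuous_intros)
next
  case (Suc k)
  then obtain Df where D: "\<forall>x. GDERIV f x :> Df x" "\<forall>i. Ck k (\<lambda>x. Df x $ i)" by auto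
  have "GDERIV (\<lambda>x. f (x - a)) x :> Df (x - a)" for x
    using D(1) by (intro GDERIV_translate) auto
  with D Suc.IH show ?case by (auto intro!: exI[of _ "\<lambda>x. Df (x - a)"])
qed

lemma nn_integral_lborel_shift:
  fixes f :: "'a::euclidean_space \<Rightarrow> ennreal"
  assumes "f \<in> borel_measurable borel"
  shows "(\<integral>\<^sup>+x. f (x + a) \<partial>lborel) = (\<integral>\<^sup>+x. f x \<partial>lborel)"
  using nn_integral_distr[of "(+) a" lborel borel f] assms lborel_distr_plus[of a] by (simp add: add.commute)

lemma integral_lborel_shift:
  fixes f :: "'a::euclidean_space \<Rightarrow> 'b::euclidean_space"
  assumes "f \<in> borel_measurable borel"
  shows "(LINT x|lborel. f (x + a)) = (LINT x|lborel. f x)"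
    "integrable lborel f \<Longrightarrow> integrable lborel (\<lambda>x. f (x + a))"
  using integral_distr[of "(+) a" lborel borel f] integrable_distr_eq[of "(+) a" lborel borel f]
    assms lborel_distr_plus[of a] by (simp_all add: add.commute)

text \<open>For fixed \<open>t\<close> the map \<open>x \<mapsto> x + t *\<^sub>R h\<close>
  preserves the measure, so the integrand on the product has mass at most C times the L^1 norm of
  \<open>f\<close>. The weight \<open>w\<close> leaves room for test functions that depend on both
  variables.\<close>

lemma segment_Fubini:
  fixes f :: "'a::euclidean_space \<Rightarrow> real" and w :: "'a \<times> real \<Rightarrow> real" and h :: 'a
  assumes f[measurable]: "f \<in> borel_measurable borel" and fi: "integrable lborel f"
    and w[measurable]: "w \<in> borel_measurable borel" and C: "\<And>z. \<bar>w z\<bar> \<le> C"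
  shows "(LINT x|lborel. (LINT t:{0..1}|lborel. w (x, t) * f (x + t *\<^sub>R h))) =
         (LINT t:{0..1}|lborel. (LINT x|lborel. w (x, t) * f (x + t *\<^sub>R h)))" (is ?A)
    "integrable lborel (\<lambda>x. LINT t:{0..1}|lborel. w (x, t) * f (x + t *\<^sub>R h))" (is ?B)
    "AE x in lborel. set_integrable lborel {0..1} (\<lambda>t. w (x, t) * f (x + t *\<^sub>R h))" (is ?C)
proof -
  define P where "P x t = indicator {0..1::real} t *\<^sub>R (w (x, t) * f (x + t *\<^sub>R h))" for x t
  have w'[measurable]: "w \<in> borel_measurable (lborel \<Otimes>\<^sub>M lborel)"
    using w by (simp add: lborel_prod)
  have m[measurable]: "case_prod P \<in> borel_measurable (lborel \<Otimes>\<^sub>M lborel)"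
    unfolding P_def by measurable
  have "(\<integral>\<^sup>+z. ennreal (norm (case_prod P z)) \<partial>(lborel \<Otimes>\<^sub>M lborel)) = (\<integral>\<^sup>+t. \<integral>\<^sup>+x. ennreal (norm (P x t)) \<partial>lborel \<partial>lborel)"
    by (subst lborel_pair.nn_integral_snd[symmetric]) auto
  also have "\<dots> \<le> (\<integral>\<^sup>+t. ennreal C * (\<integral>\<^sup>+x. ennreal (norm (f x)) \<partial>lborel) * indicator {0..1::real} t \<partial>lborel)"
  proof (rule nn_integral_mono)
    fix t :: real
    have "(\<integral>\<^sup>+x. ennreal (norm (P x t)) \<partial>lborel) \<le> (\<integral>\<^sup>+x. (ennreal C * indicator {0..1} t) * ennreal (norm (f (x + t *\<^sub>R h))) \<partial>lborel)"
      using C by (intro nn_integral_mono)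
        (auto simp: P_def indicator_def abs_mult ennreal_mult'[symmetric] order_trans[OF abs_ge_zero C] intro!: ennreal_leI mult_right_mono)
    also have "\<dots> = (ennreal C * indicator {0..1} t) * (\<integral>\<^sup>+x. ennreal (norm (f (x + t *\<^sub>R h))) \<partial>lborel)"
      by (rule nn_integral_cmult) measurable
    also have "(\<integral>\<^sup>+x. ennreal (norm (f (x + t *\<^sub>R h))) \<partial>lborel) = (\<integral>\<^sup>+x. ennreal (norm (f x)) \<partial>lborel)"
      by (rule nn_integral_lborel_shift) measurable
    finally show "(\<integral>\<^sup>+x. ennreal (norm (P x t)) \<partial>lborel) \<le> ennreal C * (\<integral>\<^sup>+x. ennreal (norm (f x)) \<partial>lborel) * indicator {0..1} t"
      by (simp add: mult_ac)
  qed
  also have "\<dots> = ennreal C * (\<integral>\<^sup>+x. ennreal (norm (f x)) \<partial>lborel)"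
    by (subst nn_integral_cmult_indicator) auto
  also have "\<dots> < \<infinity>" using fi by (simp add: integrable_iff_bounded ennreal_mult_less_top)
  finally have int: "integrable (lborel \<Otimes>\<^sub>M lborel) (case_prod P)"
    using m by (simp add: integrable_iff_bounded)
  show ?A
    using lborel_pair.Fubini_integral[OF int]
    by (simp add: P_def set_lebesgue_integral_def)
  show ?B
    using lborel_pair.integrable_fst'[OF int] by (simp add: P_def set_lebesgue_integral_def)
  show ?C
    using lborel_pair.AE_integrable_fst'[OF int] by (simp add: P_def set_integrable_def)
qed

text \<open>The exceptional null set may depend on \<open>h\<close>. The values of \<open>V\<close>
  are integrated over the whole space, so that segments may leave any given ball.\<close>

definition line_primitive :: "('a::euclidean_space \<Rightarrow> real) \<Rightarrow> ('a \<Rightarrow> 'a) \<Rightarrow> bool" where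
  "line_primitive U V \<longleftrightarrow> U \<in> borel_measurable borel \<and> V \<in> borel_measurable borel \<and> integrable lborel V \<and>
     (\<forall>h. AE x in lborel. U (x + h) - U x = (LINT t:{0..1}|lborel. V (x + t *\<^sub>R h) \<bullet> h))"

lemma set_integral_unit_eq_integral:
  fixes f :: "real \<Rightarrow> real"
  assumes "continuous_on {0..1} f"
  shows "(LINT t:{0..1}|lborel. f t) = integral {0..1} f" "set_integrable lborel {0..1} f"
proof -
  show "set_integrable lborel {0..1} f"
    using borel_integrable_compact[OF _ assms] by (simp add: set_integrable_def)
  then show "(LINT t:{0..1}|lborel. f t) = integral {0..1} f" by (rule set_borel_integral_eq_integral)
qed

lemma test_function_segment:
  fixes \<psi> :: "real^'n \<Rightarrow> real"
  assumes d: "\<forall>x. GDERIV \<psi> x :> D\<psi> x" and c: "continuous_on UNIV D\<psi>"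
  shows "\<psi> (x - h) - \<psi> x = (LINT t:{0..1}|lborel. - (D\<psi> (x - t *\<^sub>R h) \<bullet> h))"
proof -
  have D: "((\<lambda>t. \<psi> (x - t *\<^sub>R h)) has_vector_derivative - (D\<psi> (x - t *\<^sub>R h) \<bullet> h)) (at t within {0..1})" for t
  proof -
    have "((\<lambda>t. x - t *\<^sub>R h) has_derivative (\<lambda>s. - (s *\<^sub>R h))) (at t within {0..1})"
      by (auto intro!: derivative_eq_intros)
    then have "((\<lambda>t. \<psi> (x - t *\<^sub>R h)) has_derivative (\<lambda>s. (- (s *\<^sub>R h)) \<bullet> D\<psi> (x - t *\<^sub>R h))) (at t within {0..1})"
      using has_derivative_compose[of "\<lambda>t. x - t *\<^sub>R h" "\<lambda>s. - (s *\<^sub>R h)" t "{0..1}" \<psi> "\<lambda>k. k \<bullet> D\<psi> (x - t *\<^sub>R h)"] d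
      by (simp add: gderiv_def)
    then show ?thesis by (simp add: has_vector_derivative_def inner_commute)
  qed
  have "((\<lambda>t. - (D\<psi> (x - t *\<^sub>R h) \<bullet> h)) has_integral \<psi> (x - 1 *\<^sub>R h) - \<psi> (x - 0 *\<^sub>R h)) {0..1}"
    using D by (intro fundamental_theorem_of_calculus) auto
  then have "integral {0..1} (\<lambda>t. - (D\<psi> (x - t *\<^sub>R h) \<bullet> h)) = \<psi> (x - h) - \<psi> x"
    by (subst integral_unique) auto
  moreover have "continuous_on {0..1} (\<lambda>t. - (D\<psi> (x - t *\<^sub>R h) \<bullet> h))"
    by (intro continuous_intros continuous_on_compose2[OF c]) auto
  ultimately show ?thesis by (simp only: set_integral_unit_eq_integral(1))
qed

text \<open>Test the defect of the identity with \<psi>. After shifting the variable, the difference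
  falls on \<psi>; the fundamental theorem of calculus writes it as an integral over
  \<open>t\<close>, and for each \<open>t\<close> the weak equation with the translated test
  function turns it into the integral of \<open>V\<close>. The fundamental lemma concludes.\<close>

lemma weak_gradient_line_primitive:
  fixes U :: "real^'n \<Rightarrow> real"
  assumes U[measurable]: "U \<in> borel_measurable borel" and V[measurable]: "V \<in> borel_measurable borel"
    and Ui: "integrable lborel U" and Vi: "integrable lborel V" and wg: "weak_gradient UNIV U V"
  shows "line_primitive U V"
  unfolding line_primitive_def
proof (intro conjI allI U V Vi)
  fix h :: "real^'n"
  define f where "f x = V x \<bullet> h" for x
  have f[measurable]: "f \<in> borel_measurable borel" unfolding f_def by measurable
  have fi: "integrable lborel f" unfolding f_def using Vi by (intro integrable_inner_left) auto
  define I where "I x = (LINT t:{0..1}|lborel. f (x + t *\<^sub>R h))" for x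
  define d where "d x = U (x + h) - U x - I x" for x
  have Ii: "integrable lborel I"
    using segment_Fubini(2)[OF f fi, of "\<lambda>_. 1" 1 h] by (simp add: I_def[abs_def])
  have Im[measurable]: "I \<in> borel_measurable borel" using Ii by (simp add: borel_measurable_integrable)
  have di: "integrable lborel d" unfolding d_def
    using Ui Ii integral_lborel_shift(2)[OF U Ui, of h] by auto
  have dm[measurable]: "d \<in> borel_measurable borel" using di by (simp add: borel_measurable_integrable)
  have dl: "integrable lebesgue d" using di by (simp add: integrable_completion)
  have "AE x in lebesgue. x \<in> UNIV \<longrightarrow> d x = 0"
  proof (rule fundamental_lemma)
    show "locally_integrable UNIV d" using dl by (rule absolutely_integrable_UNIV_imp)
    fix \<psi> :: "real^'n \<Rightarrow> real" assume t: "test_function UNIV \<psi>"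
    then have "Ck (Suc 0) \<psi>" unfolding test_function_def by blast
    then obtain D\<psi> where dd: "\<forall>x. GDERIV \<psi> x :> D\<psi> x" by auto
    obtain K C where K: "compact K" "\<And>x. x \<notin> K \<Longrightarrow> \<psi> x = 0 \<and> D\<psi> x = 0"
      "\<And>x. \<bar>\<psi> x\<bar> \<le> C" "\<And>x. norm (D\<psi> x) \<le> C" "C > 0"
      "continuous_on UNIV \<psi>" "continuous_on UNIV D\<psi>" using test_function_bounds[OF t dd] by metis
    have \<psi>m[measurable]: "\<psi> \<in> borel_measurable borel" "D\<psi> \<in> borel_measurable borel"
      using K borel_measurable_continuous_onI by auto
    have wm: "(\<lambda>z::(real^'n) \<times> real. \<psi> (fst z)) \<in> borel_measurable borel"
      by (intro borel_measurable_continuous_onI continuous_on_compose2[OF K(6)] continuous_intros) auto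
    have wm2: "(\<lambda>z::(real^'n) \<times> real. - (D\<psi> (fst z - snd z *\<^sub>R h) \<bullet> h)) \<in> borel_measurable borel"
      by (intro borel_measurable_continuous_onI continuous_intros continuous_on_compose2[OF K(7)]) auto
    have bi: "integrable lborel (\<lambda>x. \<psi> (x - a) * g x)" if "integrable lborel g" "g \<in> borel_measurable borel" for g :: "real^'n \<Rightarrow> real" and a
      by (rule Bochner_Integration.integrable_bound[of _ "\<lambda>x. C * g x"])
        (use that K(3,5) in \<open>auto simp: abs_mult intro!: mult_right_mono\<close>)
    have 1: "(LINT x|lborel. \<psi> x * I x) = (LINT t:{0..1}|lborel. (LINT x|lborel. \<psi> (x - t *\<^sub>R h) * f x))"
    proof -
      have "(LINT x|lborel. \<psi> x * I x) = (LINT x|lborel. (LINT t:{0..1}|lborel. \<psi> x * f (x + t *\<^sub>R h)))"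
        by (simp add: I_def)
      moreover have "\<dots> = (LINT t:{0..1}|lborel. (LINT x|lborel. \<psi> x * f (x + t *\<^sub>R h)))"
        using segment_Fubini(1)[OF f fi wm, of C h] K(3) by simp
      moreover have "(LINT x|lborel. \<psi> x * f (x + t *\<^sub>R h)) = (LINT x|lborel. \<psi> (x - t *\<^sub>R h) * f x)" for t
        using integral_lborel_shift(1)[of "\<lambda>x. \<psi> (x - t *\<^sub>R h) * f x" "t *\<^sub>R h"] by simp
      ultimately show ?thesis by (simp only:)
    qed
    have 2: "(LINT x|lborel. U x * (\<psi> (x - h) - \<psi> x)) = (LINT t:{0..1}|lborel. (LINT x|lborel. \<psi> (x - t *\<^sub>R h) * f x))"
    proof -
      have Cb: "\<bar>- (D\<psi> y \<bullet> h)\<bar> \<le> C * norm h" for y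
        using Cauchy_Schwarz_ineq2[of "D\<psi> y" h] mult_right_mono[OF K(4)[of y], of "norm h"] by simp
      have "(LINT x|lborel. U x * (\<psi> (x - h) - \<psi> x)) =
          (LINT x|lborel. (LINT t:{0..1}|lborel. - (D\<psi> (x - t *\<^sub>R h) \<bullet> h) * U (x + t *\<^sub>R 0)))"
        unfolding test_function_segment[OF dd K(7)]
        by (simp only: scaleR_zero_right add_0_right set_integral_mult_left mult.commute[of "U _"])
      moreover have "\<dots> = (LINT t:{0..1}|lborel. (LINT x|lborel. - (D\<psi> (x - t *\<^sub>R h) \<bullet> h) * U (x + t *\<^sub>R 0)))"
        using segment_Fubini(1)[OF U Ui wm2, of "C * norm h" 0] Cb by simp
      moreover have "(LINT x|lborel. - (D\<psi> (x - t *\<^sub>R h) \<bullet> h) * U (x + t *\<^sub>R 0)) = (LINT x|lborel. \<psi> (x - t *\<^sub>R h) * f x)" for t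
      proof -
        have t': "test_function UNIV (\<lambda>x. \<psi> (x - t *\<^sub>R h))"
          using t K(1,2) unfolding test_function_def
          by (auto intro!: Ck_translate exI[of _ "(+) (t *\<^sub>R h) ` K"] compact_translation)
            (metis add.commute diff_add_cancel image_eqI)
        have dd': "\<forall>x. GDERIV (\<lambda>x. \<psi> (x - t *\<^sub>R h)) x :> D\<psi> (x - t *\<^sub>R h)"
          using dd by (intro allI GDERIV_translate) auto
        note w = weak_gradientD[OF wg t' dd']
        have m: "(\<lambda>x. U x *\<^sub>R D\<psi> (x - t *\<^sub>R h)) \<in> borel_measurable lborel"
          "(\<lambda>x. \<psi> (x - t *\<^sub>R h) *\<^sub>R V x) \<in> borel_measurable lborel" by measurable
        have i: "integrable lborel (\<lambda>x. U x *\<^sub>R D\<psi> (x - t *\<^sub>R h))" "integrable lborel (\<lambda>x. \<psi> (x - t *\<^sub>R h) *\<^sub>R V x)"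
          using w(1,2) m by (simp_all add: integrable_completion)
        have "(LINT x|lborel. U x *\<^sub>R D\<psi> (x - t *\<^sub>R h)) = - (LINT x|lborel. \<psi> (x - t *\<^sub>R h) *\<^sub>R V x)"
          using w(3) m by (simp add: integral_completion)
        then have "(LINT x|lborel. U x *\<^sub>R D\<psi> (x - t *\<^sub>R h)) \<bullet> h = - ((LINT x|lborel. \<psi> (x - t *\<^sub>R h) *\<^sub>R V x) \<bullet> h)" by simp
        then have "(LINT x|lborel. (U x *\<^sub>R D\<psi> (x - t *\<^sub>R h)) \<bullet> h) = - (LINT x|lborel. (\<psi> (x - t *\<^sub>R h) *\<^sub>R V x) \<bullet> h)"
          using i by (subst (1 2) integral_inner_left) auto
        then show ?thesis by (simp add: f_def mult.commute)
      qed
      ultimately show ?thesis by (simp only:)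
    qed
    have bi0: "integrable lborel (\<lambda>x. \<psi> x * g x)" if "integrable lborel g" "g \<in> borel_measurable borel" for g :: "real^'n \<Rightarrow> real"
      using bi[OF that, of 0] by simp
    have "(LINT x|lebesgue. \<psi> x * d x) = (LINT x|lborel. \<psi> x * d x)"
      by (rule integral_completion) measurable
    also have "\<dots> = (LINT x|lborel. \<psi> x * U (x + h) - \<psi> x * U x - \<psi> x * I x)"
      by (simp add: d_def algebra_simps)
    also have "\<dots> = (LINT x|lborel. \<psi> x * U (x + h)) - (LINT x|lborel. \<psi> x * U x) - (LINT x|lborel. \<psi> x * I x)"
      using bi0[OF integral_lborel_shift(2)[OF U Ui]] bi0[OF Ui] bi0[OF Ii] by simp
    also have "(LINT x|lborel. \<psi> x * U (x + h)) = (LINT x|lborel. \<psi> (x - h) * U x)"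
      using integral_lborel_shift(1)[of "\<lambda>x. \<psi> (x - h) * U x" h] by simp
    also have "\<dots> - (LINT x|lborel. \<psi> x * U x) = (LINT x|lborel. U x * (\<psi> (x - h) - \<psi> x))"
      using bi[OF Ui, of h] bi0[OF Ui] by (simp add: algebra_simps)
    finally show "(LINT x|lebesgue. \<psi> x * d x) = 0" using 1 2 by simp
  qed auto
  then have "AE x in lborel. d x = 0" 
    by (subst (asm) AE_completion_iff) auto
  then show "AE x in lborel. U (x + h) - U x = (LINT t:{0..1}|lborel. V (x + t *\<^sub>R h) \<bullet> h)"
    by eventually_elim (simp add: d_def I_def f_def)
qed

lemma integral_bounded_by_norm:
  fixes f :: "'a \<Rightarrow> real"
  assumes "integrable M g" "f \<in> borel_measurable M" "\<And>x. \<bar>f x\<bar> \<le> C * g x"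
  shows "\<bar>LINT x|M. f x\<bar> \<le> C * (LINT x|M. g x)"
proof -
  have i: "integrable M f"
    by (rule Bochner_Integration.integrable_bound[of _ "\<lambda>x. C * g x"])
      (use assms in \<open>auto intro: order_trans[OF _ abs_ge_self]\<close>)
  have "\<bar>LINT x|M. f x\<bar> \<le> (LINT x|M. \<bar>f x\<bar>)" by (rule integral_abs_bound)
  also have "\<dots> \<le> (LINT x|M. C * g x)"
    using assms i by (intro integral_mono) auto
  finally show ?thesis using assms(1) by simp
qed

text \<open>Take difference quotients with steps \<open>s m\<close> tending to 0. On the side of
  \<psi> they converge to the derivative, dominated by the Lipschitz bound. On the side of
  \<open>W\<close> the segment identity makes them averages of translates of \<psi> against
  \<open>X\<close>, which converge at the rate \<open>s m\<close> by the same Lipschitz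
  bound.\<close>

lemma line_primitive_weak_gradient:
  fixes W :: "real^'n \<Rightarrow> real"
  assumes lp: "line_primitive W X" and bd: "\<And>x. \<bar>W x\<bar> \<le> CW"
  shows "weak_gradient \<Omega> W X"
proof (rule weak_gradientI)
  have W[measurable]: "W \<in> borel_measurable borel" and X[measurable]: "X \<in> borel_measurable borel"
    and Xi: "integrable lborel X" using lp by (auto simp: line_primitive_def)
  have Xl: "integrable lebesgue X" using Xi by (simp add: integrable_completion)
  then show "locally_integrable \<Omega> X" by (rule absolutely_integrable_UNIV_imp)
  have WK: "integrable lborel (\<lambda>x. indicator K x * W x)" if "compact K" for K
  proof (rule Bochner_Integration.integrable_bound[of _ "\<lambda>x. CW * indicator K x"])
    show "integrable lborel (\<lambda>x. CW * indicat_real K x)"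
      using that emeasure_compact_finite[OF that] by (intro integrable_mult_right integrable_real_indicator) (auto intro: borel_closed compact_imp_closed)
    show "(\<lambda>x. indicat_real K x * W x) \<in> borel_measurable lborel"
      using borel_closed[OF compact_imp_closed[OF that]] W by (intro borel_measurable_times borel_measurable_indicator) auto
  qed (use bd in \<open>auto simp: indicator_def intro!: AE_I2 order_trans[OF bd abs_ge_self]\<close>)
  show "locally_integrable \<Omega> W"
    unfolding locally_integrable_def set_integrable_def using WK by (auto simp: integrable_completion)
  have CW: "CW \<ge> 0" using order_trans[OF abs_ge_zero bd] .
  fix \<psi> :: "real^'n \<Rightarrow> real" and D\<psi>
  assume t: "test_function UNIV \<psi>" and dd: "\<forall>x. GDERIV \<psi> x :> D\<psi> x"
  obtain K C where K: "compact K" "\<And>x. x \<notin> K \<Longrightarrow> \<psi> x = 0 \<and> D\<psi> x = 0"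
    "\<And>x. \<bar>\<psi> x\<bar> \<le> C" "\<And>x. norm (D\<psi> x) \<le> C" "C > 0"
    "continuous_on UNIV \<psi>" "continuous_on UNIV D\<psi>" using test_function_bounds[OF t dd] by metis
  have \<psi>m[measurable]: "\<psi> \<in> borel_measurable borel" "D\<psi> \<in> borel_measurable borel"
    using K borel_measurable_continuous_onI by auto
  have lip: "\<bar>\<psi> (x - h) - \<psi> x\<bar> \<le> C * norm h" for x h
  proof -
    have "norm (\<psi> (x - h) - \<psi> x) \<le> C * norm (x - h - x)"
    proof (rule differentiable_bound[of UNIV])
      show "(\<psi> has_derivative (\<lambda>k. k \<bullet> D\<psi> y)) (at y within UNIV)" for y
        using dd by (simp add: gderiv_def)
      show "onorm (\<lambda>k. k \<bullet> D\<psi> y) \<le> C" for y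
proof (rule onorm_le)
        fix k show "norm (k \<bullet> D\<psi> y) \<le> C * norm k"
          using Cauchy_Schwarz_ineq2[of k "D\<psi> y"] mult_left_mono[OF K(4)[of y] norm_ge_zero[of k]]
          by (simp add: mult.commute)
      qed
    qed auto
    then show ?thesis by simp
  qed
  \<comment> \<open>A compact set that contains the supports of all translates of \<psi> by vectors
    of norm at most 1.\<close>
  define K' where "K' = {x + y | x y. x \<in> K \<and> y \<in> cball (0::real^'n) 1}"
  have K': "compact K'" unfolding K'_def using K(1) by (intro compact_sums) auto
  have out: "\<psi> x = 0" "D\<psi> x = 0" "norm h \<le> 1 \<Longrightarrow> \<psi> (x - h) = 0" if "x \<notin> K'" for x h
  proof -
    have "x \<notin> K" using that unfolding K'_def by (smt (verit) add_0_right centre_in_cball mem_Collect_eq)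
    then show "\<psi> x = 0" "D\<psi> x = 0" using K(2) by auto
    show "\<psi> (x - h) = 0" if "norm h \<le> 1"
    proof (rule ccontr)
      assume "\<psi> (x - h) \<noteq> 0"
      then have "x - h \<in> K" using K(2) by blast
      then have "x \<in> K'" unfolding K'_def using that by (intro CollectI exI[of _ "x - h"] exI[of _ h]) auto
      with \<open>x \<notin> K'\<close> show False by simp
    qed
  qed
  have comp: "(LINT x|lborel. W x * (D\<psi> x \<bullet> e)) = - (LINT x|lborel. \<psi> x * (X x \<bullet> e))" if e: "norm e = 1" for e
  proof -
    define f where "f x = X x \<bullet> e" for x
    have f[measurable]: "f \<in> borel_measurable borel" unfolding f_def by measurable
    have fi: "integrable lborel f" unfolding f_def using Xi by (intro integrable_inner_left) auto
    have wm: "(\<lambda>z::(real^'n) \<times> real. \<psi> (fst z)) \<in> borel_measurable borel"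
      by (intro borel_measurable_continuous_onI continuous_on_compose2[OF K(6)] continuous_intros) auto
    define s where "s m = inverse (real (Suc m))" for m
    have s: "s m > 0" "s m \<le> 1" for m by (auto simp: s_def inverse_le_1_iff)
    have out0: "\<psi> (x - s m *\<^sub>R e) = 0" if "x \<notin> K'" for x m
      using out(3)[OF that, of "s m *\<^sub>R e"] s[of m] e by simp
    have s0: "s \<longlonglongrightarrow> 0" unfolding s_def by (rule LIMSEQ_inverse_real_of_nat)
    have lim1: "(\<lambda>m. LINT x|lborel. W x * ((\<psi> x - \<psi> (x - s m *\<^sub>R e)) / s m)) \<longlonglongrightarrow> (LINT x|lborel. W x * (D\<psi> x \<bullet> e))"
    proof (rule integral_dominated_convergence[where w="\<lambda>x. C * \<bar>indicator K' x * W x\<bar>"])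
      show "integrable lborel (\<lambda>x. C * \<bar>indicat_real K' x * W x\<bar>)"
        using WK[OF K'] by auto
      show "AE x in lborel. norm (W x * ((\<psi> x - \<psi> (x - s m *\<^sub>R e)) / s m)) \<le> C * \<bar>indicat_real K' x * W x\<bar>" for m
      proof (rule AE_I2)
        fix x
        show "norm (W x * ((\<psi> x - \<psi> (x - s m *\<^sub>R e)) / s m)) \<le> C * \<bar>indicat_real K' x * W x\<bar>"
        proof (cases "x \<in> K'")
          case True
          have "\<bar>(\<psi> x - \<psi> (x - s m *\<^sub>R e)) / s m\<bar> \<le> C"
            using lip[of x "s m *\<^sub>R e"] s(1)[of m] e by (simp add: divide_simps abs_minus_commute)
          then have "\<bar>W x\<bar> * \<bar>(\<psi> x - \<psi> (x - s m *\<^sub>R e)) / s m\<bar> \<le> \<bar>W x\<bar> * C"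
            by (rule mult_left_mono) simp
          then show ?thesis using True by (simp add: abs_mult mult.commute)
        next
          case False
          then show ?thesis using out[OF False] s[of m] e by simp
        qed
      qed
      show "AE x in lborel. (\<lambda>m. W x * ((\<psi> x - \<psi> (x - s m *\<^sub>R e)) / s m)) \<longlonglongrightarrow> W x * (D\<psi> x \<bullet> e)"
      proof (rule AE_I2)
        fix x
        have "((\<lambda>t. x - t *\<^sub>R e) has_derivative (\<lambda>t. - (t *\<^sub>R e))) (at 0)"
          by (auto intro!: derivative_eq_intros)
        from has_derivative_compose[OF this, of \<psi> "\<lambda>k. k \<bullet> D\<psi> x"] dd
        have "((\<lambda>t. \<psi> (x - t *\<^sub>R e)) has_derivative (\<lambda>t. - (t *\<^sub>R e) \<bullet> D\<psi> x)) (at 0)"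
          by (simp add: gderiv_def)
        then have "((\<lambda>t. \<psi> (x - t *\<^sub>R e)) has_real_derivative - (e \<bullet> D\<psi> x)) (at 0)"
          by (rule has_derivative_imp_has_field_derivative) simp
        then have "((\<lambda>t. (\<psi> (x - t *\<^sub>R e) - \<psi> x) / t) \<longlongrightarrow> - (e \<bullet> D\<psi> x)) (at 0)"
          by (simp add: has_field_derivative_iff)
        then have "(\<lambda>m. (\<psi> (x - s m *\<^sub>R e) - \<psi> x) / s m) \<longlonglongrightarrow> - (e \<bullet> D\<psi> x)"
          by (rule filterlim_compose) (use s0 s in \<open>auto simp: filterlim_at less_imp_neq[symmetric] intro!: always_eventually\<close>)
        then have "(\<lambda>m. - ((\<psi> (x - s m *\<^sub>R e) - \<psi> x) / s m)) \<longlonglongrightarrow> - (- (e \<bullet> D\<psi> x))"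
          by (rule tendsto_minus)
        then have "(\<lambda>m. (\<psi> x - \<psi> (x - s m *\<^sub>R e)) / s m) \<longlonglongrightarrow> D\<psi> x \<bullet> e"
          by (simp add: inner_commute minus_divide_left)
        then show "(\<lambda>m. W x * ((\<psi> x - \<psi> (x - s m *\<^sub>R e)) / s m)) \<longlonglongrightarrow> W x * (D\<psi> x \<bullet> e)"
          by (intro tendsto_mult tendsto_const)
      qed
    qed measurable
    \<comment> \<open>Discrete integration by parts followed by the segment identity in the
      direction \<open>s m *\<^sub>R e\<close>.\<close>
    have eq: "(LINT x|lborel. W x * ((\<psi> x - \<psi> (x - s m *\<^sub>R e)) / s m)) =
        - (LINT t:{0..1}|lborel. (LINT x|lborel. \<psi> (x - t *\<^sub>R (s m *\<^sub>R e)) * f x))" for m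
    proof -
      have i0: "integrable lborel (\<lambda>x. \<psi> x * W x)"
      proof (rule Bochner_Integration.integrable_bound[of _ "\<lambda>x. C * (indicator K x * W x)"])
        show "integrable lborel (\<lambda>x. C * (indicat_real K x * W x))" using WK[OF K(1)] by auto
      qed (use K(2,3,5) in \<open>auto simp: indicator_def abs_mult intro!: AE_I2 mult_right_mono\<close>)
      have i1: "integrable lborel (\<lambda>x. \<psi> (x - s m *\<^sub>R e) * W x)"
      proof (rule Bochner_Integration.integrable_bound[of _ "\<lambda>x. C * (indicator K' x * W x)"])
        show "integrable lborel (\<lambda>x. C * (indicat_real K' x * W x))" using WK[OF K'] by auto
      qed (use out0 K(3,5) in \<open>auto simp: indicator_def abs_mult intro!: AE_I2 mult_right_mono\<close>)
      have i2: "integrable lborel (\<lambda>x. \<psi> x * W (x + s m *\<^sub>R e))"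
        using integral_lborel_shift(2)[OF _ i1, of "s m *\<^sub>R e"] by simp
      have "(LINT x|lborel. W x * ((\<psi> x - \<psi> (x - s m *\<^sub>R e)) / s m)) =
          ((LINT x|lborel. \<psi> x * W x) - (LINT x|lborel. \<psi> (x - s m *\<^sub>R e) * W x)) / s m"
      proof -
        have eqx: "W x * ((\<psi> x - \<psi> (x - s m *\<^sub>R e)) / s m) = (\<psi> x * W x - \<psi> (x - s m *\<^sub>R e) * W x) / s m" for x
          by (simp add: algebra_simps)
        show ?thesis unfolding eqx integral_divide_zero using i0 i1 by simp
      qed
      also have "(LINT x|lborel. \<psi> (x - s m *\<^sub>R e) * W x) = (LINT x|lborel. \<psi> x * W (x + s m *\<^sub>R e))"
        using integral_lborel_shift(1)[of "\<lambda>x. \<psi> (x - s m *\<^sub>R e) * W x" "s m *\<^sub>R e"] by simp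
      also have "((LINT x|lborel. \<psi> x * W x) - (LINT x|lborel. \<psi> x * W (x + s m *\<^sub>R e))) / s m =
          - (LINT x|lborel. \<psi> x * ((W (x + s m *\<^sub>R e) - W x) / s m))"
      proof -
        have eqx: "\<psi> x * ((W (x + s m *\<^sub>R e) - W x) / s m) = (\<psi> x * W (x + s m *\<^sub>R e) - \<psi> x * W x) / s m" for x
          by (simp add: algebra_simps)
        show ?thesis unfolding eqx integral_divide_zero using i0 i2 by (simp add: minus_divide_left)
      qed
      also have "(LINT x|lborel. \<psi> x * ((W (x + s m *\<^sub>R e) - W x) / s m)) =
          (LINT x|lborel. (LINT t:{0..1}|lborel. \<psi> x * f (x + t *\<^sub>R (s m *\<^sub>R e))))"
      proof (rule integral_cong_AE)
        have "AE x in lborel. W (x + s m *\<^sub>R e) - W x = (LINT t:{0..1}|lborel. X (x + t *\<^sub>R (s m *\<^sub>R e)) \<bullet> (s m *\<^sub>R e))"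
          using lp unfolding line_primitive_def by blast
        then show "AE x in lborel. \<psi> x * ((W (x + s m *\<^sub>R e) - W x) / s m) = (LINT t:{0..1}|lborel. \<psi> x * f (x + t *\<^sub>R (s m *\<^sub>R e)))"
          by eventually_elim (use s(1)[of m] in \<open>simp add: f_def\<close>)
        show "(\<lambda>x. (LINT t:{0..1}|lborel. \<psi> x * f (x + t *\<^sub>R (s m *\<^sub>R e)))) \<in> borel_measurable lborel"
          using segment_Fubini(2)[OF f fi wm, of C "s m *\<^sub>R e"] K(3) by (simp add: borel_measurable_integrable)
      qed measurable
      also have "\<dots> = (LINT t:{0..1}|lborel. (LINT x|lborel. \<psi> x * f (x + t *\<^sub>R (s m *\<^sub>R e))))"
        using segment_Fubini(1)[OF f fi wm, of C "s m *\<^sub>R e"] K(3) by simp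
      finally have "(LINT x|lborel. W x * ((\<psi> x - \<psi> (x - s m *\<^sub>R e)) / s m)) =
          - (LINT t:{0..1}|lborel. (LINT x|lborel. \<psi> x * f (x + t *\<^sub>R (s m *\<^sub>R e))))" .
      moreover have "(LINT x|lborel. \<psi> x * f (x + t *\<^sub>R (s m *\<^sub>R e))) = (LINT x|lborel. \<psi> (x - t *\<^sub>R (s m *\<^sub>R e)) * f x)" for t
        using integral_lborel_shift(1)[of "\<lambda>x. \<psi> (x - t *\<^sub>R (s m *\<^sub>R e)) * f x" "t *\<^sub>R (s m *\<^sub>R e)"] by simp
      ultimately show ?thesis by (simp only:)
    qed
    define J where "J = (LINT x|lborel. \<psi> x * f x)"
    define I where "I m t = (LINT x|lborel. \<psi> (x - t *\<^sub>R (s m *\<^sub>R e)) * f x)" for m t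
    have bi: "integrable lborel (\<lambda>x. \<psi> (x - a) * f x)" for a
      by (rule Bochner_Integration.integrable_bound[of _ "\<lambda>x. C * f x"])
        (use fi K(3,5) in \<open>auto simp: abs_mult intro!: mult_right_mono\<close>)
    have IJ: "\<bar>I m t - J\<bar> \<le> C * s m * (LINT x|lborel. \<bar>f x\<bar>)" if "t \<in> {0..1}" for m t
    proof -
      have "I m t - J = (LINT x|lborel. (\<psi> (x - t *\<^sub>R (s m *\<^sub>R e)) - \<psi> x) * f x)"
        using bi[of "t *\<^sub>R (s m *\<^sub>R e)"] bi[of 0] by (simp add: I_def J_def algebra_simps)
      also have "\<bar>\<dots>\<bar> \<le> C * s m * (LINT x|lborel. \<bar>f x\<bar>)"
      proof (rule integral_bounded_by_norm)
        fix x
        have "\<bar>\<psi> (x - t *\<^sub>R (s m *\<^sub>R e)) - \<psi> x\<bar> \<le> C * (t * s m)"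
          using lip[of x "t *\<^sub>R (s m *\<^sub>R e)"] that s(1)[of m] e by (simp add: abs_mult)
        also have "\<dots> \<le> C * s m" using that s(1)[of m] K(5) by (intro mult_left_mono) (auto simp: mult_left_le_one_le)
        finally show "\<bar>(\<psi> (x - t *\<^sub>R (s m *\<^sub>R e)) - \<psi> x) * f x\<bar> \<le> C * s m * \<bar>f x\<bar>"
          by (simp add: abs_mult mult_right_mono)
      qed (use fi in auto)
      finally show ?thesis .
    qed
    have Im: "I m \<in> borel_measurable borel" for m
      unfolding I_def by measurable
    have IJ2: "\<bar>(LINT t:{0..1}|lborel. I m t) - J\<bar> \<le> C * s m * (LINT x|lborel. \<bar>f x\<bar>)" for m
    proof -
      define D where "D = C * s m * (LINT x|lborel. \<bar>f x\<bar>)"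
      have ii: "set_integrable lborel {0..1} (I m)"
        unfolding set_integrable_def
      proof (rule Bochner_Integration.integrable_bound[of _ "\<lambda>t. (D + \<bar>J\<bar>) * indicator {0..1} t"])
        show "AE t in lborel. norm (indicat_real {0..1} t *\<^sub>R I m t) \<le> norm ((D + \<bar>J\<bar>) * indicat_real {0..1} t)"
        proof (rule AE_I2)
          fix t show "norm (indicat_real {0..1} t *\<^sub>R I m t) \<le> norm ((D + \<bar>J\<bar>) * indicat_real {0..1} t)"
            using IJ[of t m] by (auto simp: indicator_def D_def)
        qed
      qed (use Im in auto)
      have "(LINT t:{0..1}|lborel. I m t) - J = (LINT t:{0..1}|lborel. I m t) - (LINT t:{0..1::real}|lborel. J)"
        by (simp add: set_lebesgue_integral_def)
      also have "\<dots> = (LINT t:{0..1}|lborel. I m t - J)"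
        using ii by (subst set_integral_diff) (auto simp: set_integrable_def)
      also have "\<bar>\<dots>\<bar> \<le> D * (LINT t|lborel. indicator {0..1::real} t)"
        unfolding set_lebesgue_integral_def
      proof (rule integral_bounded_by_norm)
        fix t show "\<bar>indicat_real {0..1} t *\<^sub>R (I m t - J)\<bar> \<le> D * indicat_real {0..1} t"
          using IJ[of t m] by (auto simp: indicator_def D_def)
      qed (use Im in auto)
      finally show ?thesis by (simp add: D_def)
    qed
    have "(\<lambda>m. (LINT t:{0..1}|lborel. I m t) - J) \<longlonglongrightarrow> 0"
    proof (rule Lim_null_comparison)
      show "\<forall>\<^sub>F m in sequentially. norm ((LINT t:{0..1}|lborel. I m t) - J) \<le> C * s m * (LINT x|lborel. \<bar>f x\<bar>)"
        using IJ2 by auto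
      show "(\<lambda>m. C * s m * (LINT x|lborel. \<bar>f x\<bar>)) \<longlonglongrightarrow> 0"
        by (intro tendsto_mult_left_zero tendsto_mult_right_zero s0)
    qed
    then have "(\<lambda>m. - (LINT t:{0..1}|lborel. I m t)) \<longlonglongrightarrow> - J"
      by (intro tendsto_minus) (simp add: LIM_zero_iff)
    then have "(LINT x|lborel. W x * (D\<psi> x \<bullet> e)) = - J"
      using lim1 unfolding eq I_def by (rule LIMSEQ_unique[rotated])
    then show ?thesis by (simp add: J_def f_def)
  qed
  have m: "(\<lambda>x. W x *\<^sub>R D\<psi> x) \<in> borel_measurable lborel" "(\<lambda>x. \<psi> x *\<^sub>R X x) \<in> borel_measurable lborel"
    by measurable
  have i1: "integrable lborel (\<lambda>x. W x *\<^sub>R D\<psi> x)"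
  proof (rule Bochner_Integration.integrable_bound[of _ "\<lambda>x. C * (indicator K x * W x)"])
    show "integrable lborel (\<lambda>x. C * (indicat_real K x * W x))" using WK[OF K(1)] by auto
    show "AE x in lborel. norm (W x *\<^sub>R D\<psi> x) \<le> norm (C * (indicat_real K x * W x))"
    proof (rule AE_I2)
      fix x show "norm (W x *\<^sub>R D\<psi> x) \<le> norm (C * (indicat_real K x * W x))"
        using K(2)[of x] mult_left_mono[OF K(4)[of x], of "\<bar>W x\<bar>"] K(5) by (cases "x \<in> K") (auto simp: abs_mult mult.commute)
    qed
  qed measurable
  have i2: "integrable lborel (\<lambda>x. \<psi> x *\<^sub>R X x)"
  proof (rule Bochner_Integration.integrable_bound[of _ "\<lambda>x. C *\<^sub>R X x"])
    show "AE x in lborel. norm (\<psi> x *\<^sub>R X x) \<le> norm (C *\<^sub>R X x)"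
      using K(3,5) by (auto intro!: AE_I2 mult_right_mono)
  qed (use Xi in auto)
  have "(LINT x|lborel. W x *\<^sub>R D\<psi> x) = - (LINT x|lborel. \<psi> x *\<^sub>R X x)"
  proof (rule euclidean_eqI)
    fix e :: "real^'n" assume "e \<in> Basis"
    then show "(LINT x|lborel. W x *\<^sub>R D\<psi> x) \<bullet> e = (- (LINT x|lborel. \<psi> x *\<^sub>R X x)) \<bullet> e"
      using comp[of e] i1 i2 by (simp flip: integral_inner_left)
  qed
  then show "(LINT x|lebesgue. W x *\<^sub>R D\<psi> x) = - (LINT x|lebesgue. \<psi> x *\<^sub>R X x)"
    using m by (simp add: integral_completion)
qed

text \<open>The identity in the directions \<open>t *\<^sub>R h\<close>, rescaled to
  \<open>{0..t}\<close>, holds off a null set that depends on \<open>t\<close>. Fubini provides a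
  single null set of points off which it holds for almost every \<open>t\<close>. The endpoint 1
  could be lost in this and is treated on its own.\<close>

lemma line_primitive_path:
  fixes U :: "'a::euclidean_space \<Rightarrow> real" and h :: 'a
  assumes lp: "line_primitive U V"
  defines "v \<equiv> \<lambda>x t. V (x + t *\<^sub>R h) \<bullet> h"
  shows "AE x in lborel. set_integrable lborel {0..1} (v x) \<and>
    U (x + h) = U x + integral {0..1} (v x) \<and>
    (AE t in lborel. t \<in> {0..1} \<longrightarrow> U (x + t *\<^sub>R h) = U x + integral {0..t} (v x))"
proof -
  have U[measurable]: "U \<in> borel_measurable borel" and V[measurable]: "V \<in> borel_measurable borel"
    and Vi: "integrable lborel V" using lp by (auto simp: line_primitive_def)
  have int: "AE x in lborel. set_integrable lborel {0..1} (v x)"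
  proof -
    have m: "(\<lambda>x. V x \<bullet> h) \<in> borel_measurable borel" by measurable
    have i: "integrable lborel (\<lambda>x. V x \<bullet> h)" using Vi by (intro integrable_inner_left) auto
    from segment_Fubini(3)[OF m i, of "\<lambda>_. 1" 1 h] show ?thesis by (simp add: v_def)
  qed
  \<comment> \<open>The integral is written with a conditional over all of the line, so that it is
    jointly measurable in \<open>x\<close> and \<open>t\<close> and the two almost-everywhere
    quantifiers can be exchanged.\<close>
  define Q where "Q x t \<longleftrightarrow> t \<in> {0..1} \<longrightarrow> U (x + t *\<^sub>R h) = U x + (LINT s|lborel. (if 0 \<le> s \<and> s \<le> t then v x s else 0))" for x t
  have Qt: "AE x in lborel. Q x t" for t
  proof (cases "t \<in> {0..1} \<and> t \<noteq> 0")
    case True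
    have "AE x in lborel. U (x + t *\<^sub>R h) - U x = (LINT s:{0..1}|lborel. V (x + s *\<^sub>R (t *\<^sub>R h)) \<bullet> (t *\<^sub>R h))"
      using lp unfolding line_primitive_def by blast
    then show ?thesis
    proof eventually_elim
      case (elim x)
      have "(LINT s|lborel. (if 0 \<le> s \<and> s \<le> t then v x s else 0)) =
          \<bar>t\<bar> *\<^sub>R (LINT s|lborel. (if 0 \<le> 0 + t * s \<and> 0 + t * s \<le> t then v x (0 + t * s) else 0))"
        using True by (intro lborel_integral_real_affine) auto
      also have "\<dots> = (LINT s|lborel. t *\<^sub>R (if 0 \<le> 0 + t * s \<and> 0 + t * s \<le> t then v x (0 + t * s) else 0))"
        using True by simp
      also have "\<dots> = (LINT s:{0..1}|lborel. V (x + s *\<^sub>R (t *\<^sub>R h)) \<bullet> (t *\<^sub>R h))"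
        unfolding set_lebesgue_integral_def using True
        by (intro Bochner_Integration.integral_cong refl)
          (auto simp: v_def indicator_def zero_le_mult_iff mult_le_cancel_left1 mult.commute)
      finally show ?case using elim by (simp add: Q_def)
    qed
  next
    case False
    have "(LINT s|lborel. (if 0 \<le> s \<and> s \<le> 0 then v x s else 0)) = 0" for x
      by (rule integral_eq_zero_AE) (use AE_lborel_singleton[of 0] in \<open>auto\<close>)
    with False show ?thesis by (auto simp: Q_def)
  qed
  have mI: "(\<lambda>z. LINT s|lborel. (if 0 \<le> s \<and> s \<le> snd z then v (fst z) s else 0)) \<in> borel_measurable (lborel \<Otimes>\<^sub>M lborel)"
    unfolding v_def by measurable
  have "AE x in lborel. AE t in lborel. Q x t"
  proof (subst lborel_pair.AE_commute)
    show "{z \<in> space (lborel \<Otimes>\<^sub>M lborel). Q (fst z) (snd z)} \<in> sets (lborel \<Otimes>\<^sub>M lborel)"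
      unfolding Q_def using mI by measurable
    show "AE t in lborel. AE x in lborel. Q x t" using Qt by simp
  qed
  then show ?thesis using int Qt[of 1]
  proof eventually_elim
    case (elim x)
    have eq: "(LINT s|lborel. (if 0 \<le> s \<and> s \<le> t then v x s else 0)) = integral {0..t} (v x)" if "t \<in> {0..1}" for t
    proof -
      have "set_integrable lborel {0..t} (v x)" using elim(2) by (rule set_integrable_subset) (use that in auto)
      then have "(LINT s:{0..t}|lborel. v x s) = integral {0..t} (v x)" by (rule set_borel_integral_eq_integral)
      moreover have "(LINT s:{0..t}|lborel. v x s) = (LINT s|lborel. (if 0 \<le> s \<and> s \<le> t then v x s else 0))"
        unfolding set_lebesgue_integral_def by (intro Bochner_Integration.integral_cong) auto
      ultimately show ?thesis by simp
    qed
    have "AE t in lborel. t \<in> {0..1} \<longrightarrow> U (x + t *\<^sub>R h) = U x + integral {0..t} (v x)"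
      using elim(1) by eventually_elim (use eq in \<open>auto simp: Q_def\<close>)
    then show ?case using elim eq[of 1] by (auto simp: Q_def)
  qed
qed

text \<open>Absolute continuity in disguise: the values of \<open>N\<close> serve as the parameter, so that
  no monotonicity of the partition is needed.\<close>

lemma constant_of_square_bound:
  fixes G N :: "real \<Rightarrow> real"
  assumes N: "continuous_on {0..1} N" "N 0 = 0" "N 1 \<ge> 0"
    and G: "\<And>a b. 0 \<le> a \<Longrightarrow> a \<le> b \<Longrightarrow> b \<le> 1 \<Longrightarrow> \<bar>G b - G a\<bar> \<le> C * (N b - N a)\<^sup>2"
  shows "G 1 = G 0"
proof -
  have G': "\<bar>G b - G a\<bar> \<le> C * (N b - N a)\<^sup>2" if "a \<in> {0..1}" "b \<in> {0..1}" for a b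
    using G[of a b] G[of b a] that by (cases "a \<le> b") (auto simp: power2_commute abs_minus_commute)
  have "\<bar>G 1 - G 0\<bar> \<le> C * (N 1)\<^sup>2 / real m" if m: "m > 0" for m :: nat
  proof -
    have "\<exists>t. t \<in> {0..1} \<and> N t = i * N 1 / m" if "i \<le> m" for i
    proof -
      have "i * N 1 / m \<le> N 1" using that m N(3) by (simp add: field_simps mult_left_mono)
      then show ?thesis using IVT'[of N 0 "i * N 1 / m" 1] N m by auto
    qed
    then obtain t where t: "\<And>i. i \<le> m \<Longrightarrow> t i \<in> {0..1} \<and> N (t i) = i * N 1 / m" by metis
    have "\<bar>G (t i) - G (t 0)\<bar> \<le> i * (C * (N 1 / m)\<^sup>2)" if "i \<le> m" for i
      using that
    proof (induction i)
      case (Suc i)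
      have "\<bar>G (t (Suc i)) - G (t i)\<bar> \<le> C * (N (t (Suc i)) - N (t i))\<^sup>2"
        using t Suc by (intro G') auto
      also have "N (t (Suc i)) - N (t i) = N 1 / m" using t[of i] t[of "Suc i"] Suc by (simp add: field_simps)
      finally show ?case using Suc by (simp add: algebra_simps)
    qed simp
    from this[of m] have 1: "\<bar>G (t m) - G (t 0)\<bar> \<le> C * (N 1)\<^sup>2 / m" using m
      by (simp add: power2_eq_square field_simps)
    have "\<bar>G (t 0) - G 0\<bar> \<le> C * (N (t 0) - N 0)\<^sup>2" using t[of 0] by (intro G') auto
    moreover have "\<bar>G 1 - G (t m)\<bar> \<le> C * (N 1 - N (t m))\<^sup>2" using t[of m] by (intro G') auto
    ultimately show ?thesis using 1 t[of 0] t[of m] N m by simp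
  qed
  then have "\<forall>\<^sub>F m in sequentially. \<bar>G 1 - G 0\<bar> \<le> C * (N 1)\<^sup>2 / real m"
    by (auto simp: eventually_sequentially intro!: exI[of _ 1])
  moreover have "(\<lambda>m. C * (N 1)\<^sup>2 / real m) \<longlonglongrightarrow> 0" by real_asymp
  ultimately have "\<bar>G 1 - G 0\<bar> \<le> 0" using tendsto_lowerbound trivial_limit_sequentially by blast
  then show ?thesis by simp
qed

text \<open>The level-dependent factor of the test function. Its derivative is Lipschitz, unlike
  that of the positive part itself.\<close>

definition pos_sq :: "real \<Rightarrow> real \<Rightarrow> real" where
  "pos_sq k t = (max 0 (t - k))\<^sup>2"

text \<open>Taylor's formula of first order; the derivative has Lipschitz constant 2.\<close>

lemma pos_sq_remainder: "\<bar>pos_sq k b - pos_sq k a - 2 * max 0 (a - k) * (b - a)\<bar> \<le> (b - a)\<^sup>2"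
proof -
  consider "a \<le> k" "b \<le> k" | "a \<le> k" "b > k" | "a > k" "b \<le> k" | "a > k" "b > k" by linarith
  then show ?thesis
  proof cases
    case 2
    then have "(b - k)\<^sup>2 \<le> (b - a)\<^sup>2" by (intro power_mono) auto
    with 2 show ?thesis by (simp add: pos_sq_def)
  next
    case 3
    have "(b - a)\<^sup>2 - (a - k) * (2 * (a - b) - (a - k)) = (b - k)\<^sup>2"
      by (simp add: power2_eq_square algebra_simps)
    then have 1: "(a - k) * (2 * (a - b) - (a - k)) \<le> (b - a)\<^sup>2"
      using zero_le_power2[of "b - k"] by linarith
    have "(a - k) * (2 * (a - b) - (a - k)) \<ge> 0" using 3 by (intro mult_nonneg_nonneg) auto
    moreover have "pos_sq k b - pos_sq k a - 2 * max 0 (a - k) * (b - a) = (a - k) * (2 * (a - b) - (a - k))"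
      using 3 by (simp add: pos_sq_def power2_eq_square algebra_simps)
    ultimately show ?thesis using 1 by simp
  next
    case 4
    have "pos_sq k b - pos_sq k a - 2 * max 0 (a - k) * (b - a) = (b - a)\<^sup>2"
      using 4 by (simp add: pos_sq_def power2_eq_square algebra_simps)
    then show ?thesis by simp
  qed (auto simp: pos_sq_def)
qed

text \<open>Let \<open>N\<close> be the variation of \<open>w\<close>. On a subinterval both the
  Taylor remainder and the error from freezing the factor \<open>f\<close> at the left end are
  quadratic in the increment of \<open>N\<close>, with constants 1 and 2. Hence the defect
  \<open>G\<close> of the chain rule is constant by \<open>constant_of_square_bound\<close>.\<close>

lemma chain_rule_pos_sq_path:
  fixes v :: "real \<Rightarrow> real" and c :: real
  assumes v: "v absolutely_integrable_on {0..1}"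
  defines "w \<equiv> \<lambda>t. c + integral {0..t} v"
  shows "((\<lambda>t. 2 * max 0 (w t - k) * v t) absolutely_integrable_on {0..1})"
    "pos_sq k (w 1) - pos_sq k (w 0) = integral {0..1} (\<lambda>t. 2 * max 0 (w t - k) * v t)"
proof -
  have vi: "v integrable_on {0..1}" "(\<lambda>t. \<bar>v t\<bar>) integrable_on {0..1}"
    using v by (auto simp: absolutely_integrable_on_def)
  have sub: "f integrable_on {a..b}" if "f integrable_on {0..1}" "0 \<le> a" "b \<le> 1" for f :: "real \<Rightarrow> real" and a b
    using that by (intro integrable_subinterval_real[OF that(1)]) auto
  have cw: "continuous_on {0..1} w" unfolding w_def by (intro continuous_intros indefinite_integral_continuous_1 vi)
  define f where "f t = 2 * max 0 (w t - k)" for t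
  have cf: "continuous_on {0..1} f" unfolding f_def by (intro continuous_intros cw)
  have fv: "(\<lambda>t. f t * v t) absolutely_integrable_on {0..1}"
  proof (rule absolutely_integrable_bounded_measurable_product_real)
    show "f \<in> borel_measurable (lebesgue_on {0..1})"
      by (rule continuous_imp_measurable_on_sets_lebesgue[OF cf]) auto
    show "bounded (f ` {0..1})" using cf by (intro compact_imp_bounded compact_continuous_image) auto
  qed (use v in auto)
  then show "((\<lambda>t. 2 * max 0 (w t - k) * v t) absolutely_integrable_on {0..1})" by (simp add: f_def)
  have fvi: "(\<lambda>t. f t * v t) integrable_on {0..1}" using fv by (simp add: absolutely_integrable_on_def)
  define N where "N t = integral {0..t} (\<lambda>t. \<bar>v t\<bar>)" for t
  define G where "G t = pos_sq k (w t) - integral {0..t} (\<lambda>t. f t * v t)" for t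
  have "G 1 = G 0"
  proof (rule constant_of_square_bound)
    show "continuous_on {0..1} N" unfolding N_def by (intro indefinite_integral_continuous_1 vi)
    show "N 0 = 0" "N 1 \<ge> 0" using vi by (auto simp: N_def intro!: integral_nonneg)
    fix a b :: real assume ab: "0 \<le> a" "a \<le> b" "b \<le> 1"
    have comb: "integral {0..b} g - integral {0..a} g = integral {a..b} g" if "g integrable_on {0..1}" for g :: "real \<Rightarrow> real"
      using Henstock_Kurzweil_Integration.integral_combine[OF ab(1,2), of g] sub[OF that, of 0 b] ab by simp
    have wba: "w b - w a = integral {a..b} v" using comb[OF vi(1)] by (simp add: w_def)
    have Nba: "N b - N a = integral {a..b} (\<lambda>t. \<bar>v t\<bar>)" using comb[OF vi(2)] by (simp add: N_def)
    have wt: "\<bar>w t - w a\<bar> \<le> N b - N a" if "t \<in> {a..b}" for t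
    proof -
      have "w t - w a = integral {a..t} v"
        using Henstock_Kurzweil_Integration.integral_combine[of 0 a t v] sub[OF vi(1), of 0 t] that ab by (simp add: w_def)
      also have "\<bar>\<dots>\<bar> \<le> integral {a..t} (\<lambda>t. \<bar>v t\<bar>)"
        using integral_norm_bound_integral[of v "{a..t}" "\<lambda>t. \<bar>v t\<bar>"] sub[OF vi(1), of a t] sub[OF vi(2), of a t] that ab by simp
      also have "\<dots> \<le> integral {a..b} (\<lambda>t. \<bar>v t\<bar>)"
        using that ab by (intro integral_subset_le sub[OF vi(2)]) auto
      finally show ?thesis by (simp add: Nba)
    qed
    have Nnn: "N b - N a \<ge> 0" using wt[of a] ab by simp
    have "G b - G a = (pos_sq k (w b) - pos_sq k (w a) - f a * (w b - w a)) + (f a * (w b - w a) - integral {a..b} (\<lambda>t. f t * v t))"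
      using comb[OF fvi] by (simp add: G_def)
    moreover have "\<bar>pos_sq k (w b) - pos_sq k (w a) - f a * (w b - w a)\<bar> \<le> (N b - N a)\<^sup>2"
    proof -
      have "\<bar>pos_sq k (w b) - pos_sq k (w a) - f a * (w b - w a)\<bar> \<le> \<bar>w b - w a\<bar>\<^sup>2"
        using pos_sq_remainder[of k "w b" "w a"] by (simp add: f_def)
      also have "\<dots> \<le> (N b - N a)\<^sup>2" using wt[of b] ab by (intro power_mono) auto
      finally show ?thesis .
    qed
    moreover have "\<bar>f a * (w b - w a) - integral {a..b} (\<lambda>t. f t * v t)\<bar> \<le> 2 * (N b - N a)\<^sup>2"
    proof -
      have "f a * (w b - w a) - integral {a..b} (\<lambda>t. f t * v t) = integral {a..b} (\<lambda>t. f a * v t - f t * v t)"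
        unfolding wba using sub[OF vi(1), of a b] sub[OF fvi, of a b] ab
        by (subst Henstock_Kurzweil_Integration.integral_diff) (auto intro: integrable_on_mult_right[of v])
      also have "norm \<dots> \<le> integral {a..b} (\<lambda>t. 2 * (N b - N a) * \<bar>v t\<bar>)"
      proof (rule integral_norm_bound_integral)
        show "(\<lambda>t. f a * v t - f t * v t) integrable_on {a..b}"
          by (rule integrable_diff[OF integrable_on_mult_right[OF sub[OF vi(1) ab(1,3)]] sub[OF fvi ab(1,3)]])
        show "(\<lambda>t. 2 * (N b - N a) * \<bar>v t\<bar>) integrable_on {a..b}"
          by (rule integrable_on_mult_right[OF sub[OF vi(2) ab(1,3)]])
        fix t assume "t \<in> {a..b}"
        then have "\<bar>f a - f t\<bar> \<le> 2 * (N b - N a)" using wt[of t] by (auto simp: f_def max_def abs_if split: if_splits)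
        then have "\<bar>f a - f t\<bar> * \<bar>v t\<bar> \<le> 2 * (N b - N a) * \<bar>v t\<bar>" by (rule mult_right_mono) simp
        then show "norm (f a * v t - f t * v t) \<le> 2 * (N b - N a) * \<bar>v t\<bar>"
          by (simp add: abs_mult left_diff_distrib[symmetric])
      qed
      also have "\<dots> = 2 * (N b - N a)\<^sup>2" by (simp add: Nba power2_eq_square)
      finally show ?thesis by simp
    qed
    ultimately show "\<bar>G b - G a\<bar> \<le> 3 * (N b - N a)\<^sup>2" by linarith
  qed
  then show "pos_sq k (w 1) - pos_sq k (w 0) = integral {0..1} (\<lambda>t. 2 * max 0 (w t - k) * v t)"
    by (simp add: G_def f_def)
qed

lemma set_integrable_lborel_absolutely:
  fixes f :: "'a::euclidean_space \<Rightarrow> real"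
  assumes "set_integrable lborel S f" shows "f absolutely_integrable_on S"
  using assms unfolding set_integrable_def by (simp add: integrable_completion borel_measurable_integrable)

text \<open>On almost every segment \<open>U\<close> has an absolutely continuous version
  \<open>w\<close> with the correct endpoint values. Inside the segment \<open>U\<close> and
  \<open>w\<close> agree for almost every \<open>t\<close>, which suffices for the integrand of the
  chain rule.\<close>

lemma line_primitive_pos_sq:
  fixes U :: "'a::euclidean_space \<Rightarrow> real"
  assumes lp: "line_primitive U V" and bd: "\<And>x. \<bar>U x\<bar> \<le> M"
  shows "line_primitive (\<lambda>x. pos_sq k (U x)) (\<lambda>x. (2 * max 0 (U x - k)) *\<^sub>R V x)"
  unfolding line_primitive_def
proof (intro conjI allI)
  have U[measurable]: "U \<in> borel_measurable borel" and V[measurable]: "V \<in> borel_measurable borel"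
    and Vi: "integrable lborel V" using lp by (auto simp: line_primitive_def)
  show "(\<lambda>x. pos_sq k (U x)) \<in> borel_measurable borel" unfolding pos_sq_def by measurable
  show m[measurable]: "(\<lambda>x. (2 * max 0 (U x - k)) *\<^sub>R V x) \<in> borel_measurable borel" by measurable
  show Xi: "integrable lborel (\<lambda>x. (2 * max 0 (U x - k)) *\<^sub>R V x)"
  proof (rule Bochner_Integration.integrable_bound[of _ "\<lambda>x. (2 * (M + \<bar>k\<bar>)) *\<^sub>R V x"])
    show "AE x in lborel. norm ((2 * max 0 (U x - k)) *\<^sub>R V x) \<le> norm ((2 * (M + \<bar>k\<bar>)) *\<^sub>R V x)"
    proof (rule AE_I2)
      fix x
      have "\<bar>2 * max 0 (U x - k)\<bar> \<le> \<bar>2 * (M + \<bar>k\<bar>)\<bar>" using bd[of x] by (auto simp: max_def abs_if split: if_splits)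
      then show "norm ((2 * max 0 (U x - k)) *\<^sub>R V x) \<le> norm ((2 * (M + \<bar>k\<bar>)) *\<^sub>R V x)"
        unfolding norm_scaleR by (rule mult_right_mono) simp
    qed
  qed (use Vi m in auto)
  fix h
  show "AE x in lborel. pos_sq k (U (x + h)) - pos_sq k (U x) =
      (LINT t:{0..1}|lborel. ((2 * max 0 (U (x + t *\<^sub>R h) - k)) *\<^sub>R V (x + t *\<^sub>R h)) \<bullet> h)"
    using line_primitive_path[OF lp, of h]
  proof eventually_elim
    case (elim x)
    define v where "v t = V (x + t *\<^sub>R h) \<bullet> h" for t
    define w where "w t = U x + integral {0..t} v" for t
    have v: "v absolutely_integrable_on {0..1}" 
      using elim set_integrable_lborel_absolutely[of "{0..1}" v] by (simp add: v_def[abs_def])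
    note ch = chain_rule_pos_sq_path[OF v, where c="U x" and k=k, folded w_def]
    have AE: "AE t in lborel. t \<in> {0..1} \<longrightarrow> U (x + t *\<^sub>R h) = w t"
      using elim by (simp add: w_def v_def[abs_def])
    have m1: "(\<lambda>t. indicator {0..1} t *\<^sub>R (((2 * max 0 (U (x + t *\<^sub>R h) - k)) *\<^sub>R V (x + t *\<^sub>R h)) \<bullet> h)) \<in> borel_measurable lborel"
      by measurable
    have "(LINT t:{0..1}|lborel. ((2 * max 0 (U (x + t *\<^sub>R h) - k)) *\<^sub>R V (x + t *\<^sub>R h)) \<bullet> h) =
        (LINT t:{0..1}|lebesgue. ((2 * max 0 (U (x + t *\<^sub>R h) - k)) *\<^sub>R V (x + t *\<^sub>R h)) \<bullet> h)"
      unfolding set_lebesgue_integral_def using m1 by (rule integral_completion[symmetric])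
    also have "\<dots> = (LINT t:{0..1}|lebesgue. 2 * max 0 (w t - k) * v t)"
      unfolding set_lebesgue_integral_def
    proof (rule integral_cong_AE)
      show "(\<lambda>t. indicator {0..1} t *\<^sub>R (((2 * max 0 (U (x + t *\<^sub>R h) - k)) *\<^sub>R V (x + t *\<^sub>R h)) \<bullet> h)) \<in> borel_measurable lebesgue"
        using m1 by (rule measurable_completion)
      show "(\<lambda>t. indicat_real {0..1} t *\<^sub>R (2 * max 0 (w t - k) * v t)) \<in> borel_measurable lebesgue"
        using ch(1) unfolding set_integrable_def by (rule borel_measurable_integrable)
      show "AE t in lebesgue. indicat_real {0..1} t *\<^sub>R (((2 * max 0 (U (x + t *\<^sub>R h) - k)) *\<^sub>R V (x + t *\<^sub>R h)) \<bullet> h) =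
          indicat_real {0..1} t *\<^sub>R (2 * max 0 (w t - k) * v t)"
        using AE_completion[OF AE] by eventually_elim (auto simp: indicator_def v_def)
    qed
    also have "\<dots> = integral {0..1} (\<lambda>t. 2 * max 0 (w t - k) * v t)"
      using ch(1) by (rule set_lebesgue_integral_eq_integral)
    also have "\<dots> = pos_sq k (w 1) - pos_sq k (w 0)" using ch(2) by simp
    also have "w 1 = U (x + h)" using elim by (simp add: w_def v_def[abs_def])
    finally show ?case by (simp add: w_def)
  qed
qed

section \<open>De Giorgi's isoperimetric inequality\<close>

text \<open>\<open>a\<close> is the last time at which the path is at or above \<open>l\<close>, and
  \<open>b\<close> the first later time at which it is at or below \<open>k\<close>; in between it
  runs strictly inside the strip while dropping by at least \<open>l - k\<close>.\<close>

lemma level_crossing: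
  fixes v :: "real \<Rightarrow> real" and c :: real
  assumes v: "v integrable_on {0..1}" and kl: "k < l"
  defines "w \<equiv> \<lambda>t. c + integral {0..t} v"
  assumes w0: "w 0 \<ge> l" and w1: "w 1 \<le> k"
  obtains a b where "0 \<le> a" "a \<le> b" "b \<le> 1" "\<And>t. a < t \<Longrightarrow> t < b \<Longrightarrow> k < w t \<and> w t < l"
    "l - k \<le> - integral {a..b} v"
proof -
  have cw: "continuous_on {0..1} w" unfolding w_def by (intro continuous_intros indefinite_integral_continuous_1 v)
  have A: "compact ({0..1} \<inter> w -` {l..})"
    using continuous_closed_preimage[OF cw closed_atLeastAtMost closed_atLeast]
    by (auto intro: compact_Int_closed simp: compact_eq_bounded_closed bounded_Int)
  moreover have "0 \<in> {0..1} \<inter> w -` {l..}" using w0 by simp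
  ultimately obtain a where a: "a \<in> {0..1}" "w a \<ge> l" "\<And>t. t \<in> {0..1} \<Longrightarrow> w t \<ge> l \<Longrightarrow> t \<le> a"
    using compact_attains_sup[of "{0..1} \<inter> w -` {l..}"] by (metis IntD1 IntD2 IntI atLeast_iff empty_iff vimage_eq)
  have "continuous_on {a..1} w" using cw by (rule continuous_on_subset) (use a in auto)
  then have "compact ({a..1} \<inter> w -` {..k})"
    using continuous_closed_preimage[OF _ closed_atLeastAtMost closed_atMost]
    by (auto simp: compact_eq_bounded_closed bounded_Int)
  moreover have "1 \<in> {a..1} \<inter> w -` {..k}" using w1 a by simp
  ultimately obtain b where b: "b \<in> {a..1}" "w b \<le> k" "\<And>t. t \<in> {a..1} \<Longrightarrow> w t \<le> k \<Longrightarrow> b \<le> t"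
    using compact_attains_inf[of "{a..1} \<inter> w -` {..k}"] by (metis IntD1 IntD2 IntI atMost_iff empty_iff vimage_eq)
  show ?thesis
  proof (rule that[of a b])
    fix t assume t: "a < t" "t < b"
    show "k < w t \<and> w t < l" using a(3)[of t] b(3)[of t] t a(1) b(1) by (force simp: not_le[symmetric])
  next
    have i: "v integrable_on {0..b}"
      using a b by (intro integrable_subinterval_real[OF v]) auto
    have "w b - w a = integral {a..b} v"
      using Henstock_Kurzweil_Integration.integral_combine[of 0 a b v] i a b by (simp add: w_def)
    then show "l - k \<le> - integral {a..b} v" using a b by linarith
  qed (use a b in auto)
qed

text \<open>The order of integration is chosen such that, for fixed \<open>h\<close> and \<open>t\<close>, the map
  \<open>y \<mapsto> y + t *\<^sub>R h\<close> is a translation, so that no change of variables is needed.\<close>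

theorem isoperimetric_segments:
  fixes U :: "'a::euclidean_space \<Rightarrow> real" and d :: real
  assumes lp: "line_primitive U V" and kl: "k < l"
    and Y[measurable]: "Y \<in> sets borel" and X[measurable]: "X \<in> sets borel"
    and Q[measurable]: "Q \<in> sets borel" and S[measurable]: "S \<in> sets borel"
    and YU: "\<And>y. y \<in> Y \<Longrightarrow> l \<le> U y" and XU: "\<And>y. y \<in> X \<Longrightarrow> U y \<le> k"
    and Sd: "\<And>h. h \<in> S \<Longrightarrow> norm h \<le> d"
    and seg: "\<And>y h t. y \<in> Y \<Longrightarrow> h \<in> S \<Longrightarrow> y + h \<in> X \<Longrightarrow> 0 \<le> t \<Longrightarrow> t \<le> 1 \<Longrightarrow> y + t *\<^sub>R h \<in> Q"
  shows "ennreal (l - k) * (\<integral>\<^sup>+y. (\<integral>\<^sup>+h. indicator Y y * indicator S h * indicator X (y + h) \<partial>lborel) \<partial>lborel)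
    \<le> emeasure lborel S * (ennreal d * (\<integral>\<^sup>+x. ennreal (indicator (Q \<inter> {x. k < U x \<and> U x < l}) x * norm (V x)) \<partial>lborel))"
proof -
  have U[measurable]: "U \<in> borel_measurable borel" and V[measurable]: "V \<in> borel_measurable borel"
    and Vi: "integrable lborel V" using lp by (auto simp: line_primitive_def)
  define F where "F x = indicator (Q \<inter> {x. k < U x \<and> U x < l}) x * norm (V x)" for x
  have F[measurable]: "F \<in> borel_measurable borel" unfolding F_def by measurable
  \<comment> \<open>A segment from \<open>Y\<close> to \<open>X\<close> passes through the strip, so
    the gradient integrated over its part there, times the length of \<open>h\<close>, is at least
    \<open>l - k\<close>.\<close>
  have main: "AE y in lborel. ennreal (l - k) * (indicator Y y * indicator X (y + h)) \<le>
      ennreal d * (\<integral>\<^sup>+t. indicator {0..1} t * ennreal (F (y + t *\<^sub>R h)) \<partial>lborel)" if h: "h \<in> S" for h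
    using line_primitive_path[OF lp, of h]
  proof eventually_elim
    case (elim y)
    show ?case
    proof (cases "y \<in> Y \<and> y + h \<in> X")
      case True
      define v where "v t = V (y + t *\<^sub>R h) \<bullet> h" for t
      define w where "w t = U y + integral {0..t} v" for t
      have vs: "set_integrable lborel {0..1} v" using elim by (simp add: v_def[abs_def])
      then have v: "v integrable_on {0..1}" by (rule set_borel_integral_eq_integral)
      have w0: "w 0 \<ge> l" using True YU by (simp add: w_def)
      have "U (y + h) \<le> k" using True XU by blast
      then have w1: "w 1 \<le> k" using elim by (simp add: w_def v_def[abs_def])
      obtain a b where ab: "0 \<le> a" "a \<le> b" "b \<le> 1" "\<And>t. a < t \<Longrightarrow> t < b \<Longrightarrow> k < w t \<and> w t < l"
        "l - k \<le> - integral {a..b} v"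
        using level_crossing[OF v kl, of "U y"] w0 w1 unfolding w_def by blast
      have sab: "set_integrable lborel {a..b} v" using vs by (rule set_integrable_subset) (use ab in auto)
      have AE: "AE t in lborel. t \<in> {0..1} \<longrightarrow> U (y + t *\<^sub>R h) = w t"
        using elim by (simp add: w_def v_def[abs_def])
      have "ennreal (l - k) \<le> ennreal (norm (LINT t:{a..b}|lborel. v t))"
        using ab(5) set_borel_integral_eq_integral(2)[OF sab] by (intro ennreal_leI) simp
      also have "\<dots> \<le> (\<integral>\<^sup>+t. ennreal (norm (indicator {a..b} t *\<^sub>R v t)) \<partial>lborel)"
        using sab unfolding set_lebesgue_integral_def set_integrable_def by (rule integral_norm_bound_ennreal)
      also have "\<dots> \<le> (\<integral>\<^sup>+t. ennreal d * (indicator {0..1} t * ennreal (F (y + t *\<^sub>R h))) \<partial>lborel)"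
      proof (rule nn_integral_mono_AE)
        show "AE t in lborel. ennreal (norm (indicator {a..b} t *\<^sub>R v t)) \<le> ennreal d * (indicator {0..1} t * ennreal (F (y + t *\<^sub>R h)))"
          using AE AE_lborel_singleton[of a] AE_lborel_singleton[of b]
        proof eventually_elim
          case (elim t)
          show ?case
          proof (cases "t \<in> {a<..<b}")
            case True
            then have t: "0 \<le> t" "t \<le> 1" using ab by auto
            have "U (y + t *\<^sub>R h) = w t" using elim t by simp
            moreover have "y + t *\<^sub>R h \<in> Q" using seg h \<open>y \<in> Y \<and> y + h \<in> X\<close> t by blast
            ultimately have "F (y + t *\<^sub>R h) = norm (V (y + t *\<^sub>R h))" using ab(4)[of t] True by (simp add: F_def)
            moreover have "norm (v t) \<le> d * norm (V (y + t *\<^sub>R h))"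
            proof -
              have "norm (v t) \<le> norm (V (y + t *\<^sub>R h)) * norm h" unfolding v_def by (simp add: Cauchy_Schwarz_ineq2)
              also have "\<dots> \<le> norm (V (y + t *\<^sub>R h)) * d" using Sd[OF h] by (intro mult_left_mono) auto
              finally show ?thesis by (simp add: mult.commute)
            qed
            ultimately have "ennreal (norm (v t)) \<le> ennreal d * ennreal (F (y + t *\<^sub>R h))"
              by (simp flip: ennreal_mult'' add: ennreal_leI)
            then show ?thesis using t by (auto simp: indicator_def)
          next
            case False
            then show ?thesis using elim by (auto simp: indicator_def)
          qed
        qed
      qed
      also have "\<dots> = ennreal d * (\<integral>\<^sup>+t. indicator {0..1} t * ennreal (F (y + t *\<^sub>R h)) \<partial>lborel)"
        by (rule nn_integral_cmult) measurable
      finally show ?thesis using True by simp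
    next
      case False
      then have "indicator Y y * indicator X (y + h) = (0::ennreal)" by (auto simp: indicator_def)
      then show ?thesis by (simp only: mult_zero_right zero_le)
    qed
  qed
  have "ennreal (l - k) * (\<integral>\<^sup>+y. (\<integral>\<^sup>+h. indicator Y y * indicator S h * indicator X (y + h) \<partial>lborel) \<partial>lborel)
    = ennreal (l - k) * (\<integral>\<^sup>+h. (\<integral>\<^sup>+y. indicator Y y * indicator S h * indicator X (y + h) \<partial>lborel) \<partial>lborel)"
    by (subst lborel_pair.Fubini') measurable
  also have "\<dots> = (\<integral>\<^sup>+h. ennreal (l - k) * (\<integral>\<^sup>+y. indicator Y y * indicator S h * indicator X (y + h) \<partial>lborel) \<partial>lborel)"
    by (rule nn_integral_cmult[symmetric]) measurable
  also have "\<dots> \<le> (\<integral>\<^sup>+h. (ennreal d * (\<integral>\<^sup>+x. ennreal (F x) \<partial>lborel)) * indicator S h \<partial>lborel)"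
  proof (rule nn_integral_mono)
    fix h
    show "ennreal (l - k) * (\<integral>\<^sup>+y. indicator Y y * indicator S h * indicator X (y + h) \<partial>lborel) \<le>
      (ennreal d * (\<integral>\<^sup>+x. ennreal (F x) \<partial>lborel)) * indicator S h"
    proof (cases "h \<in> S")
      case True
      have "ennreal (l - k) * (\<integral>\<^sup>+y. indicator Y y * indicator S h * indicator X (y + h) \<partial>lborel) =
          (\<integral>\<^sup>+y. ennreal (l - k) * (indicator Y y * indicator X (y + h)) \<partial>lborel)"
        using True by (subst nn_integral_cmult) auto
      also have "\<dots> \<le> (\<integral>\<^sup>+y. ennreal d * (\<integral>\<^sup>+t. indicator {0..1} t * ennreal (F (y + t *\<^sub>R h)) \<partial>lborel) \<partial>lborel)"
        using main[OF True] by (rule nn_integral_mono_AE)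
      also have "\<dots> = ennreal d * (\<integral>\<^sup>+y. (\<integral>\<^sup>+t. indicator {0..1} t * ennreal (F (y + t *\<^sub>R h)) \<partial>lborel) \<partial>lborel)"
        by (rule nn_integral_cmult) measurable
      also have "(\<integral>\<^sup>+y. (\<integral>\<^sup>+t. indicator {0..1} t * ennreal (F (y + t *\<^sub>R h)) \<partial>lborel) \<partial>lborel) =
          (\<integral>\<^sup>+t. (\<integral>\<^sup>+y. indicator {0..1} t * ennreal (F (y + t *\<^sub>R h)) \<partial>lborel) \<partial>lborel)"
        by (rule lborel_pair.Fubini') measurable
      also have "\<dots> = (\<integral>\<^sup>+t. (\<integral>\<^sup>+x. ennreal (F x) \<partial>lborel) * indicator {0..1} (t::real) \<partial>lborel)"
      proof (rule nn_integral_cong)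
        fix t :: real
        have "(\<integral>\<^sup>+y. indicator {0..1} t * ennreal (F (y + t *\<^sub>R h)) \<partial>lborel) = indicator {0..1} t * (\<integral>\<^sup>+y. ennreal (F (y + t *\<^sub>R h)) \<partial>lborel)"
          by (rule nn_integral_cmult) measurable
        also have "(\<integral>\<^sup>+y. ennreal (F (y + t *\<^sub>R h)) \<partial>lborel) = (\<integral>\<^sup>+x. ennreal (F x) \<partial>lborel)"
          by (rule nn_integral_lborel_shift) measurable
        finally show "(\<integral>\<^sup>+y. indicator {0..1} t * ennreal (F (y + t *\<^sub>R h)) \<partial>lborel) = (\<integral>\<^sup>+x. ennreal (F x) \<partial>lborel) * indicator {0..1} t"
          by (simp add: mult.commute)
      qed
      also have "\<dots> = (\<integral>\<^sup>+x. ennreal (F x) \<partial>lborel)"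
        by (subst nn_integral_cmult_indicator) auto
      finally show ?thesis using True by simp
    qed simp
  qed
  also have "\<dots> = emeasure lborel S * (ennreal d * (\<integral>\<^sup>+x. ennreal (F x) \<partial>lborel))"
    by (subst nn_integral_cmult_indicator) (auto simp: mult.commute)
  finally show ?thesis by (simp add: F_def)
qed

text \<open>\<open>c\<close> bounds from below the measure of the steps in \<open>S\<close> that
  lead from a point of \<open>Y\<close> into \<open>X\<close>. Keeping \<open>S\<close> free covers
  two situations: short steps when the superlevel set is thin, and steps of up to the diameter of a
  ball.\<close>

lemma isoperimetric_real:
  fixes U :: "'a::euclidean_space \<Rightarrow> real"
  assumes lp: "line_primitive U V" and kl: "k < l" and d: "d \<ge> 0" and c: "c \<ge> 0"
    and Y[measurable]: "Y \<in> sets borel" and X[measurable]: "X \<in> sets borel"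
    and Q[measurable]: "Q \<in> sets borel" and S[measurable]: "S \<in> sets borel"
    and bdd: "bounded Y" "bounded S"
    and YU: "\<And>y. y \<in> Y \<Longrightarrow> l \<le> U y" and XU: "\<And>y. y \<in> X \<Longrightarrow> U y \<le> k"
    and Sd: "\<And>h. h \<in> S \<Longrightarrow> norm h \<le> d"
    and seg: "\<And>y h t. y \<in> Y \<Longrightarrow> h \<in> S \<Longrightarrow> y + h \<in> X \<Longrightarrow> 0 \<le> t \<Longrightarrow> t \<le> 1 \<Longrightarrow> y + t *\<^sub>R h \<in> Q"
    and cY: "\<And>y. y \<in> Y \<Longrightarrow> c \<le> measure lborel {h \<in> S. y + h \<in> X}"
  shows "(l - k) * c * measure lborel Y \<le>
    measure lborel S * d * (LINT x:Q \<inter> {x. k < U x \<and> U x < l}|lborel. norm (V x))"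
proof -
  have U[measurable]: "U \<in> borel_measurable borel" and V[measurable]: "V \<in> borel_measurable borel"
    and Vi: "integrable lborel V" using lp by (auto simp: line_primitive_def)
  have fin: "emeasure lborel A = ennreal (measure lborel A)" if "bounded A" for A :: "'a set"
    using emeasure_bounded_finite[OF that] by (simp add: emeasure_eq_ennreal_measure)
  have "ennreal (l - k) * (ennreal c * emeasure lborel Y) = ennreal (l - k) * (\<integral>\<^sup>+y. ennreal c * indicator Y y \<partial>lborel)"
    by (subst nn_integral_cmult_indicator) auto
  also have "\<dots> \<le> ennreal (l - k) * (\<integral>\<^sup>+y. (\<integral>\<^sup>+h. indicator Y y * indicator S h * indicator X (y + h) \<partial>lborel) \<partial>lborel)"
  proof (intro mult_left_mono nn_integral_mono)
    fix y
    show "ennreal c * indicator Y y \<le> (\<integral>\<^sup>+h. indicator Y y * indicator S h * indicator X (y + h) \<partial>lborel)"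
    proof (cases "y \<in> Y")
      case True
      have "ennreal c \<le> ennreal (measure lborel {h \<in> S. y + h \<in> X})" using cY[OF True] by (rule ennreal_leI)
      also have "\<dots> = emeasure lborel {h \<in> S. y + h \<in> X}"
        using bdd(2) by (intro fin[symmetric]) (auto intro: bounded_subset)
      also have "\<dots> = (\<integral>\<^sup>+h. indicator {h \<in> S. y + h \<in> X} h \<partial>lborel)"
        by (subst nn_integral_indicator) auto
      also have "\<dots> = (\<integral>\<^sup>+h. indicator Y y * indicator S h * indicator X (y + h) \<partial>lborel)"
        using True by (intro nn_integral_cong) (auto simp: indicator_def)
      finally show ?thesis using True by simp
    qed simp
  qed simp
  also have "\<dots> \<le> emeasure lborel S * (ennreal d * (\<integral>\<^sup>+x. ennreal (indicator (Q \<inter> {x. k < U x \<and> U x < l}) x * norm (V x)) \<partial>lborel))"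
    by (rule isoperimetric_segments[OF lp kl Y X Q S YU XU Sd seg])
  also have "(\<integral>\<^sup>+x. ennreal (indicator (Q \<inter> {x. k < U x \<and> U x < l}) x * norm (V x)) \<partial>lborel) =
      ennreal (LINT x:Q \<inter> {x. k < U x \<and> U x < l}|lborel. norm (V x))"
    unfolding set_lebesgue_integral_def
  proof (subst nn_integral_eq_integral)
    have "integrable lborel (\<lambda>x. indicat_real (Q \<inter> {x. k < U x \<and> U x < l}) x *\<^sub>R norm (V x))"
      using Vi by (intro integrable_mult_indicator integrable_norm) auto
    then show "integrable lborel (\<lambda>x. indicat_real (Q \<inter> {x. k < U x \<and> U x < l}) x * norm (V x))" by simp
  qed auto
  finally have le: "ennreal (l - k) * (ennreal c * emeasure lborel Y) \<le>
      emeasure lborel S * (ennreal d * ennreal (LINT x:Q \<inter> {x. k < U x \<and> U x < l}|lborel. norm (V x)))" .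
  have nn: "(LINT x:Q \<inter> {x. k < U x \<and> U x < l}|lborel. norm (V x)) \<ge> 0"
    by (auto simp: set_lebesgue_integral_def intro!: Bochner_Integration.integral_nonneg)
  from le have "ennreal ((l - k) * (c * measure lborel Y)) \<le>
      ennreal (measure lborel S * (d * (LINT x:Q \<inter> {x. k < U x \<and> U x < l}|lborel. norm (V x))))"
    using kl c d by (simp add: fin[OF bdd(1)] fin[OF bdd(2)] ennreal_mult' ennreal_mult'' nn)
  moreover have "measure lborel S * (d * (LINT x:Q \<inter> {x. k < U x \<and> U x < l}|lborel. norm (V x))) \<ge> 0"
    using d nn by simp
  ultimately show ?thesis by (simp add: ennreal_le_iff mult.assoc)
qed

section \<open>The isoperimetric inequality in balls\<close>

abbreviation "super_level U k x0 r \<equiv> {x \<in> ball x0 r. U x > (k::real)}"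

lemma measure_bounded_mono:
  fixes A B :: "'a::euclidean_space set"
  assumes "A \<subseteq> B" "A \<in> sets borel" "B \<in> sets borel" "bounded B"
  shows "measure lborel A \<le> measure lborel B"
  using assms emeasure_bounded_finite[OF assms(4)] by (intro measure_mono_fmeasurable) (auto simp: fmeasurable_def)

lemma super_level_mono:
  fixes U :: "'a::euclidean_space \<Rightarrow> real"
  assumes "U \<in> borel_measurable borel" "k' \<le> k" "r \<le> r'"
  shows "measure lborel (super_level U k x0 r) \<le> measure lborel (super_level U k' x0 r')"
proof (rule measure_bounded_mono)
  show "bounded (super_level U k' x0 r')" by (rule bounded_subset[OF bounded_ball]) auto
qed (use assms in auto)

lemma measure_vimage_plus:
  fixes y :: "'a::euclidean_space"
  assumes "Z \<in> sets borel"
  shows "measure lborel ((+) y -` Z) = measure lborel Z"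
  using measure_distr[of "(+) y" lborel borel Z] assms by (simp add: lborel_distr_plus)

text \<open>If the superlevel set fills at most half of a ball of radius \<open>e\<close>, then from
  each point at least half of the steps shorter than \<open>e\<close> end where \<open>U\<close> is
  at most \<open>k\<close>. The gain over the inequality in the full ball is the factor
  \<open>e\<close> in place of the radius, and this factor drives the iteration.\<close>

lemma isoperimetric_small_scale:
  fixes U :: "'a::euclidean_space \<Rightarrow> real"
  assumes lp: "line_primitive U V" and kl: "k < l" and e: "0 < e" "r + e \<le> a"
    and small: "measure lborel (super_level U k x0 a) \<le> unit_ball_vol DIM('a) * e ^ DIM('a) / 2"
  shows "(l - k) * measure lborel {x \<in> ball x0 r. l \<le> U x} \<le>
    2 * e * (LINT x:{x \<in> ball x0 a. k < U x \<and> U x < l}|lborel. norm (V x))"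
proof -
  have U[measurable]: "U \<in> borel_measurable borel" using lp by (auto simp: line_primitive_def)
  define \<omega> where "\<omega> = unit_ball_vol DIM('a) * e ^ DIM('a)"
  have \<omega>: "\<omega> > 0" using e by (simp add: \<omega>_def)
  have Se: "measure lborel (ball y e) = \<omega>" for y :: 'a using e by (simp add: content_ball \<omega>_def)
  have m1[measurable]: "{x \<in> ball x0 r. l \<le> U x} \<in> sets borel" "{x. U x \<le> k} \<in> sets borel"
    "super_level U k x0 a \<in> sets borel" by measurable
  have "(l - k) * (\<omega> / 2) * measure lborel {x \<in> ball x0 r. l \<le> U x} \<le>
    measure lborel (ball (0::'a) e) * e * (LINT x:ball x0 a \<inter> {x. k < U x \<and> U x < l}|lborel. norm (V x))"
  proof (rule isoperimetric_real[OF lp kl, where X="{x. U x \<le> k}"])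
    show "bounded {x \<in> ball x0 r. l \<le> U x}" by (rule bounded_subset[OF bounded_ball]) auto
    fix y assume y: "y \<in> {x \<in> ball x0 r. l \<le> U x}"
    have sub: "ball y e \<subseteq> ball x0 a" using y e by (auto intro: order.strict_trans1[OF dist_triangle, of _ _ y] simp: dist_commute)
        (metis add_strict_mono dist_commute dist_triangle_lt less_le_trans)
    have eq: "{h \<in> ball 0 e. y + h \<in> {x. U x \<le> k}} = (+) y -` (ball y e - super_level U k x0 a)"
    proof -
      have "dist x0 (y + h) < a" if "norm h < e" for h
      proof -
        have "y + h \<in> ball y e" using that by (simp add: dist_norm)
        then show ?thesis using sub by auto
      qed
      then show ?thesis by (auto simp: dist_norm)
    qed
    \<comment> \<open>Removing the superlevel set from the small ball leaves at least half of its
      volume \<omega>.\<close>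
    have "\<omega> / 2 \<le> measure lborel (ball y e) - measure lborel (super_level U k x0 a)"
      using small by (simp add: Se \<omega>_def)
    also have "\<dots> \<le> measure lborel (ball y e - super_level U k x0 a)"
    proof -
      have "measure lborel (ball y e) \<le> measure lborel ((ball y e - super_level U k x0 a) \<union> super_level U k x0 a)"
        by (rule measure_bounded_mono) (auto intro: bounded_subset[OF bounded_ball[of x0 a]] bounded_subset[OF bounded_ball[of y e]])
      also have "\<dots> \<le> measure lborel (ball y e - super_level U k x0 a) + measure lborel (super_level U k x0 a)"
        by (rule measure_Un_le) auto
      finally show ?thesis by simp
    qed
    also have "\<dots> = measure lborel {h \<in> ball 0 e. y + h \<in> {x. U x \<le> k}}"
      unfolding eq by (rule measure_vimage_plus[symmetric]) measurable
    finally show "\<omega> / 2 \<le> measure lborel {h \<in> ball 0 e. y + h \<in> {x. U x \<le> k}}" .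
  next
    fix y h t assume *: "y \<in> {x \<in> ball x0 r. l \<le> U x}" "h \<in> ball (0::'a) e" "0 \<le> t" "t \<le> (1::real)"
    have "dist x0 (y + t *\<^sub>R h) \<le> dist x0 y + norm (t *\<^sub>R h)"
      using dist_triangle[of x0 "y + t *\<^sub>R h" y] by (simp add: dist_norm)
    also have "norm (t *\<^sub>R h) \<le> norm h" using * by (simp add: mult_left_le_one_le)
    finally show "y + t *\<^sub>R h \<in> ball x0 a" using * e by simp
  qed (use e \<omega> in auto)
  then have "\<omega> * ((l - k) * measure lborel {x \<in> ball x0 r. l \<le> U x}) \<le>
      \<omega> * (2 * e * (LINT x:ball x0 a \<inter> {x. k < U x \<and> U x < l}|lborel. norm (V x)))"
    unfolding Se by (simp add: field_simps)
  moreover have "ball x0 a \<inter> {x. k < U x \<and> U x < l} = {x \<in> ball x0 a. k < U x \<and> U x < l}" by auto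
  ultimately show ?thesis using \<omega> by (simp only: mult_le_cancel_left_pos)
qed

text \<open>With steps from the ball of radius \<open>2 * r\<close>, every point of the ball is
  reached from every other one, and the segments stay inside by convexity.\<close>

lemma isoperimetric_ball:
  fixes U :: "'a::euclidean_space \<Rightarrow> real"
  assumes lp: "line_primitive U V" and kl: "k < l" and r: "0 < r"
  shows "(l - k) * measure lborel {x \<in> ball x0 r. U x \<le> k} * measure lborel {x \<in> ball x0 r. l \<le> U x} \<le>
    unit_ball_vol DIM('a) * (2 * r) ^ DIM('a) * (2 * r) * (LINT x:{x \<in> ball x0 r. k < U x \<and> U x < l}|lborel. norm (V x))"
proof -
  have U[measurable]: "U \<in> borel_measurable borel" using lp by (auto simp: line_primitive_def)
  have m1[measurable]: "{x \<in> ball x0 r. l \<le> U x} \<in> sets borel" "{x \<in> ball x0 r. U x \<le> k} \<in> sets borel" by measurable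
  have "(l - k) * measure lborel {x \<in> ball x0 r. U x \<le> k} * measure lborel {x \<in> ball x0 r. l \<le> U x} \<le>
    measure lborel (ball (0::'a) (2 * r)) * (2 * r) * (LINT x:ball x0 r \<inter> {x. k < U x \<and> U x < l}|lborel. norm (V x))"
  proof (rule isoperimetric_real[OF lp kl, where X="{x \<in> ball x0 r. U x \<le> k}"])
    show "bounded {x \<in> ball x0 r. l \<le> U x}" by (rule bounded_subset[OF bounded_ball]) auto
    fix y assume y: "y \<in> {x \<in> ball x0 r. l \<le> U x}"
    have eq: "{h \<in> ball 0 (2 * r). y + h \<in> {x \<in> ball x0 r. U x \<le> k}} = (+) y -` {x \<in> ball x0 r. U x \<le> k}"
    proof safe
      fix h assume "y + h \<in> ball x0 r"
      then have "norm (y + h - y) < 2 * r" using y dist_triangle[of "y + h" y x0] by (simp add: dist_norm norm_minus_commute)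
      then show "h \<in> ball 0 (2 * r)" by simp
    qed auto
    show "measure lborel {x \<in> ball x0 r. U x \<le> k} \<le> measure lborel {h \<in> ball 0 (2 * r). y + h \<in> {x \<in> ball x0 r. U x \<le> k}}"
      unfolding eq measure_vimage_plus[OF m1(2)] ..
  next
    fix y h t assume *: "y \<in> {x \<in> ball x0 r. l \<le> U x}" "y + h \<in> {x \<in> ball x0 r. U x \<le> k}" "0 \<le> t" "t \<le> (1::real)"
    have "(1 - t) *\<^sub>R y + t *\<^sub>R (y + h) \<in> ball x0 r"
      using convex_ball[of x0 r] * by (intro convexD) auto
    then show "y + t *\<^sub>R h \<in> ball x0 r" by (simp add: algebra_simps)
  qed (use r in auto)
  moreover have "ball x0 r \<inter> {x. k < U x \<and> U x < l} = {x \<in> ball x0 r. k < U x \<and> U x < l}" by auto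
  ultimately show ?thesis using r by (simp add: content_ball)
qed

section \<open>De Giorgi iteration\<close>

text \<open>The defining inequality of the De Giorgi class in its \<open>W\<^sup>1\<^sup>,\<^sup>1\<close> form; \<open>T\<close> is the parameter of the
  truncation \<open>norm (V x) \<le> T * H / R\<close>, which is large only in the shrinking argument.\<close>

definition energy_est ::
    "('a::euclidean_space \<Rightarrow> real) \<Rightarrow> ('a \<Rightarrow> 'a) \<Rightarrow> 'a \<Rightarrow> real \<Rightarrow> nat \<Rightarrow> real \<Rightarrow> real \<Rightarrow> real \<Rightarrow> real \<Rightarrow> bool" where
  "energy_est U V x0 R m \<Gamma> p k H \<longleftrightarrow>
     (\<forall>l a b T S. k < l \<and> 0 < a \<and> a < b \<and> b \<le> R \<and> 1 \<le> T \<and> S \<in> sets borel \<and> S \<subseteq> super_level U l x0 a \<longrightarrow>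
        (LINT x:S|lborel. norm (V x)) \<le> T * (H / R) * measure lborel S +
          T powr (1 - p) * \<Gamma> * (R / (b - a)) ^ m * (H / (l - k)) * (H / R) * measure lborel (super_level U k x0 b))"

lemma energy_estD:
  assumes "energy_est U V x0 R m \<Gamma> p k H" "k < l" "0 < a" "a < b" "b \<le> R" "1 \<le> T"
    "S \<in> sets borel" "S \<subseteq> super_level U l x0 a"
  shows "(LINT x:S|lborel. norm (V x)) \<le> T * (H / R) * measure lborel S +
    T powr (1 - p) * \<Gamma> * (R / (b - a)) ^ m * (H / (l - k)) * (H / R) * measure lborel (super_level U k x0 b)"
  using assms unfolding energy_est_def by blast

text \<open>\<open>deg_eta\<close> fixes the smallness \<open>deg_eta ^ n / 2\<close> of the initial level set (relative to the ball)
  from which the iteration converges, and \<open>deg_s\<close> is the number of halvings of the level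
  after which the level set is that small.\<close>

definition deg_B :: "nat \<Rightarrow> real" where
  "deg_B m = 2 ^ (m + 2)"

definition deg_eta :: "nat \<Rightarrow> nat \<Rightarrow> real \<Rightarrow> real" where
  "deg_eta n m \<Gamma> = 1 / (4 * \<Gamma> * deg_B m ^ (n + 4))"

text \<open>The solution T of T^(1-p) \<Gamma> 4^(m+1) = \<eta> / 2^(n+5), where \<eta> is the n-th
  power of \<open>deg_eta\<close>. In the shrinking argument the term with T^(1-p) then amounts to
  half of the admissible measure, and \<open>deg_s\<close> is the number of levels that brings the
  other term down to the same size.\<close>

definition deg_T :: "nat \<Rightarrow> nat \<Rightarrow> real \<Rightarrow> real \<Rightarrow> real" where
  "deg_T n m p \<Gamma> = (2 ^ (n + 5) * \<Gamma> * 4 ^ (m + 1) / deg_eta n m \<Gamma> ^ n) powr (1 / (p - 1))"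

definition deg_s :: "nat \<Rightarrow> nat \<Rightarrow> real \<Rightarrow> real \<Rightarrow> nat" where
  "deg_s n m p \<Gamma> = nat \<lceil>2 ^ (n + 5) * deg_T n m p \<Gamma> / deg_eta n m \<Gamma> ^ n\<rceil>"

context
  fixes U :: "'a::euclidean_space \<Rightarrow> real" and V :: "'a \<Rightarrow> 'a" and x0 :: 'a and R :: real
    and m :: nat and \<Gamma> p :: real
  assumes lp: "line_primitive U V" and R: "R > 0" and \<Gamma>: "\<Gamma> \<ge> 1" and p: "p > 1"
begin

lemma borel_U[measurable]: "U \<in> borel_measurable borel"
  using lp by (auto simp: line_primitive_def)

lemma deg_B_ge: "deg_B m \<ge> 4" "deg_B m > 0"
  by (auto simp: deg_B_def)

lemma deg_eta_bounds: "0 < deg_eta DIM('a) m \<Gamma>" "deg_eta DIM('a) m \<Gamma> \<le> 1 / deg_B m ^ 4"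
proof -
  show "0 < deg_eta DIM('a) m \<Gamma>" using \<Gamma> deg_B_ge by (simp add: deg_eta_def)
  have "1 * deg_B m ^ 4 \<le> (4 * \<Gamma>) * deg_B m ^ (DIM('a) + 4)"
    using \<Gamma> deg_B_ge by (intro mult_mono power_increasing) auto
  then show "deg_eta DIM('a) m \<Gamma> \<le> 1 / deg_B m ^ 4"
    unfolding deg_eta_def using deg_B_ge by (intro divide_left_mono) (use \<Gamma> deg_B_ge in \<open>auto intro!: mult_pos_pos\<close>)
qed

text \<open>The measure of a level set is expressed by the radius \<open>e\<close> of a comparable
  ball, and this radius is also the step length in the isoperimetric inequality. It shrinks by the
  factor \<open>deg_B m\<close> each time, which compensates the growing loss from closer levels and
  radii; so a plain induction takes the place of a nonlinear recursion.\<close>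

lemma level_set_decay:
  assumes H: "H > 0" and E: "\<And>k. k \<ge> K0 \<Longrightarrow> energy_est U V x0 R m \<Gamma> p k H"
    and small: "measure lborel (super_level U K0 x0 (R / 2)) \<le> unit_ball_vol DIM('a) * (deg_eta DIM('a) m \<Gamma> * R) ^ DIM('a) / 2"
  shows "measure lborel (super_level U (K0 + H / 2 * (1 - 1 / 2 ^ j)) x0 (R / 4 * (1 + 1 / 2 ^ j)))
    \<le> unit_ball_vol DIM('a) * (deg_eta DIM('a) m \<Gamma> * R / deg_B m ^ j) ^ DIM('a) / 2"
proof (induction j)
  case 0
  then show ?case using small by simp
next
  case (Suc j)
  define \<delta> where "\<delta> = 1 / (2::real) ^ j"
  have \<delta>: "0 < \<delta>" "\<delta> \<le> 1" by (auto simp: \<delta>_def)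
  define k where "k = K0 + H / 2 * (1 - \<delta>)"
  \<comment> \<open>The energy estimate starts from level \<open>k\<close> and radius
    \<open>b\<close> and holds above \<open>l\<close> inside radius \<open>a\<close>; the
    isoperimetric inequality then works between \<open>l\<close> and \<open>k'\<close>, with step
    room between \<open>r\<close> and \<open>a\<close>.\<close>
  define l where "l = k + H * \<delta> / 8"
  define k' where "k' = k + H * \<delta> / 4"
  define b where "b = R / 4 * (1 + \<delta>)"
  define r where "r = R / 4 * (1 + \<delta> / 2)"
  define a where "a = (b + r) / 2"
  define e where "e = deg_eta DIM('a) m \<Gamma> * R / deg_B m ^ j"
  define A where "A = measure lborel (super_level U k x0 b)"
  have k'_eq: "K0 + H / 2 * (1 - 1 / 2 ^ Suc j) = k'" by (simp add: k'_def k_def \<delta>_def field_simps)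
  have r_eq: "R / 4 * (1 + 1 / 2 ^ Suc j) = r" by (simp add: r_def \<delta>_def field_simps)
  have "R * \<delta> > 0" "H * \<delta> > 0" "R * \<delta> \<le> R" using H R \<delta> by auto
  moreover have "0 < a" using R \<delta> by (simp add: a_def b_def r_def add_pos_pos)
  ultimately have ord: "k < l" "l < k'" "0 < a" "a < b" "b \<le> R" "K0 \<le> k" "r < a"
    using H R \<delta> by (auto simp: l_def k'_def a_def b_def r_def k_def field_simps)
  have ba: "b - a = R * \<delta> / 16" "a - r = R * \<delta> / 16" by (auto simp: b_def a_def r_def field_simps)
  have IH: "A \<le> unit_ball_vol DIM('a) * e ^ DIM('a) / 2"
    using Suc by (simp add: A_def k_def b_def e_def \<delta>_def)
  have e: "0 < e" "r + e \<le> a"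
  proof -
    show "0 < e" using deg_eta_bounds deg_B_ge R by (simp add: e_def)
    \<comment> \<open>The step length must fit into the gap between \<open>r\<close> and
      \<open>a\<close>, which halves with \<open>j\<close>, whereas \<open>e\<close> shrinks at
      least as fast.\<close>
    have "deg_eta DIM('a) m \<Gamma> / deg_B m ^ j \<le> (1 / 4 ^ 4) / 2 ^ j"
    proof (rule frac_le)
      have "1 / deg_B m ^ 4 \<le> 1 / 4 ^ 4" using deg_B_ge by (intro divide_left_mono power_mono) auto
      then show "deg_eta DIM('a) m \<Gamma> \<le> 1 / 4 ^ 4" using deg_eta_bounds by linarith
      show "2 ^ j \<le> deg_B m ^ j" using deg_B_ge by (intro power_mono) auto
    qed auto
    also have "(1 / 4 ^ 4) / 2 ^ j \<le> \<delta> / 16" by (simp add: \<delta>_def field_simps)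
    finally have "R * (deg_eta DIM('a) m \<Gamma> / deg_B m ^ j) \<le> R * (\<delta> / 16)" using R by (intro mult_left_mono) auto
    then have "e \<le> R * \<delta> / 16" by (simp add: e_def mult.commute)
    then show "r + e \<le> a" using ba by linarith
  qed
  have mA: "measure lborel (super_level U l x0 a) \<le> A"
    unfolding A_def using ord by (intro measure_bounded_mono) (auto intro: bounded_subset[OF bounded_ball])
  define D where "D = (LINT x:{x \<in> ball x0 a. l < U x \<and> U x < k'}|lborel. norm (V x))"
  have iso: "(k' - l) * measure lborel {x \<in> ball x0 r. k' \<le> U x} \<le> 2 * e * D"
    unfolding D_def using mA IH ord e by (intro isoperimetric_small_scale[OF lp]) auto
  have D: "D \<le> 2 * \<Gamma> * (16 / \<delta>) ^ (m + 1) * (H / R) * A"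
  proof -
    have "D \<le> 1 * (H / R) * measure lborel {x \<in> ball x0 a. l < U x \<and> U x < k'} +
        1 powr (1 - p) * \<Gamma> * (R / (b - a)) ^ m * (H / (l - k)) * (H / R) * A"
    proof -
      have "energy_est U V x0 R m \<Gamma> p k H" using E ord by auto
      then show ?thesis unfolding D_def A_def by (rule energy_estD) (use ord in auto)
    qed
    also have "R / (b - a) = 16 / \<delta>" using R \<delta> by (simp add: ba)
    also have "H / (l - k) = 8 / \<delta>" using H \<delta> by (simp add: l_def)
    also have "1 * (H / R) * measure lborel {x \<in> ball x0 a. l < U x \<and> U x < k'} +
        1 powr (1 - p) * \<Gamma> * (16 / \<delta>) ^ m * (8 / \<delta>) * (H / R) * A \<le>
        \<Gamma> * (16 / \<delta>) ^ (m + 1) * (H / R) * A + \<Gamma> * (16 / \<delta>) ^ (m + 1) * (H / R) * A"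
    proof (rule add_mono)
      have "measure lborel {x \<in> ball x0 a. l < U x \<and> U x < k'} \<le> A"
        unfolding A_def using ord by (intro measure_bounded_mono) (auto intro: bounded_subset[OF bounded_ball])
      moreover have "1 \<le> \<Gamma> * (16 / \<delta>) ^ (m + 1)"
        using \<Gamma> \<delta> mult_mono[of 1 \<Gamma> 1 "(16 / \<delta>) ^ (m + 1)"] one_le_power[of "16 / \<delta>" "m + 1"] by simp
      ultimately show "1 * (H / R) * measure lborel {x \<in> ball x0 a. l < U x \<and> U x < k'} \<le> \<Gamma> * (16 / \<delta>) ^ (m + 1) * (H / R) * A"
        using H R \<Gamma> \<delta> by (intro mult_mono) (auto simp: A_def)
      show "1 powr (1 - p) * \<Gamma> * (16 / \<delta>) ^ m * (8 / \<delta>) * (H / R) * A \<le> \<Gamma> * (16 / \<delta>) ^ (m + 1) * (H / R) * A"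
        using H R \<Gamma> \<delta> by (intro mult_right_mono) (auto simp: A_def field_simps)
    qed
    finally show ?thesis by (simp add: mult_ac)
  qed
  have "measure lborel (super_level U k' x0 r) \<le> measure lborel {x \<in> ball x0 r. k' \<le> U x}"
    by (intro measure_bounded_mono) (auto intro: bounded_subset[OF bounded_ball])
  also have "\<dots> \<le> 16 / (H * \<delta>) * e * D"
    using iso H \<delta> by (simp add: k'_def l_def field_simps)
  also have "\<dots> \<le> 16 / (H * \<delta>) * e * (2 * \<Gamma> * (16 / \<delta>) ^ (m + 1) * (H / R) * A)"
    using D e H \<delta> by (intro mult_left_mono) auto
  also have "\<dots> = 2 * \<Gamma> * (16 / \<delta>) ^ (m + 2) * (e / R) * A"
    using H by (simp add: field_simps)
  \<comment> \<open>The exponent collects \<open>m\<close> factors from the cutoff, one from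
    \<open>H / (l - k)\<close> and one from dividing by \<open>k' - l\<close>. As
    \<open>16 / \<delta> = 2 ^ (j + 4)\<close>, this is the origin of \<open>deg_B\<close>.\<close>
  also have "(16 / \<delta>) ^ (m + 2) = deg_B m ^ (j + 4)"
  proof -
    have "16 / \<delta> = 2 ^ (j + 4)" by (simp add: \<delta>_def power_add)
    then show ?thesis by (simp only: deg_B_def power_mult[symmetric] mult.commute)
  qed
  also have "2 * \<Gamma> * deg_B m ^ (j + 4) * (e / R) * A \<le> A / deg_B m ^ DIM('a)"
  proof -
    \<comment> \<open>This cancellation of the powers of \<open>deg_B m\<close> with exponent
      \<open>j\<close> dictates the value of \<open>deg_eta\<close>.\<close>
    have "2 * \<Gamma> * deg_B m ^ (j + 4) * (e / R) = 1 / 2 / deg_B m ^ DIM('a)"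
      using R \<Gamma> deg_B_ge(2) by (simp add: e_def deg_eta_def power_add field_simps)
    also have "\<dots> \<le> 1 / deg_B m ^ DIM('a)" using deg_B_ge(2) by (simp add: field_simps)
    finally have "(2 * \<Gamma> * deg_B m ^ (j + 4) * (e / R)) * A \<le> (1 / deg_B m ^ DIM('a)) * A"
      by (rule mult_right_mono) (simp add: A_def)
    then show ?thesis by (simp only: times_divide_eq_left mult_1)
  qed
  also have "A / deg_B m ^ DIM('a) \<le> unit_ball_vol DIM('a) * e ^ DIM('a) / 2 / deg_B m ^ DIM('a)"
    using IH deg_B_ge(2) by (intro divide_right_mono) auto
  also have "\<dots> = unit_ball_vol DIM('a) * (deg_eta DIM('a) m \<Gamma> * R / deg_B m ^ Suc j) ^ DIM('a) / 2"
    using deg_B_ge(2) by (simp add: e_def power_divide power_mult_distrib)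
  finally show ?case unfolding k'_eq r_eq .
qed

text \<open>The set in question lies in all sets of \<open>level_set_decay\<close>, whose measures
  tend to 0.\<close>

lemma sup_reduction:
  assumes H: "H > 0" and E: "\<And>k. k \<ge> K0 \<Longrightarrow> energy_est U V x0 R m \<Gamma> p k H"
    and small: "measure lborel (super_level U K0 x0 (R / 2)) \<le> unit_ball_vol DIM('a) * (deg_eta DIM('a) m \<Gamma> * R) ^ DIM('a) / 2"
  shows "measure lborel (super_level U (K0 + H / 2) x0 (R / 4)) = 0"
proof -
  let ?s = "\<lambda>j. unit_ball_vol DIM('a) * (deg_eta DIM('a) m \<Gamma> * R / deg_B m ^ j) ^ DIM('a) / 2"
  have "measure lborel (super_level U (K0 + H / 2) x0 (R / 4)) \<le> ?s j" for j
  proof -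
    have "K0 + H / 2 * (1 - 1 / 2 ^ j) \<le> K0 + H / 2" "R / 4 \<le> R / 4 * (1 + 1 / 2 ^ j)"
      using H R by (auto simp: field_simps)
    then have "measure lborel (super_level U (K0 + H / 2) x0 (R / 4)) \<le>
        measure lborel (super_level U (K0 + H / 2 * (1 - 1 / 2 ^ j)) x0 (R / 4 * (1 + 1 / 2 ^ j)))"
      by (intro super_level_mono borel_U)
    also have "\<dots> \<le> ?s j" by (rule level_set_decay[OF assms])
    finally show ?thesis .
  qed
  moreover have "?s \<longlonglongrightarrow> unit_ball_vol DIM('a) * (deg_eta DIM('a) m \<Gamma> * R * 0) ^ DIM('a) / 2"
  proof -
    have "(\<lambda>j. inverse (deg_B m ^ j)) \<longlonglongrightarrow> 0" using deg_B_ge by (intro LIMSEQ_inverse_realpow_zero) auto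
    then show ?thesis unfolding divide_inverse[of _ "deg_B m ^ _"] by (intro tendsto_intros) auto
  qed
  ultimately have "measure lborel (super_level U (K0 + H / 2) x0 (R / 4)) \<le> unit_ball_vol DIM('a) * (deg_eta DIM('a) m \<Gamma> * R * 0) ^ DIM('a) / 2"
    by (intro tendsto_lowerbound[where F=sequentially]) auto
  then have le: "measure lborel (super_level U (K0 + H / 2) x0 (R / 4)) \<le> 0" by (simp add: power_0_left)
  show ?thesis by (rule antisym[OF le measure_nonneg])
qed

text \<open>The isoperimetric inequality is summed over the levels, with the height halved each
  time. The strips \<open>S j\<close> are disjoint, so the terms with \<open>T\<close> add up to at
  most \<open>T\<close> times the volume of the ball, independently of \<open>s\<close>. Only the
  terms with the small factor \<open>T powr (1 - p)\<close> grow with \<open>s\<close>.\<close>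

lemma measure_shrinking:
  fixes s :: nat
  assumes H: "H > 0" and T: "T \<ge> 1"
    and E: "\<And>j. j < s \<Longrightarrow> energy_est U V x0 R m \<Gamma> p (k0 + H * (1 - 1 / 2 ^ j)) (H / 2 ^ j)"
    and half: "measure lborel {x \<in> ball x0 (R / 2). U x \<le> k0} \<ge> measure lborel (ball x0 (R / 2)) / 2"
  shows "s * measure lborel {x \<in> ball x0 (R / 2). k0 + H * (1 - 1 / 2 ^ s) \<le> U x} \<le>
    2 ^ (DIM('a) + 3) * (unit_ball_vol DIM('a) * R ^ DIM('a)) * (T + s * (T powr (1 - p) * \<Gamma> * 4 ^ (m + 1)))"
proof -
  define w where "w = unit_ball_vol DIM('a) * R ^ DIM('a)"
  have w: "w > 0" using R by (simp add: w_def)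
  define k where "k j = k0 + H * (1 - 1 / 2 ^ j)" for j :: nat
  define Y where "Y j = measure lborel {x \<in> ball x0 (R / 2). k j \<le> U x}" for j
  define S where "S j = {x \<in> ball x0 (R / 2). k j < U x \<and> U x < k (Suc j)}" for j
  have kmono: "k i \<le> k j" if "i \<le> j" for i j
  proof -
    have "(1::real) / 2 ^ j \<le> 1 / 2 ^ i" using that by (intro divide_left_mono power_increasing) auto
    then show ?thesis using H by (simp add: k_def mult_left_mono)
  qed
  have Sb: "S j \<in> sets borel" for j unfolding S_def by measurable
  have step: "Y (Suc j) \<le> 2 ^ (DIM('a) + 3) * (T * measure lborel (S j) + T powr (1 - p) * \<Gamma> * 4 ^ (m + 1) * w)" if j: "j < s" for j
  proof -
    define h where "h = H / 2 ^ j"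
    have h: "h > 0" using H by (simp add: h_def)
    \<comment> \<open>A level strictly between \<open>k j\<close> and \<open>k (Suc j)\<close> is
      inserted because the energy estimate needs \<open>l - k\<close> comparable to the
      height.\<close>
    define l where "l = k j + h / 4"
    have k': "k (Suc j) = k j + h / 2" by (simp add: k_def h_def field_simps)
    define D where "D = (LINT x:{x \<in> ball x0 (R / 2). l < U x \<and> U x < k (Suc j)}|lborel. norm (V x))"
    have "D \<le> T * (h / R) * measure lborel {x \<in> ball x0 (R / 2). l < U x \<and> U x < k (Suc j)} +
        T powr (1 - p) * \<Gamma> * (R / (3 * R / 4 - R / 2)) ^ m * (h / (l - k j)) * (h / R) * measure lborel (super_level U (k j) x0 (3 * R / 4))"
    proof -
      have "energy_est U V x0 R m \<Gamma> p (k j) h" using E[OF j] by (simp add: k_def h_def)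
      then show ?thesis unfolding D_def by (rule energy_estD) (use R T h in \<open>auto simp: l_def\<close>)
    qed
    also have "R / (3 * R / 4 - R / 2) = 4" using R by (simp add: field_simps)
    also have "h / (l - k j) = 4" using h by (simp add: l_def)
    also have "T * (h / R) * measure lborel {x \<in> ball x0 (R / 2). l < U x \<and> U x < k (Suc j)} +
        T powr (1 - p) * \<Gamma> * 4 ^ m * 4 * (h / R) * measure lborel (super_level U (k j) x0 (3 * R / 4)) \<le>
       T * (h / R) * measure lborel (S j) + T powr (1 - p) * \<Gamma> * 4 ^ m * 4 * (h / R) * w"
    proof (intro add_mono mult_left_mono)
      show "measure lborel {x \<in> ball x0 (R / 2). l < U x \<and> U x < k (Suc j)} \<le> measure lborel (S j)"
        unfolding S_def using h by (intro measure_bounded_mono) (auto simp: l_def intro: bounded_subset[OF bounded_ball[of x0 "R / 2"]])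
      have "measure lborel (super_level U (k j) x0 (3 * R / 4)) \<le> measure lborel (ball x0 R)"
        using R by (intro measure_bounded_mono) auto
      then show "measure lborel (super_level U (k j) x0 (3 * R / 4)) \<le> w" using R by (simp add: w_def content_ball)
    qed (use R T h \<Gamma> in auto)
    finally have D: "D \<le> (h / R) * (T * measure lborel (S j) + T powr (1 - p) * \<Gamma> * 4 ^ (m + 1) * w)"
      by (simp add: algebra_simps)
    have "(k (Suc j) - l) * measure lborel {x \<in> ball x0 (R / 2). U x \<le> l} * Y (Suc j) \<le> w * R * D"
      using isoperimetric_ball[OF lp, of l "k (Suc j)" "R / 2" x0] R h k' by (simp add: Y_def D_def w_def l_def)
    moreover have "w / 2 ^ DIM('a) / 2 \<le> measure lborel {x \<in> ball x0 (R / 2). U x \<le> l}"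
    proof -
      have "w / 2 ^ DIM('a) / 2 = measure lborel (ball x0 (R / 2)) / 2"
        using R by (simp add: w_def content_ball power_divide)
      also have "\<dots> \<le> measure lborel {x \<in> ball x0 (R / 2). U x \<le> k0}" by (rule half)
      also have "\<dots> \<le> measure lborel {x \<in> ball x0 (R / 2). U x \<le> l}"
        using kmono[of 0 j] h by (intro measure_bounded_mono) (auto simp: l_def k_def intro: bounded_subset[OF bounded_ball[of x0 "R / 2"]])
      finally show ?thesis .
    qed
    then have "h / 4 * (w / 2 ^ DIM('a) / 2) * Y (Suc j) \<le> (k (Suc j) - l) * measure lborel {x \<in> ball x0 (R / 2). U x \<le> l} * Y (Suc j)"
      using h w by (intro mult_right_mono mult_mono) (auto simp: k' l_def Y_def)
    ultimately have "h / 4 * (w / 2 ^ DIM('a) / 2) * Y (Suc j) \<le> w * R * D" by linarith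
    also have "\<dots> \<le> w * R * ((h / R) * (T * measure lborel (S j) + T powr (1 - p) * \<Gamma> * 4 ^ (m + 1) * w))"
      using D w R by (intro mult_left_mono) auto
    also have "\<dots> = (w * h) * (T * measure lborel (S j) + T powr (1 - p) * \<Gamma> * 4 ^ (m + 1) * w)" using R by simp
    finally have "(w * h) * Y (Suc j) \<le> (w * h) * (2 ^ (DIM('a) + 3) * (T * measure lborel (S j) + T powr (1 - p) * \<Gamma> * 4 ^ (m + 1) * w))"
      by (simp add: field_simps power_add)
    then show ?thesis using w h by simp
  qed
  have sumS: "(\<Sum>j<s. measure lborel (S j)) \<le> w"
  proof -
    have "(\<Sum>j<s. measure lborel (S j)) = measure lborel (\<Union>j\<in>{..<s}. S j)"
    proof (rule measure_finite_Union[symmetric])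
      show "disjoint_family_on S {..<s}"
      proof (unfold disjoint_family_on_def, intro ballI impI)
        fix i j :: nat assume "i \<noteq> j"
        then consider "Suc i \<le> j" | "Suc j \<le> i" by linarith
        then show "S i \<inter> S j = {}" by cases (use kmono[of "Suc i" j] kmono[of "Suc j" i] in \<open>force simp: S_def\<close>)+
      qed
      have "bounded (S j)" for j unfolding S_def by (rule bounded_subset[OF bounded_ball[of x0 "R / 2"]]) auto
      then show "emeasure lborel (S j) \<noteq> \<infinity>" for j using emeasure_bounded_finite[of "S j"] by simp
    qed (use Sb in auto)
    also have "\<dots> \<le> measure lborel (ball x0 R)"
      using Sb R by (intro measure_bounded_mono) (auto simp: S_def)
    finally show ?thesis using R by (simp add: w_def content_ball)
  qed
  have "s * Y s = (\<Sum>j<s. Y s)" by simp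
  also have "\<dots> \<le> (\<Sum>j<s. Y (Suc j))"
  proof (rule sum_mono)
    fix j assume "j \<in> {..<s}"
    then show "Y s \<le> Y (Suc j)" unfolding Y_def using kmono[of "Suc j" s]
      by (intro measure_bounded_mono) (auto intro: bounded_subset[OF bounded_ball[of x0 "R / 2"]])
  qed
  also have "\<dots> \<le> (\<Sum>j<s. 2 ^ (DIM('a) + 3) * (T * measure lborel (S j) + T powr (1 - p) * \<Gamma> * 4 ^ (m + 1) * w))"
    using step by (intro sum_mono) auto
  also have "\<dots> = 2 ^ (DIM('a) + 3) * (T * (\<Sum>j<s. measure lborel (S j)) + s * (T powr (1 - p) * \<Gamma> * 4 ^ (m + 1) * w))"
    by (simp add: sum_distrib_left[symmetric] sum.distrib)
  also have "\<dots> \<le> 2 ^ (DIM('a) + 3) * (T * w + s * (T powr (1 - p) * \<Gamma> * 4 ^ (m + 1) * w))"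
    using sumS T by (intro mult_left_mono add_right_mono) auto
  also have "\<dots> = 2 ^ (DIM('a) + 3) * w * (T + s * (T powr (1 - p) * \<Gamma> * 4 ^ (m + 1)))" by (simp add: algebra_simps)
  finally show ?thesis by (simp add: Y_def k_def w_def)
qed

text \<open>The shrinking argument brings the measure above \<open>K0\<close> below the threshold of
  \<open>sup_reduction\<close>; there the remaining height \<open>H / 2 ^ s\<close> is halved once
  more. In the energy hypothesis, the inequality between \<open>k0 + H\<close> and
  \<open>k + h\<close> expresses that \<open>k + h\<close> still bounds \<open>U\<close> from
  above.\<close>

theorem oscillation_step:
  assumes H: "H > 0"
    and E: "\<And>k h. k0 \<le> k \<Longrightarrow> H / 2 ^ deg_s DIM('a) m p \<Gamma> \<le> h \<Longrightarrow> h \<le> H \<Longrightarrow> k0 + H \<le> k + h \<Longrightarrow> energy_est U V x0 R m \<Gamma> p k h"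
    and half: "measure lborel {x \<in> ball x0 (R / 2). U x \<le> k0} \<ge> measure lborel (ball x0 (R / 2)) / 2"
  shows "measure lborel (super_level U (k0 + H - H / 2 ^ (deg_s DIM('a) m p \<Gamma> + 1)) x0 (R / 4)) = 0"
proof -
  define s where "s = deg_s DIM('a) m p \<Gamma>"
  define \<eta> where "\<eta> = (deg_eta DIM('a) m \<Gamma> :: real) ^ DIM('a)"
  define T where "T = deg_T DIM('a) m p \<Gamma>"
  have \<eta>: "0 < \<eta>" "\<eta> \<le> 1"
  proof -
    show "0 < \<eta>" using deg_eta_bounds by (simp add: \<eta>_def)
    have "1 / deg_B m ^ 4 \<le> (1::real)" using deg_B_ge one_le_power[of "deg_B m" 4] by (simp add: divide_le_eq_1)
    then show "\<eta> \<le> 1" unfolding \<eta>_def using deg_eta_bounds by (intro power_le_one) auto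
  qed
  have big: "1 \<le> 2 ^ (DIM('a) + 5) * \<Gamma> * 4 ^ (m + 1) / \<eta>"
  proof -
    have "\<eta> \<le> 1 * 1 * 1" using \<eta> by simp
    also have "\<dots> \<le> 2 ^ (DIM('a) + 5) * \<Gamma> * 4 ^ (m + 1)" using \<Gamma> by (intro mult_mono one_le_power) auto
    finally show ?thesis using \<eta> by (simp add: field_simps)
  qed
  have T1: "T \<ge> 1" unfolding T_def deg_T_def using big p by (intro ge_one_powr_ge_zero) (auto simp: \<eta>_def)
  have Tp: "T powr (1 - p) * \<Gamma> * 4 ^ (m + 1) = \<eta> / 2 ^ (DIM('a) + 5)"
  proof -
    have "T powr (1 - p) = (2 ^ (DIM('a) + 5) * \<Gamma> * 4 ^ (m + 1) / \<eta>) powr (-1)"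
    proof -
      have "1 / (p - 1) * (1 - p) = -1" using p by (simp add: field_simps)
      then show ?thesis unfolding T_def deg_T_def powr_powr \<eta>_def by (simp only:)
    qed
    also have "\<dots> = \<eta> / (2 ^ (DIM('a) + 5) * \<Gamma> * 4 ^ (m + 1))" using big \<eta> \<Gamma> by (simp add: powr_minus_divide abs_mult)
    finally show ?thesis using \<Gamma> by simp
  qed
  have s: "real s \<ge> 2 ^ (DIM('a) + 5) * T / \<eta>" unfolding s_def deg_s_def T_def \<eta>_def by linarith
  have spos: "real s > 0"
  proof -
    have "2 ^ (DIM('a) + 5) * T / \<eta> > 0" using T1 \<eta> by simp
    then show ?thesis using s by linarith
  qed
  define w where "w = unit_ball_vol DIM('a) * R ^ DIM('a)"
  have w: "w > 0" using R by (simp add: w_def)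
  define Y where "Y = measure lborel {x \<in> ball x0 (R / 2). k0 + H * (1 - 1 / 2 ^ s) \<le> U x}"
  have "s * Y \<le> 2 ^ (DIM('a) + 3) * w * (T + s * (T powr (1 - p) * \<Gamma> * 4 ^ (m + 1)))"
    unfolding Y_def w_def
  proof (rule measure_shrinking[OF H T1 _ half])
    fix j assume "j < s"
    then have "H / 2 ^ s \<le> H / 2 ^ j" using H by (intro divide_left_mono) (auto intro: power_increasing)
    moreover have "H / 2 ^ j \<le> H" using H by (simp add: divide_le_eq)
    ultimately show "energy_est U V x0 R m \<Gamma> p (k0 + H * (1 - 1 / 2 ^ j)) (H / 2 ^ j)"
      using H by (intro E) (auto simp: s_def algebra_simps divide_le_eq)
  qed
  also have "\<dots> = 2 ^ (DIM('a) + 3) * w * T + s * (w * \<eta> / 4)"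
    unfolding Tp by (simp add: power_add field_simps)
  \<comment> \<open>The choice of \<open>deg_s\<close> makes this term as small as the other one, so
    together they give \<open>w * \<eta> / 2\<close>.\<close>
  also have "2 ^ (DIM('a) + 3) * w * T \<le> s * (w * \<eta> / 4)"
  proof -
    have "2 ^ (DIM('a) + 5) * T \<le> s * \<eta>" using s \<eta> by (simp add: field_simps)
    then have "w / 4 * (2 ^ (DIM('a) + 5) * T) \<le> w / 4 * (s * \<eta>)" using w by (intro mult_left_mono) auto
    then show ?thesis by (simp add: power_add algebra_simps)
  qed
  finally have "s * Y \<le> s * (w * \<eta> / 2)" by (simp add: mult_ac)
  then have Y: "Y \<le> w * \<eta> / 2" by (rule mult_le_cancel_left_pos[OF spos, THEN iffD1])
  define K0 where "K0 = k0 + H * (1 - 1 / 2 ^ s)"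
  have "measure lborel (super_level U K0 x0 (R / 2)) \<le> Y"
    unfolding Y_def K0_def by (intro measure_bounded_mono) (auto intro: bounded_subset[OF bounded_ball[of x0 "R / 2"]])
  then have small: "measure lborel (super_level U K0 x0 (R / 2)) \<le> unit_ball_vol DIM('a) * (deg_eta DIM('a) m \<Gamma> * R) ^ DIM('a) / 2"
    using Y by (simp add: w_def \<eta>_def power_mult_distrib mult_ac)
  have "measure lborel (super_level U (K0 + H / 2 ^ s / 2) x0 (R / 4)) = 0"
  proof (rule sup_reduction[OF _ _ small])
    show "0 < H / 2 ^ s" using H by simp
    fix k assume k: "K0 \<le> k"
    have "H * (1 / 2 ^ s) \<le> H * 1" using H by (intro mult_left_mono) auto
    then show "energy_est U V x0 R m \<Gamma> p k (H / 2 ^ s)"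
      using k H by (intro E) (auto simp: K0_def s_def algebra_simps)
  qed
  moreover have "K0 + H / 2 ^ s / 2 = k0 + H - H / 2 ^ (s + 1)" by (simp add: K0_def algebra_simps)
  ultimately show ?thesis by (simp add: s_def)
qed

end

section \<open>Localisation and the energy estimate\<close>

lemma borel_measurable_lebesgue_AE:
  fixes f g :: "'a::euclidean_space \<Rightarrow> 'b::{second_countable_topology, metric_space}"
  assumes "f \<in> borel_measurable lebesgue" "AE x in lebesgue. f x = g x"
  shows "g \<in> borel_measurable lebesgue"
proof (rule borel_measurableI)
  fix S :: "'b set" assume "open S"
  obtain N where N: "{x. f x \<noteq> g x} \<subseteq> N" "N \<in> null_sets lebesgue"
    using assms(2) by (auto simp: eventually_ae_filter)
  have "f x = g x" if "x \<notin> N" for x using N(1) that by auto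
  then have "g -` S = (f -` S - N) \<union> (g -` S \<inter> N)" by auto
  moreover have f: "f -` S \<in> sets lebesgue" using measurable_sets[OF assms(1), of S] \<open>open S\<close> by simp
  have gN: "g -` S \<inter> N \<in> sets lebesgue"
    using null_sets_completion_subset[OF Int_lower2 N(2)] by (rule null_setsD2)
  ultimately have "g -` S \<in> sets lebesgue" using sets.Un[OF sets.Diff[OF f null_setsD2[OF N(2)]] gN] by simp
  then show "g -` S \<inter> space lebesgue \<in> sets lebesgue" by simp
qed

text \<open>\<open>f\<close> is approximated by functions with countably many values
  \<open>i / Suc n\<close>, for which the composition is measurable piece by piece; continuity in
  the second argument passes to the limit off a null set.\<close>

lemma caratheodory_measurable:
  fixes g :: "'a::euclidean_space \<Rightarrow> real \<Rightarrow> real"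
  assumes g: "\<And>v. v \<ge> 0 \<Longrightarrow> (\<lambda>x. indicator \<Omega> x * g x v) \<in> borel_measurable lebesgue"
    and c: "AE x in lebesgue. x \<in> \<Omega> \<longrightarrow> continuous_on {0..} (g x)"
    and f: "f \<in> borel_measurable lebesgue" "\<And>x. f x \<ge> 0"
  shows "(\<lambda>x. indicator \<Omega> x * g x (f x)) \<in> borel_measurable lebesgue"
proof -
  define N where "N n x = nat \<lfloor>f x * real (Suc n)\<rfloor>" for n x
  define a where "a n x = real (N n x) / real (Suc n)" for n x
  have m: "(\<lambda>x. indicator \<Omega> x * g x (a n x)) \<in> borel_measurable lebesgue" for n
  proof -
    have "(\<lambda>x. (\<lambda>i x. indicator \<Omega> x * g x (real i / real (Suc n))) (N n x) x) \<in> borel_measurable lebesgue"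
    proof (rule measurable_compose_countable[where f="\<lambda>i x. indicator \<Omega> x * g x (real i / real (Suc n))" and g="N n"])
      show "(\<lambda>x. indicator \<Omega> x * g x (real i / real (Suc n))) \<in> borel_measurable lebesgue" for i :: nat
        by (rule g) auto
      show "N n \<in> lebesgue \<rightarrow>\<^sub>M count_space UNIV" unfolding N_def using f(1) by measurable
    qed
    then show ?thesis by (simp add: a_def)
  qed
  have lim: "(\<lambda>n. a n x) \<longlonglongrightarrow> f x" for x
  proof (rule tendsto_sandwich)
    show "\<forall>\<^sub>F n in sequentially. f x - 1 / real (Suc n) \<le> a n x"
    proof (rule always_eventually, rule allI)
      fix n
      have "f x * real (Suc n) - 1 \<le> real (N n x)" unfolding N_def using f(2)[of x] by linarith
      then have "(f x * real (Suc n) - 1) / real (Suc n) \<le> a n x" unfolding a_def by (rule divide_right_mono) simp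
      moreover have "(f x * real (Suc n) - 1) / real (Suc n) = f x - 1 / real (Suc n)"
        by (simp add: diff_divide_distrib del: of_nat_Suc)
      ultimately show "f x - 1 / real (Suc n) \<le> a n x" by simp
    qed
    show "\<forall>\<^sub>F n in sequentially. a n x \<le> f x"
    proof (rule always_eventually, rule allI)
      fix n
      have "0 \<le> f x * real (Suc n)" using f(2)[of x] by simp
      then have "real (N n x) \<le> f x * real (Suc n)" unfolding N_def by linarith
      then show "a n x \<le> f x" unfolding a_def by (simp add: field_simps)
    qed
    show "(\<lambda>n. f x - 1 / real (Suc n)) \<longlonglongrightarrow> f x"
      using tendsto_diff[OF tendsto_const LIMSEQ_inverse_real_of_nat, of "f x"] by (simp add: inverse_eq_divide)
  qed auto
  obtain S where S: "{x. \<not> (x \<in> \<Omega> \<longrightarrow> continuous_on {0..} (g x))} \<subseteq> S" "S \<in> null_sets lebesgue"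
    using c by (auto elim!: AE_E2 AE_E simp: eventually_ae_filter)
  have "(\<lambda>x. indicator (- S) x * (indicator \<Omega> x * g x (f x))) \<in> borel_measurable lebesgue"
  proof (rule borel_measurable_LIMSEQ_real)
    show "(\<lambda>x. indicator (- S) x * (indicator \<Omega> x * g x (a n x))) \<in> borel_measurable lebesgue" for n
      by (rule borel_measurable_times[OF borel_measurable_indicator m])
        (simp add: Compl_in_sets_lebesgue null_setsD2[OF S(2)])
    fix x
    show "(\<lambda>n. indicator (- S) x * (indicator \<Omega> x * g x (a n x))) \<longlonglongrightarrow> indicator (- S) x * (indicator \<Omega> x * g x (f x))"
    proof (cases "x \<in> \<Omega> \<and> x \<notin> S")
      case True
      then have "continuous_on {0..} (g x)" using S(1) by auto
      then have "(\<lambda>n. g x (a n x)) \<longlonglongrightarrow> g x (f x)"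
        by (rule continuous_on_tendsto_compose[OF _ lim]) (auto simp: f(2) a_def)
      then show ?thesis by (intro tendsto_mult tendsto_const)
    qed auto
  qed
  moreover have "AE x in lebesgue. indicator (- S) x * (indicator \<Omega> x * g x (f x)) = indicator \<Omega> x * g x (f x)"
    using AE_not_in[OF S(2)] by eventually_elim auto
  ultimately show ?thesis by (rule borel_measurable_lebesgue_AE)
qed

lemma weak_gradient_cong_AE:
  fixes u :: "real^'n \<Rightarrow> real"
  assumes wg: "weak_gradient \<Omega> u Du" and i: "integrable lebesgue u'" "integrable lebesgue Du'"
    and ae: "AE x in lebesgue. u x = u' x" "AE x in lebesgue. Du x = Du' x"
  shows "weak_gradient \<Omega> u' Du'"
  unfolding weak_gradient_def
proof (intro conjI allI impI, goal_cases)
  case (3 \<psi> D\<psi>)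
  then have t: "test_function \<Omega> \<psi>" and d: "\<forall>x. GDERIV \<psi> x :> D\<psi> x" by auto
  obtain K C where K: "compact K" "K \<subseteq> \<Omega>" "\<And>x. x \<notin> K \<Longrightarrow> \<psi> x = 0 \<and> D\<psi> x = 0"
    using test_function_bounds[OF t d] by metis
  note w = weak_gradientD[OF wg t d]
  have a1: "AE x in lebesgue. u x *\<^sub>R D\<psi> x = u' x *\<^sub>R D\<psi> x" using ae(1) by eventually_elim simp
  have a2: "AE x in lebesgue. \<psi> x *\<^sub>R Du x = \<psi> x *\<^sub>R Du' x" using ae(2) by eventually_elim simp
  have "(LINT x|lebesgue. u x *\<^sub>R D\<psi> x) = (LINT x|lebesgue. u' x *\<^sub>R D\<psi> x)"
    using w(1) a1 borel_measurable_lebesgue_AE[OF borel_measurable_integrable[OF w(1)] a1] by (intro integral_cong_AE) auto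
  moreover have "(LINT x|lebesgue. \<psi> x *\<^sub>R Du x) = (LINT x|lebesgue. \<psi> x *\<^sub>R Du' x)"
    using w(2) a2 borel_measurable_lebesgue_AE[OF borel_measurable_integrable[OF w(2)] a2] by (intro integral_cong_AE) auto
  moreover have "(LINT x:\<Omega>|lebesgue. u' x *\<^sub>R D\<psi> x) = (LINT x|lebesgue. u' x *\<^sub>R D\<psi> x)"
    by (rule set_lebesgue_integral_absorb) (use K in auto)
  moreover have "(LINT x:\<Omega>|lebesgue. \<psi> x *\<^sub>R Du' x) = (LINT x|lebesgue. \<psi> x *\<^sub>R Du' x)"
    by (rule set_lebesgue_integral_absorb) (use K in auto)
  ultimately show ?case using w(3) by simp
qed (use i in \<open>auto intro: absolutely_integrable_UNIV_imp\<close>)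

text \<open>Multiplying by a cutoff extends \<open>u\<close> by 0 and makes it and its gradient
  integrable on the whole space, as \<open>line_primitive\<close> requires. The truncation at
  \<open>M\<close> changes \<open>U'\<close> only on a null set and gives the bound at every
  point.\<close>

lemma localization:
  fixes u :: "real^'n \<Rightarrow> real"
  assumes wg: "weak_gradient \<Omega> u Du" and R: "0 < R0" "R0 < R1" "cball x0 R1 \<subseteq> \<Omega>"
    and bd: "AE x in lebesgue. x \<in> \<Omega> \<longrightarrow> \<bar>u x\<bar> \<le> M" and M: "M \<ge> 0"
  obtains U V where "line_primitive U V" "\<And>x. \<bar>U x\<bar> \<le> M"
    "AE x in lebesgue. x \<in> ball x0 R0 \<longrightarrow> U x = u x \<and> V x = Du x"
proof -
  obtain \<kappa> D\<kappa> where C: "\<forall>k. Ck k \<kappa>" and D: "\<forall>x. GDERIV \<kappa> x :> D\<kappa> x" and \<kappa>01: "\<And>x. 0 \<le> \<kappa> x \<and> \<kappa> x \<le> 1"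
    and \<kappa>1: "\<And>x. x \<in> cball x0 R0 \<Longrightarrow> \<kappa> x = 1 \<and> D\<kappa> x = 0"
    and \<kappa>0: "\<And>x. x \<notin> ball x0 R1 \<Longrightarrow> \<kappa> x = 0 \<and> D\<kappa> x = 0"
  proof -
    obtain B where "has_cutoffs x0 B" using radial_cutoff by metis
    then show ?thesis using R(1,2) that unfolding has_cutoffs_def by metis
  qed
  have t: "test_function \<Omega> \<kappa>" unfolding test_function_def
  proof (intro conjI exI[of _ "cball x0 R1"] allI impI)
    show "Ck k \<kappa>" for k using C by blast
    show "\<kappa> x = 0" if "x \<notin> cball x0 R1" for x using \<kappa>0[of x] that ball_subset_cball by blast
  qed (use R in auto)
  note w = weak_gradient_mult_test[OF wg t D]
  obtain U' where U': "U' \<in> borel_measurable borel" "integrable lborel U'" "AE x in lebesgue. \<kappa> x * u x = U' x"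
    using borel_representative_real[OF w(1)] by blast
  obtain V where V: "V \<in> borel_measurable borel" "integrable lborel V"
    "AE x in lebesgue. \<kappa> x *\<^sub>R Du x + u x *\<^sub>R D\<kappa> x = V x"
    using borel_representative_vec[OF w(2)] by blast
  define U where "U x = max (- M) (min M (U' x))" for x
  have Um: "U \<in> borel_measurable borel" unfolding U_def[abs_def] using U'(1) by measurable
  have Ui: "integrable lborel U"
    by (rule Bochner_Integration.integrable_bound[OF U'(2)]) (use Um M in \<open>auto simp: U_def\<close>)
  have ae: "AE x in lebesgue. \<kappa> x * u x = U x"
    using U'(3) bd
  proof eventually_elim
    case (elim x)
    have "\<bar>\<kappa> x * u x\<bar> \<le> M"
    proof (cases "x \<in> \<Omega>")
      case True
      then have "\<bar>u x\<bar> \<le> M" using elim by blast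
      moreover have "\<bar>\<kappa> x * u x\<bar> \<le> 1 * \<bar>u x\<bar>" unfolding abs_mult using \<kappa>01[of x] by (intro mult_right_mono) auto
      ultimately show ?thesis by simp
    next
      case False
      then have "\<kappa> x = 0" using \<kappa>0[of x] R(3) ball_subset_cball by blast
      then show ?thesis using M by simp
    qed
    then show ?case using elim M by (auto simp: U_def)
  qed
  have "weak_gradient UNIV U V"
    using w(3) _ _ ae V(3) by (rule weak_gradient_cong_AE) (use Ui V(2) in \<open>simp_all add: integrable_completion\<close>)
  then have "line_primitive U V" by (rule weak_gradient_line_primitive[OF Um V(1) Ui V(2)])
  moreover have "\<bar>U x\<bar> \<le> M" for x using M by (auto simp: U_def)
  moreover have "AE x in lebesgue. x \<in> ball x0 R0 \<longrightarrow> U x = u x \<and> V x = Du x"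
    using ae V(3) by eventually_elim (use \<kappa>1 in auto)
  ultimately show ?thesis using that by blast
qed

text \<open>The pointwise inequality behind the absorption in the Caccioppoli estimate: either
  \<open>t\<close> exceeds \<open>m H D / \<zeta>\<close>, and the left hand side is bounded by the first term on the
  right, or monotonicity and the doubling of \<open>\<gamma>\<close> bound it by the second one.\<close>

lemma caccioppoli_pointwise:
  fixes \<gamma> :: "real \<Rightarrow> real" and m :: nat and w t H D \<zeta> b0 c1 q :: real
  assumes nn: "\<And>v. v \<ge> 0 \<Longrightarrow> \<gamma> v \<ge> 0" and mono: "mono_on {0..} \<gamma>"
    and g1: "\<And>v w. 0 < v \<Longrightarrow> b0 \<le> v \<Longrightarrow> v \<le> w \<Longrightarrow> \<gamma> w \<le> c1 * (w / v) powr (q - 1) * \<gamma> v"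
    and q: "q > 1" "q \<le> m" and c1: "c1 > 0"
    and w: "0 \<le> w" "w \<le> H" and H: "H > 0" and \<zeta>: "0 \<le> \<zeta>" "\<zeta> \<le> 1" and D: "D > 0" "b0 \<le> H * D" and t: "t \<ge> 0"
  shows "w\<^sup>2 * \<gamma> t * (m * \<zeta> ^ (m - 1) * D) \<le> w * (\<gamma> t * t) * \<zeta> ^ m + c1 * m ^ m * H * (\<gamma> (H * D) * (H * D))"
proof (cases "\<zeta> = 0")
  case True
  have "m \<ge> 2" using q by linarith
  then have z: "\<zeta> ^ (m - 1) = 0" "\<zeta> ^ m = 0" using True by auto
  have "0 \<le> c1 * m ^ m * H * (\<gamma> (H * D) * (H * D))" using c1 H D nn by (intro mult_nonneg_nonneg) auto
  then show ?thesis unfolding z by simp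
next
  case False
  with \<zeta> have \<zeta>0: "\<zeta> > 0" by simp
  have m2: "m \<ge> 2" using q by linarith
  have zz: "\<zeta> ^ m = \<zeta> * \<zeta> ^ (m - 1)" using m2 by (simp flip: power_Suc)
  have B0: "0 \<le> c1 * m ^ m * H * (\<gamma> (H * D) * (H * D))" using c1 H D nn by (intro mult_nonneg_nonneg) auto
  have A0: "0 \<le> w * (\<gamma> t * t) * \<zeta> ^ m" using w t \<zeta> nn by (intro mult_nonneg_nonneg) auto
  show ?thesis
  proof (cases "t \<ge> m * H * D / \<zeta>")
    case True
    then have le: "H * (m * D) \<le> t * \<zeta>" using \<zeta>0 by (simp add: field_simps)
    have "w\<^sup>2 * \<gamma> t * (m * \<zeta> ^ (m - 1) * D) = (w * \<gamma> t * \<zeta> ^ (m - 1)) * (w * (m * D))"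
      by (simp add: power2_eq_square algebra_simps)
    also have "\<dots> \<le> (w * \<gamma> t * \<zeta> ^ (m - 1)) * (t * \<zeta>)"
    proof (rule mult_left_mono)
      have "w * (m * D) \<le> H * (m * D)" using w D by (intro mult_right_mono) auto
      then show "w * (m * D) \<le> t * \<zeta>" using le by linarith
    qed (use w nn t \<zeta> in \<open>auto intro!: mult_nonneg_nonneg\<close>)
    also have "\<dots> = w * (\<gamma> t * t) * \<zeta> ^ m" by (simp add: zz algebra_simps)
    finally show ?thesis using B0 by linarith
  next
    case False
    define \<tau> where "\<tau> = m * H * D / \<zeta>"
    have HD: "0 < H * D" using H D by simp
    have ratio: "\<tau> / (H * D) = m / \<zeta>" using H D by (simp add: \<tau>_def)
    have mz: "m / \<zeta> \<ge> 1" using \<zeta>0 \<zeta> m2 by (simp add: field_simps)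
    then have "\<tau> \<ge> H * D" using mult_right_mono[OF mz, of "H * D"] HD by (simp add: \<tau>_def mult.assoc)
    have "\<gamma> t \<le> \<gamma> \<tau>" using mono False t by (intro mono_onD[OF mono]) (auto simp: \<tau>_def)
    also have "\<dots> \<le> c1 * (m / \<zeta>) powr (q - 1) * \<gamma> (H * D)"
      using g1[OF HD D(2) \<open>\<tau> \<ge> H * D\<close>] ratio by simp
    finally have gt: "\<gamma> t \<le> c1 * (m / \<zeta>) powr (q - 1) * \<gamma> (H * D)" .
    have "w\<^sup>2 * \<gamma> t * (m * \<zeta> ^ (m - 1) * D) \<le> H\<^sup>2 * (c1 * (m / \<zeta>) powr (q - 1) * \<gamma> (H * D)) * (m * \<zeta> ^ (m - 1) * D)"
      using w gt nn t D \<zeta> by (intro mult_right_mono mult_mono power_mono) auto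
    also have "\<dots> = c1 * H * (\<gamma> (H * D) * (H * D)) * (m * \<zeta> ^ (m - 1) * (m / \<zeta>) powr (q - 1))"
      by (simp add: power2_eq_square algebra_simps)
    \<comment> \<open>Here m \<ge> q enters: the power of the cutoff compensates the negative power
      of \<zeta> from the doubling of \<gamma>.\<close>
    also have "m * \<zeta> ^ (m - 1) * (m / \<zeta>) powr (q - 1) \<le> m ^ m"
    proof -
      have "(m / \<zeta>) powr (q - 1) \<le> (m / \<zeta>) powr (m - 1)" using mz q by (intro powr_mono) auto
      also have "\<dots> = (m / \<zeta>) ^ (m - 1)" using mz m2 by (simp add: powr_realpow[symmetric] of_nat_diff)
      finally have "m * \<zeta> ^ (m - 1) * (m / \<zeta>) powr (q - 1) \<le> m * \<zeta> ^ (m - 1) * (m / \<zeta>) ^ (m - 1)"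
        using \<zeta> by (intro mult_left_mono) auto
      also have "\<dots> = m ^ m" using \<zeta>0 m2 by (simp add: power_divide flip: power_Suc)
      finally show ?thesis .
    qed
    finally have "w\<^sup>2 * \<gamma> t * (m * \<zeta> ^ (m - 1) * D) \<le> c1 * H * (\<gamma> (H * D) * (H * D)) * m ^ m"
      using c1 H nn HD by (simp add: mult_left_mono)
    then show ?thesis using A0 by (simp add: algebra_simps)
  qed
qed

text \<open>Either \<open>y\<close> is at most twice the constant, or at most
  \<open>2 * A * t\<close>. In the latter situation (g1) compares with the value at \<open>t\<close>
  once \<open>t\<close> exceeds \<open>b\<close>; below \<open>b\<close> a constant suffices. It
  gives the test function finite energy.\<close>

lemma growth_pointwise:
  fixes \<gamma> :: "real \<Rightarrow> real"
  assumes nn: "\<And>v. v \<ge> 0 \<Longrightarrow> \<gamma> v \<ge> 0" and mono: "mono_on {0..} \<gamma>"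
    and g1: "\<And>v w. 0 < v \<Longrightarrow> b0 \<le> v \<Longrightarrow> v \<le> w \<Longrightarrow> \<gamma> w \<le> c1 * (w / v) powr (q - 1) * \<gamma> v"
    and c1: "c1 > 0" and b: "b > 0" "b \<ge> b0" and A: "A \<ge> 1" and c: "c \<ge> 0" and t: "t \<ge> 0"
    and y: "0 \<le> y" "y \<le> A * t + c"
  shows "\<gamma> y * y \<le> c1 * (2 * A) powr q * (\<gamma> t * t) + \<gamma> (2 * A * b) * (2 * A * b) + \<gamma> (2 * c) * (2 * c)"
proof -
  have G: "\<gamma> a * a \<le> \<gamma> a' * a'" if "0 \<le> a" "a \<le> a'" for a a'
    using that nn by (intro mult_mono mono_onD[OF mono]) auto
  have nG: "0 \<le> \<gamma> a * a" if "0 \<le> a" for a using that nn by simp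
  have nC: "0 \<le> c1 * (2 * A) powr q * (\<gamma> t * t)" using c1 nn[OF t] t by simp
  have n1: "0 \<le> \<gamma> (2 * A * b) * (2 * A * b)" by (rule nG) (use A b in auto)
  have n2: "0 \<le> \<gamma> (2 * c) * (2 * c)" by (rule nG) (use c in auto)
  consider "y \<le> 2 * c" | "y \<le> 2 * A * t" using y by linarith
  then show ?thesis
  proof cases
    case 1
    then show ?thesis using G[OF y(1) 1] nC n1 by linarith
  next
    case 2
    show ?thesis
    proof (cases "t \<le> b")
      case True
      then have "2 * A * t \<le> 2 * A * b" using A by simp
      then show ?thesis using G[OF y(1), of "2 * A * b"] 2 nC n2 by linarith
    next
      case False
      then have tp: "0 < t" "b0 \<le> t" "t \<le> 2 * A * t" using b A by auto
      have "\<gamma> y * y \<le> \<gamma> (2 * A * t) * (2 * A * t)" by (rule G[OF y(1) 2])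
      also have "\<dots> \<le> (c1 * (2 * A * t / t) powr (q - 1) * \<gamma> t) * (2 * A * t)"
        using g1[OF tp] A t by (intro mult_right_mono) auto
      also have "\<dots> = c1 * (2 * A) powr q * (\<gamma> t * t)"
        using tp A by (simp add: powr_diff field_simps)
      finally show ?thesis using n1 n2 by linarith
    qed
  qed
qed

section \<open>The Caccioppoli inequality and the energy estimate\<close>

lemma cond_g_integrable:
  assumes cg: "cond_g \<Omega> g" and S: "S \<in> sets lebesgue" "S \<subseteq> \<Omega>" and v: "v \<ge> 0"
  shows "integrable lebesgue (\<lambda>x. indicator S x * g x v)"
proof -
  have "integrable lebesgue (\<lambda>x. indicator \<Omega> x *\<^sub>R g x v)"
    using cg v by (auto simp: cond_g_def set_integrable_def)
  then have "integrable lebesgue (\<lambda>x. indicator S x *\<^sub>R (indicator \<Omega> x *\<^sub>R g x v))"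
    by (rule integrable_mult_indicator[OF S(1)])
  moreover have "indicator S x *\<^sub>R (indicator \<Omega> x *\<^sub>R g x v) = indicator S x * g x v" for x
    using S(2) by (auto simp: indicator_def)
  ultimately show ?thesis by (simp only:)
qed

lemma cond_g_measurable:
  assumes cg: "cond_g \<Omega> g" and S: "S \<in> sets lebesgue" "S \<subseteq> \<Omega>"
    and f: "f \<in> borel_measurable lebesgue" "\<And>x. f x \<ge> 0"
  shows "(\<lambda>x. indicator S x * g x (f x)) \<in> borel_measurable lebesgue"
proof (rule caratheodory_measurable[OF _ _ f])
  show "(\<lambda>x. indicator S x * g x v) \<in> borel_measurable lebesgue" if "v \<ge> 0" for v
    using cond_g_integrable[OF cg S that] by simp
  have "AE x in lebesgue. x \<in> \<Omega> \<longrightarrow> continuous_on {0..} (g x) \<and> mono_on {0..} (g x) \<and>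
      (g x \<longlongrightarrow> 0) (at_right 0) \<and> filterlim (g x) at_top at_top"
    using cg unfolding cond_g_def by blast
  then show "AE x in lebesgue. x \<in> S \<longrightarrow> continuous_on {0..} (g x)"
    by eventually_elim (use S in blast)
qed

context
  fixes \<Omega> :: "(real^'n) set" and g :: "real^'n \<Rightarrow> real \<Rightarrow> real" and U :: "real^'n \<Rightarrow> real" and V :: "real^'n \<Rightarrow> real^'n"
    and x0 :: "real^'n" and R0 M p q b0 c1 rs :: real and lam c2 :: "real \<Rightarrow> real"
  assumes cg: "cond_g \<Omega> g" and cg1: "cond_g1 \<Omega> g c1 q b0" and cg2: "cond_g2 \<Omega> g p" and cg3: "cond_g3 \<Omega> g rs lam c2"
    and lp: "line_primitive U V" and UM: "\<And>x. \<bar>U x\<bar> \<le> M" and R0: "R0 > 0" "cball x0 R0 \<subseteq> \<Omega>"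
    and en: "(\<integral>\<^sup>+x\<in>ball x0 R0. ennreal (G_of g x (norm (V x))) \<partial>lebesgue) < \<infinity>"
    and eqn: "\<And>\<phi> D\<phi>. W1G_0 g \<Omega> \<phi> \<Longrightarrow> weak_gradient \<Omega> \<phi> D\<phi> \<Longrightarrow> D\<phi> \<in> borel_measurable lebesgue \<Longrightarrow>
      (\<And>x. x \<notin> ball x0 R0 \<Longrightarrow> D\<phi> x = 0) \<Longrightarrow>
      (LINT x|lebesgue. indicator (ball x0 R0) x * (g x (norm (V x)) * (((1 / norm (V x)) *\<^sub>R V x) \<bullet> D\<phi> x))) = 0"
begin

lemma local_facts:
  shows U_borel: "U \<in> borel_measurable borel" and V_borel: "V \<in> borel_measurable borel" and
    U_lebesgue: "U \<in> borel_measurable lebesgue" and V_lebesgue: "V \<in> borel_measurable lebesgue" and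
    ball_in_domain: "x \<in> ball x0 R0 \<Longrightarrow> x \<in> \<Omega>" and
    g_nonneg: "x \<in> \<Omega> \<Longrightarrow> v \<ge> 0 \<Longrightarrow> g x v \<ge> 0" and
    g_pos: "x \<in> \<Omega> \<Longrightarrow> v > 0 \<Longrightarrow> g x v > 0" and
    g_mono_AE: "AE x in lebesgue. x \<in> \<Omega> \<longrightarrow> mono_on {0..} (g x)" and
    q_gt_1: "q > 1" and p_gt_1: "p > 1" and c1_pos: "c1 > 0" and b0_nonneg: "b0 \<ge> 0"
proof -
  show "U \<in> borel_measurable borel" "V \<in> borel_measurable borel" using lp unfolding line_primitive_def by blast+
  then show "U \<in> borel_measurable lebesgue" "V \<in> borel_measurable lebesgue" by (simp_all add: measurable_completion)
  show "x \<in> ball x0 R0 \<Longrightarrow> x \<in> \<Omega>" using R0 ball_subset_cball by blast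
  show nn: "x \<in> \<Omega> \<Longrightarrow> v \<ge> 0 \<Longrightarrow> g x v \<ge> 0" for x v using cg by (auto simp: cond_g_def)
  show "g x v > 0" if "x \<in> \<Omega>" "v > 0" for x v
  proof (rule ccontr)
    assume "\<not> g x v > 0"
    then have "g x v = 0" using nn[of x v] that by simp
    \<comment> \<open>For \<open>w = v\<close> the left side of (g2) is 1, whereas the quotient is 0
      if \<open>g x v = 0\<close>, by \<open>a / 0 = 0\<close>.\<close>
    moreover have "(v / v) powr (p - 1) \<le> g x v / g x v" using cg2 that unfolding cond_g2_def by blast
    ultimately show False using that by simp
  qed
  show "AE x in lebesgue. x \<in> \<Omega> \<longrightarrow> mono_on {0..} (g x)"
  proof -
    have "AE x in lebesgue. x \<in> \<Omega> \<longrightarrow> continuous_on {0..} (g x) \<and> mono_on {0..} (g x) \<and>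
        (g x \<longlongrightarrow> 0) (at_right 0) \<and> filterlim (g x) at_top at_top"
      using cg unfolding cond_g_def by blast
    then show ?thesis by eventually_elim blast
  qed
  show "q > 1" "p > 1" "c1 > 0" "b0 \<ge> 0" using cg1 cg2 by (auto simp: cond_g1_def cond_g2_def)
qed

lemma g1_mult: "x \<in> \<Omega> \<Longrightarrow> 0 < v \<Longrightarrow> b0 \<le> v \<Longrightarrow> v \<le> w \<Longrightarrow> g x w \<le> c1 * (w / v) powr (q - 1) * g x v"
  using cg1 g_pos[of x v] unfolding cond_g1_def by (metis pos_divide_le_eq)

lemma g2_mult: "x \<in> \<Omega> \<Longrightarrow> 0 < v \<Longrightarrow> v \<le> w \<Longrightarrow> (w / v) powr (p - 1) * g x v \<le> g x w"
  using cg2 g_pos[of x v] unfolding cond_g2_def by (metis pos_le_divide_eq)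

lemma g_integrable: "v \<ge> 0 \<Longrightarrow> integrable lebesgue (\<lambda>x. indicator (ball x0 R0) x * g x v)"
  using ball_in_domain by (intro cond_g_integrable[OF cg]) auto

lemma g_measurable:
  assumes "f \<in> borel_measurable lebesgue" "\<And>x. f x \<ge> 0"
  shows "(\<lambda>x. indicator (ball x0 R0) x * g x (f x)) \<in> borel_measurable lebesgue"
  using ball_in_domain by (intro cond_g_measurable[OF cg _ _ assms]) auto

lemma energy_integrable:
  "integrable lebesgue (\<lambda>x. indicator (ball x0 R0) x * (g x (norm (V x)) * norm (V x)))"
proof (rule integrableI_bounded)
  have "(\<lambda>x. (indicator (ball x0 R0) x * g x (norm (V x))) * norm (V x)) \<in> borel_measurable lebesgue"
    using V_lebesgue by (intro borel_measurable_times[OF g_measurable]) auto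
  then show "(\<lambda>x. indicator (ball x0 R0) x * (g x (norm (V x)) * norm (V x))) \<in> borel_measurable lebesgue"
    by (simp add: mult.assoc)
  have "(\<integral>\<^sup>+x. ennreal (norm (indicator (ball x0 R0) x * (g x (norm (V x)) * norm (V x)))) \<partial>lebesgue) =
      (\<integral>\<^sup>+x\<in>ball x0 R0. ennreal (G_of g x (norm (V x))) \<partial>lebesgue)"
  proof (intro nn_integral_cong)
    fix x
    show "ennreal (norm (indicator (ball x0 R0) x * (g x (norm (V x)) * norm (V x)))) = ennreal (G_of g x (norm (V x))) * indicator (ball x0 R0) x"
      using ball_in_domain[of x] g_nonneg[of x "norm (V x)"] by (cases "x \<in> ball x0 R0") (auto simp: G_of_def)
  qed
  then show "(\<integral>\<^sup>+x. ennreal (norm (indicator (ball x0 R0) x * (g x (norm (V x)) * norm (V x)))) \<partial>lebesgue) < \<infinity>"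
    using en by simp
qed

text \<open>The point is the admissibility of the test function: its gradient is bounded by
  \<open>A * norm (V x) + c\<close>, so \<open>growth_pointwise\<close> bounds its energy by that of
  \<open>V\<close> and by integrable values of \<open>g\<close> at constant arguments.\<close>

lemma test_weak_equation:
  fixes m :: nat and \<zeta> :: "real^'n \<Rightarrow> real"
  assumes C: "\<forall>k. Ck k \<zeta>" and D: "\<forall>x. GDERIV \<zeta> x :> D\<zeta> x" and \<zeta>: "\<And>x. 0 \<le> \<zeta> x \<and> \<zeta> x \<le> 1"
    and out: "\<And>x. x \<notin> ball x0 b \<Longrightarrow> \<zeta> x = 0 \<and> D\<zeta> x = 0" and b: "b \<le> R0"
    and bd: "\<And>x. norm (D\<zeta> x) \<le> d" and m: "m \<ge> 2"
  shows "(LINT x|lebesgue. indicator (ball x0 R0) x * (g x (norm (V x)) * (((1 / norm (V x)) *\<^sub>R V x) \<bullet>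
      ((\<zeta> x ^ m * (2 * max 0 (U x - k))) *\<^sub>R V x + (pos_sq k (U x) * (m * \<zeta> x ^ (m - 1))) *\<^sub>R D\<zeta> x)))) = 0"
    (is "(LINT x|lebesgue. _ * (_ * (_ \<bullet> ?D x))) = 0")
proof (rule eqn)
  define \<phi> where "\<phi> x = \<zeta> x ^ m * pos_sq k (U x)" for x
  define M' where "M' = M + \<bar>k\<bar>"
  have M0: "M \<ge> 0" using order_trans[OF abs_ge_zero UM] .
  have M': "M' \<ge> 0" "max 0 (U x - k) \<le> M'" "pos_sq k (U x) \<le> M'\<^sup>2" for x
  proof -
    show "M' \<ge> 0" using M0 by (simp add: M'_def)
    show le: "max 0 (U x - k) \<le> M'" using UM[of x] M0 by (simp add: M'_def abs_if split: if_splits)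
    show "pos_sq k (U x) \<le> M'\<^sup>2" unfolding pos_sq_def using le by (intro power_mono) auto
  qed
  have d0: "d \<ge> 0" using order_trans[OF norm_ge_zero bd] .
  have t: "test_function UNIV (\<lambda>x. \<zeta> x ^ m)" unfolding test_function_def
  proof (intro conjI exI[of _ "cball x0 b"] allI impI)
    show "Ck j (\<lambda>x. \<zeta> x ^ m)" for j using C by (intro Ck_power) auto
    show "\<zeta> x ^ m = 0" if "x \<notin> cball x0 b" for x using out[of x] that ball_subset_cball m by auto
  qed auto
  have Dm: "\<forall>x. GDERIV (\<lambda>x. \<zeta> x ^ m) x :> (m * \<zeta> x ^ (m - 1)) *\<^sub>R D\<zeta> x"
  proof
    fix x
    have "DERIV (\<lambda>s. s ^ m) (\<zeta> x) :> m * \<zeta> x ^ (m - 1)"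
      using DERIV_pow[of m "\<zeta> x"] by simp
    then show "GDERIV (\<lambda>x. \<zeta> x ^ m) x :> (m * \<zeta> x ^ (m - 1)) *\<^sub>R D\<zeta> x"
      by (rule GDERIV_DERIV_compose[OF D[rule_format]])
  qed
  have bdd: "\<bar>pos_sq k (U x)\<bar> \<le> M'\<^sup>2" for x using M'(3)[of x] by (simp add: pos_sq_def)
  have wg: "weak_gradient UNIV (\<lambda>x. pos_sq k (U x)) (\<lambda>x. (2 * max 0 (U x - k)) *\<^sub>R V x)"
    by (rule line_primitive_weak_gradient[OF line_primitive_pos_sq[OF lp UM] bdd])
  have eqD: "\<zeta> x ^ m *\<^sub>R ((2 * max 0 (U x - k)) *\<^sub>R V x) + pos_sq k (U x) *\<^sub>R ((m * \<zeta> x ^ (m - 1)) *\<^sub>R D\<zeta> x) = ?D x" for x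
    by simp
  note w = weak_gradient_mult_test[OF wg t Dm, unfolded eqD, folded \<phi>_def]
  show "weak_gradient \<Omega> \<phi> ?D" by (rule w(3))
  show "?D \<in> borel_measurable lebesgue" using w(2) by (rule borel_measurable_integrable)
  have m0: "m - 1 > 0" "m > 0" using m by auto
  show D0: "?D x = 0" if "x \<notin> ball x0 R0" for x
  proof -
    have "x \<notin> ball x0 b" using that b by auto
    then show ?thesis using out[of x] m0 by simp
  qed
  show "W1G_0 g \<Omega> \<phi>" unfolding W1G_0_def W1G_def
  proof (intro conjI exI[of _ ?D] exI[of _ "cball x0 b"])
    show "weak_gradient \<Omega> \<phi> ?D" by (rule w(3))
    have ind: "indicator \<Omega> x *\<^sub>R \<phi> x = \<phi> x" "indicator \<Omega> x *\<^sub>R ?D x = ?D x" for x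
    proof -
      have "\<phi> x = 0 \<and> ?D x = 0" if "x \<notin> \<Omega>"
      proof -
        have "x \<notin> ball x0 R0" using that ball_in_domain by blast
        moreover from this have "x \<notin> ball x0 b" using b by auto
        ultimately show ?thesis using out[of x] m0 D0 by (simp add: \<phi>_def)
      qed
      then show "indicator \<Omega> x *\<^sub>R \<phi> x = \<phi> x" "indicator \<Omega> x *\<^sub>R ?D x = ?D x" by (auto simp: indicator_def)
    qed
    show "\<phi> absolutely_integrable_on \<Omega>" "?D absolutely_integrable_on \<Omega>"
      unfolding set_integrable_def ind using w(1,2) by auto
    show "cball x0 b \<subseteq> \<Omega>" using R0 b by (meson cball_subset_cball_iff order_trans subset_cball)
    show "AE x in lebesgue. x \<in> \<Omega> - cball x0 b \<longrightarrow> \<phi> x = 0"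
      using out m0 ball_subset_cball by (intro AE_I2) (auto simp: \<phi>_def)
    define A where "A = max 1 (2 * M')"
    define c where "c = M'\<^sup>2 * (m * d)"
    \<comment> \<open>A positive argument from which (g1) is available.\<close>
    define B where "B = max b0 1"
    have A: "A \<ge> 1" "c \<ge> 0" "B > 0" "B \<ge> b0" using d0 by (auto simp: A_def c_def B_def)
    have nD: "norm (?D x) \<le> A * norm (V x) + c" for x
    proof -
      have "norm (?D x) \<le> \<bar>\<zeta> x ^ m * (2 * max 0 (U x - k))\<bar> * norm (V x) + \<bar>pos_sq k (U x) * (m * \<zeta> x ^ (m - 1))\<bar> * norm (D\<zeta> x)"
        using norm_triangle_ineq[of "(\<zeta> x ^ m * (2 * max 0 (U x - k))) *\<^sub>R V x" "(pos_sq k (U x) * (m * \<zeta> x ^ (m - 1))) *\<^sub>R D\<zeta> x"] by simp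
      also have "\<dots> \<le> A * norm (V x) + (M'\<^sup>2 * m) * d"
      proof (intro add_mono mult_mono bd)
        have "\<zeta> x ^ m * (2 * max 0 (U x - k)) \<le> 1 * (2 * M')"
          using \<zeta>[of x] M'(2)[of x] by (intro mult_mono power_le_one) auto
        then show "\<bar>\<zeta> x ^ m * (2 * max 0 (U x - k))\<bar> \<le> A" using \<zeta>[of x] by (simp add: A_def)
        have "pos_sq k (U x) * (m * \<zeta> x ^ (m - 1)) \<le> M'\<^sup>2 * (real m * 1)"
          using \<zeta>[of x] M'(3)[of x] by (intro mult_mono[OF _ mult_left_mono]) (auto simp: pos_sq_def power_le_one)
        then show "\<bar>pos_sq k (U x) * (m * \<zeta> x ^ (m - 1))\<bar> \<le> M'\<^sup>2 * m" using \<zeta>[of x] by (simp add: pos_sq_def)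
      qed (use A in auto)
      finally show ?thesis by (simp add: c_def mult.assoc)
    qed
    define h where "h x = c1 * (2 * A) powr q * (indicator (ball x0 R0) x * (g x (norm (V x)) * norm (V x))) +
      (indicator (ball x0 R0) x * g x (2 * A * B)) * (2 * A * B) + (indicator (ball x0 R0) x * g x (2 * c)) * (2 * c)" for x
    have hi: "integrable lebesgue h" unfolding h_def[abs_def]
      using energy_integrable g_integrable[of "2 * A * B"] g_integrable[of "2 * c"] A
      by (intro Bochner_Integration.integrable_add integrable_mult_right integrable_mult_left) auto
    have "(\<integral>\<^sup>+x\<in>\<Omega>. ennreal (G_of g x (norm (?D x))) \<partial>lebesgue) \<le> (\<integral>\<^sup>+x. ennreal (norm (h x)) \<partial>lebesgue)"
    proof (rule nn_integral_mono_AE)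
      show "AE x in lebesgue. ennreal (G_of g x (norm (?D x))) * indicator \<Omega> x \<le> ennreal (norm (h x))"
        using g_mono_AE
      proof eventually_elim
        case (elim x)
        show ?case
        proof (cases "x \<in> ball x0 R0")
          case True
          then have xO: "x \<in> \<Omega>" by (rule ball_in_domain)
          have "g x (norm (?D x)) * norm (?D x) \<le> c1 * (2 * A) powr q * (g x (norm (V x)) * norm (V x)) +
              g x (2 * A * B) * (2 * A * B) + g x (2 * c) * (2 * c)"
            by (rule growth_pointwise[OF g_nonneg[OF xO] _ g1_mult[OF xO] c1_pos A(3,4,1,2) _ _ nD])
              (use elim xO in auto)
          also have "\<dots> = h x" using True by (simp add: h_def)
          also have "\<dots> \<le> norm (h x)" by simp
          finally show ?thesis using xO by (simp add: G_of_def ennreal_leI)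
        next
          case False
          show ?thesis unfolding D0[OF False] by (simp add: G_of_def)
        qed
      qed
    qed
    also have "\<dots> < \<infinity>" using hi by (simp add: integrable_iff_bounded)
    finally show "(\<integral>\<^sup>+x\<in>\<Omega>. ennreal (G_of g x (norm (?D x))) \<partial>lebesgue) < \<infinity>" .
  qed auto
qed

text \<open>The tested integrand equals 2 L + r, where r comes from the gradient of the cutoff.
  Pointwise r is at most L + err in absolute value, so one L is absorbed and the other one is
  bounded by err. The condition on \<open>H * d\<close> makes (g1) applicable at that
  argument.\<close>

lemma caccioppoli:
  fixes m :: nat and \<zeta> :: "real^'n \<Rightarrow> real"
  assumes C: "\<forall>k. Ck k \<zeta>" and D: "\<forall>x. GDERIV \<zeta> x :> D\<zeta> x" and \<zeta>: "\<And>x. 0 \<le> \<zeta> x \<and> \<zeta> x \<le> 1"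
    and out: "\<And>x. x \<notin> ball x0 b \<Longrightarrow> \<zeta> x = 0 \<and> D\<zeta> x = 0" and b: "b \<le> R0"
    and bd: "\<And>x. norm (D\<zeta> x) \<le> d" and m: "m \<ge> q" and d: "d > 0" and H: "H > 0" "b0 \<le> H * d"
    and Uk: "AE x in lebesgue. x \<in> ball x0 b \<longrightarrow> U x \<le> k + H"
  defines "L \<equiv> \<lambda>x. indicator (ball x0 R0) x * (max 0 (U x - k) * (g x (norm (V x)) * norm (V x)) * \<zeta> x ^ m)"
  shows "integrable lebesgue L"
    "(LINT x|lebesgue. L x) \<le> c1 * m ^ m * H * (LINT x|lebesgue. indicator (super_level U k x0 b) x * (g x (H * d) * (H * d)))"
proof -
  have m2: "m \<ge> 2" using m q_gt_1 by linarith
  define M' where "M' = M + \<bar>k\<bar>"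
  have M': "max 0 (U x - k) \<le> M'" for x
    using UM[of x] order_trans[OF abs_ge_zero UM[of x]] by (simp add: M'_def abs_if split: if_splits)
  have \<zeta>m: "\<zeta> \<in> borel_measurable lebesgue" "D\<zeta> \<in> borel_measurable lebesgue"
  proof -
    have t: "test_function UNIV \<zeta>" unfolding test_function_def
      using C out ball_subset_cball by (intro conjI exI[of _ "cball x0 b"]) auto
    obtain K where "continuous_on UNIV \<zeta>" "continuous_on UNIV D\<zeta>" "compact (K::(real^'n) set)"
      using test_function_bounds[OF t D] by metis
    then show "\<zeta> \<in> borel_measurable lebesgue" "D\<zeta> \<in> borel_measurable lebesgue"
      by (auto intro!: measurable_completion borel_measurable_continuous_onI)
  qed
  have gm: "(\<lambda>x. indicator (ball x0 R0) x * g x (norm (V x))) \<in> borel_measurable lebesgue"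
    using V_lebesgue by (intro g_measurable) auto
  define P where "P x = 2 * max 0 (U x - k) * norm (V x) * \<zeta> x ^ m" for x
  show Li: "integrable lebesgue L"
  proof (rule Bochner_Integration.integrable_bound)
    show "integrable lebesgue (\<lambda>x. M' * (indicator (ball x0 R0) x * (g x (norm (V x)) * norm (V x))))"
      by (intro integrable_mult_right energy_integrable)
    have "(\<lambda>x. (indicator (ball x0 R0) x * g x (norm (V x))) * (max 0 (U x - k) * norm (V x) * \<zeta> x ^ m)) \<in> borel_measurable lebesgue"
      by (rule borel_measurable_times[OF gm]) (use U_lebesgue V_lebesgue \<zeta>m in measurable)
    then show "L \<in> borel_measurable lebesgue" by (simp add: L_def mult_ac)
    show "AE x in lebesgue. norm (L x) \<le> norm (M' * (indicator (ball x0 R0) x * (g x (norm (V x)) * norm (V x))))"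
    proof (rule AE_I2)
      fix x
      have "max 0 (U x - k) * \<zeta> x ^ m \<le> M' * 1"
        using M'[of x] \<zeta>[of x] by (intro mult_mono power_le_one) auto
      then have "\<bar>max 0 (U x - k) * \<zeta> x ^ m\<bar> \<le> \<bar>M'\<bar>" using \<zeta>[of x] by simp
      then have "\<bar>max 0 (U x - k) * \<zeta> x ^ m\<bar> * \<bar>indicator (ball x0 R0) x * (g x (norm (V x)) * norm (V x))\<bar> \<le>
          \<bar>M'\<bar> * \<bar>indicator (ball x0 R0) x * (g x (norm (V x)) * norm (V x))\<bar>" by (rule mult_right_mono) simp
      then show "norm (L x) \<le> norm (M' * (indicator (ball x0 R0) x * (g x (norm (V x)) * norm (V x))))"
        by (simp add: L_def abs_mult mult_ac)
    qed
  qed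
  define err where "err x = c1 * m ^ m * H * (indicator (super_level U k x0 b) x * (g x (H * d) * (H * d)))" for x
  have sb: "super_level U k x0 b \<subseteq> ball x0 R0" using b by auto
  have erri: "integrable lebesgue err"
  proof -
    have "integrable lebesgue (\<lambda>x. indicator (super_level U k x0 b) x *\<^sub>R (indicator (ball x0 R0) x * g x (H * d)))"
    proof (rule integrable_mult_indicator)
      have "super_level U k x0 b \<in> sets borel" using U_borel by measurable
      then show "super_level U k x0 b \<in> sets lebesgue" by simp
      show "integrable lebesgue (\<lambda>x. indicator (ball x0 R0) x * g x (H * d))"
        using H d by (intro g_integrable) auto
    qed
    moreover have "indicator (super_level U k x0 b) x *\<^sub>R (indicator (ball x0 R0) x * g x (H * d)) =
        indicator (super_level U k x0 b) x * g x (H * d)" for x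
      using sb by (auto simp: indicator_def)
    ultimately have "integrable lebesgue (\<lambda>x. indicator (super_level U k x0 b) x * g x (H * d))" by (simp only:)
    then have "integrable lebesgue (\<lambda>x. c1 * m ^ m * H * ((indicator (super_level U k x0 b) x * g x (H * d)) * (H * d)))"
      by (intro integrable_mult_right integrable_mult_left)
    then show ?thesis by (simp add: err_def[abs_def] mult.assoc)
  qed
  define E where "E x = indicator (ball x0 R0) x * (g x (norm (V x)) * (((1 / norm (V x)) *\<^sub>R V x) \<bullet>
      ((\<zeta> x ^ m * (2 * max 0 (U x - k))) *\<^sub>R V x + (pos_sq k (U x) * (m * \<zeta> x ^ (m - 1))) *\<^sub>R D\<zeta> x)))" for x
  have E0: "(LINT x|lebesgue. E x) = 0"
    unfolding E_def by (rule test_weak_equation[OF C D \<zeta> out b bd m2])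
  \<comment> \<open>The lower bound is the estimate; the upper one makes \<open>E\<close>
    integrable, so that its vanishing integral can be compared.\<close>
  have key: "AE x in lebesgue. L x - err x \<le> E x \<and> \<bar>E x\<bar> \<le> 3 * L x + err x"
    using Uk g_mono_AE
  proof eventually_elim
    case (elim x)
    show ?case
    proof (cases "x \<in> ball x0 b")
      case False
      then have "\<zeta> x = 0" using out by blast
      then show ?thesis using m2 False by (simp add: L_def E_def err_def power_0_left)
    next
      case True
      then have xR: "x \<in> ball x0 R0" using b by auto
      then have xO: "x \<in> \<Omega>" by (rule ball_in_domain)
      define w where "w = max 0 (U x - k)"
      define t where "t = norm (V x)"
      have w: "0 \<le> w" "w \<le> H" using elim True H by (auto simp: w_def)
      have err: "err x = c1 * m ^ m * H * (g x (H * d) * (H * d)) \<or> w = 0 \<and> err x = 0"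
      proof (cases "U x > k")
        case True
        then have "x \<in> super_level U k x0 b" using \<open>x \<in> ball x0 b\<close> by simp
        then show ?thesis by (simp only: err_def indicator_simps mult_1 simp_thms)
      next
        case False
        then have "x \<notin> super_level U k x0 b" by simp
        then have "indicat_real (super_level U k x0 b) x = 0" by (rule indicator_simps)
        then have "err x = 0" by (simp only: err_def mult_zero_left mult_zero_right)
        then show ?thesis using False by (simp add: w_def)
      qed
      have Lx: "L x = w * (g x t * t) * \<zeta> x ^ m" using xR by (simp add: L_def w_def t_def)
      have VV: "((1 / norm (V x)) *\<^sub>R V x) \<bullet> V x = t"
        by (cases "V x = 0") (auto simp: t_def dot_square_norm power2_eq_square)
      define r where "r = g x t * (w\<^sup>2 * (m * \<zeta> x ^ (m - 1)) * (((1 / norm (V x)) *\<^sub>R V x) \<bullet> D\<zeta> x))"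
      have Ex: "E x = 2 * L x + r"
      proof -
        define N where "N = (1 / norm (V x)) *\<^sub>R V x"
        have IP: "N \<bullet> (\<alpha> *\<^sub>R V x + \<beta> *\<^sub>R D\<zeta> x) = \<alpha> * t + \<beta> * (N \<bullet> D\<zeta> x)" for \<alpha> \<beta>
          unfolding N_def inner_add_right inner_scaleR_right[of _ _ "V x"] VV inner_scaleR_right[of _ _ "D\<zeta> x"] ..
        have "E x = g x t * (N \<bullet> ((\<zeta> x ^ m * (2 * w)) *\<^sub>R V x + (w\<^sup>2 * (m * \<zeta> x ^ (m - 1))) *\<^sub>R D\<zeta> x))"
          using xR by (simp only: E_def w_def t_def N_def pos_sq_def indicator_simps mult_1)
        then show ?thesis unfolding IP Lx r_def N_def[symmetric] by (simp add: algebra_simps)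
      qed
      have gt: "g x t \<ge> 0" using g_nonneg[OF xO, of t] by (simp add: t_def)
      define Z where "Z = ((1 / norm (V x)) *\<^sub>R V x) \<bullet> D\<zeta> x"
      have Zd: "\<bar>Z\<bar> \<le> d"
      proof -
        have "\<bar>Z\<bar> \<le> norm ((1 / norm (V x)) *\<^sub>R V x) * norm (D\<zeta> x)"
          unfolding Z_def by (rule Cauchy_Schwarz_ineq2)
        also have "\<dots> \<le> 1 * d" using bd[of x] by (intro mult_mono) auto
        finally show ?thesis by simp
      qed
      have "\<bar>r\<bar> = g x t * (w\<^sup>2 * (m * \<zeta> x ^ (m - 1)) * \<bar>Z\<bar>)"
        unfolding r_def Z_def[symmetric] using gt \<zeta>[of x] by (simp add: abs_mult)
      also have "\<dots> \<le> g x t * (w\<^sup>2 * (m * \<zeta> x ^ (m - 1)) * d)"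
        using gt \<zeta>[of x] Zd by (intro mult_left_mono) auto
      also have "\<dots> = w\<^sup>2 * g x t * (m * \<zeta> x ^ (m - 1) * d)" by (simp add: mult_ac)
      also have "\<dots> \<le> L x + err x"
      proof (cases "w = 0")
        case True
        have "err x \<ge> 0" unfolding err_def using c1_pos H d g_nonneg[OF xO, of "H * d"]
          by (intro mult_nonneg_nonneg) auto
        then show ?thesis using True Lx by simp
      next
        case False
        then have "err x = c1 * m ^ m * H * (g x (H * d) * (H * d))" using err by blast
        then show ?thesis unfolding Lx
          using caccioppoli_pointwise[OF g_nonneg[OF xO] _ g1_mult[OF xO] q_gt_1 m c1_pos w H(1) _ _ d H(2), of "\<zeta> x" t]
            elim xO \<zeta>[of x] by (simp add: t_def)
      qed
      finally have "\<bar>r\<bar> \<le> L x + err x" .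
      moreover have "L x \<ge> 0" unfolding Lx using w gt \<zeta>[of x] by (simp add: t_def)
      ultimately show ?thesis unfolding Ex by (auto simp: abs_if split: if_splits)
    qed
  qed
  have Em: "E \<in> borel_measurable lebesgue"
  proof -
    have "(\<lambda>x. (indicator (ball x0 R0) x * g x (norm (V x))) * (((1 / norm (V x)) *\<^sub>R V x) \<bullet>
      ((\<zeta> x ^ m * (2 * max 0 (U x - k))) *\<^sub>R V x + (pos_sq k (U x) * (m * \<zeta> x ^ (m - 1))) *\<^sub>R D\<zeta> x))) \<in> borel_measurable lebesgue"
      by (rule borel_measurable_times[OF gm], unfold pos_sq_def) (use U_lebesgue V_lebesgue \<zeta>m in measurable)
    then show ?thesis by (simp add: E_def[abs_def] mult.assoc)
  qed
  have Ei: "integrable lebesgue E"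
  proof (rule Bochner_Integration.integrable_bound[OF _ Em])
    show "integrable lebesgue (\<lambda>x. 3 * L x + err x)" using Li erri by auto
    show "AE x in lebesgue. norm (E x) \<le> norm (3 * L x + err x)" using key by eventually_elim auto
  qed
  have "(LINT x|lebesgue. L x - err x) \<le> (LINT x|lebesgue. E x)"
    using key Li erri Ei by (intro integral_mono_AE) auto
  then have "(LINT x|lebesgue. L x) \<le> (LINT x|lebesgue. err x)" using Li erri E0 by simp
  also have "\<dots> = c1 * m ^ m * H * (LINT x|lebesgue. indicator (super_level U k x0 b) x * (g x (H * d) * (H * d)))"
    by (simp add: err_def)
  finally show "(LINT x|lebesgue. L x) \<le> c1 * m ^ m * H * (LINT x|lebesgue. indicator (super_level U k x0 b) x * (g x (H * d) * (H * d)))" .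
qed

text \<open>Where the norm of \<open>V\<close> is at most T H/R there is nothing to show. Elsewhere
  (g2) gives T^(p-1) g(x,H/R) \<le> g(x,|V|), and (g3) replaces g(x,H/R) by g(x0,H/R) up to a factor
  \<gamma>; so |V| is controlled by the weighted energy of \<open>caccioppoli\<close>. Its right
  side contains g at points of the level set, which (g3) compares with g(x0,H/R) again. The value at
  x0 cancels and leaves \<gamma>^2; likewise one factor \<open>c1\<close> comes from the absorption
  and one from the scaling by \<mu>.\<close>

theorem energy_estimate:
  fixes m :: nat and B :: real
  assumes cut: "has_cutoffs x0 B" and m: "q \<le> m"
    and R: "0 < R" "R \<le> R0" "R < rs" "ball x0 (8 * R) \<subseteq> \<Omega>"
    and H: "R \<le> H" "H \<le> M" "b0 \<le> H / R"
    and Uk: "AE x in lebesgue. x \<in> ball x0 R \<longrightarrow> U x \<le> k + H"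
  shows "energy_est U V x0 R m (c1\<^sup>2 * m ^ m * (c2 M)\<^sup>2 * B ^ m * (exp (lam R))\<^sup>2) p k H"
  unfolding energy_est_def
proof (intro allI impI, elim conjE)
  fix l a b T :: real and S
  assume kl: "k < l" and ab: "0 < a" "a < b" "b \<le> R" and T: "1 \<le> T" and Sb: "S \<in> sets borel" and SA: "S \<subseteq> super_level U l x0 a"
  obtain \<zeta> D\<zeta> where C: "\<forall>k. Ck k \<zeta>" and D: "\<forall>x. GDERIV \<zeta> x :> D\<zeta> x" and \<zeta>: "\<And>x. 0 \<le> \<zeta> x \<and> \<zeta> x \<le> 1"
    and \<zeta>1: "\<And>x. x \<in> cball x0 a \<Longrightarrow> \<zeta> x = 1" and out: "\<And>x. x \<notin> ball x0 b \<Longrightarrow> \<zeta> x = 0 \<and> D\<zeta> x = 0"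
    and bd: "\<And>x. norm (D\<zeta> x) \<le> B / (b - a)"
    using cut ab(1,2) unfolding has_cutoffs_def by metis
  have B: "B \<ge> 1" using cut by (simp add: has_cutoffs_def)
  have Hp: "H > 0" and Mp: "M > 0" using H R by linarith+
  define d where "d = B / (b - a)"
  define \<mu> where "\<mu> = B * (R / (b - a))"
  define h where "h = H / R"
  have h: "h > 0" "b0 \<le> h" using Hp R H by (auto simp: h_def)
  have ba: "0 < b - a" "b - a \<le> R" using ab by auto
  have \<mu>1: "\<mu> \<ge> 1"
  proof -
    have "1 * 1 \<le> B * (R / (b - a))" using B ba by (intro mult_mono) auto
    then show ?thesis by (simp add: \<mu>_def)
  qed
  \<comment> \<open>The argument natural for the cutoff exceeds H/R by the factor \<mu>, which (g1)
    removes.\<close>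
  have Hd: "H * d = h * \<mu>" using R by (simp add: h_def d_def \<mu>_def)
  have hm: "h \<le> h * \<mu>" using h \<mu>1 by simp
  have d0: "d > 0" using B ba by (simp add: d_def)
  have c2: "c2 M > 0" using cg3 Mp by (auto simp: cond_g3_def)
  define \<gamma> where "\<gamma> = c2 M * exp (lam R)"
  have \<gamma>: "\<gamma> > 0" using c2 by (simp add: \<gamma>_def)
  have x0R: "x0 \<in> ball x0 R" using R by simp
  have x0O: "x0 \<in> \<Omega>" using R(4) R(1) by auto
  define g0 where "g0 = g x0 h"
  have g0: "g0 > 0" unfolding g0_def using x0O h by (intro g_pos)
  \<comment> \<open>(g3) with K = M and v = H, which is where R \<le> H \<le> M is used.\<close>
  have g3: "g x1 h \<le> \<gamma> * g x2 h" if "x1 \<in> ball x0 R" "x2 \<in> ball x0 R" for x1 x2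
    using cg3 Mp R H that unfolding cond_g3_def h_def \<gamma>_def by blast
  have RO: "x \<in> ball x0 R \<Longrightarrow> x \<in> \<Omega>" for x using R by auto
  have Ukb: "AE x in lebesgue. x \<in> ball x0 b \<longrightarrow> U x \<le> k + H"
    using Uk by eventually_elim (use ab in auto)
  define A where "A = super_level U k x0 b"
  have Ab: "A \<in> sets borel" unfolding A_def using U_borel by measurable
  have fin: "bounded A" unfolding A_def by (rule bounded_subset[OF bounded_ball[of x0 b]]) auto
  have finS: "bounded S" using SA by (intro bounded_subset[OF bounded_ball[of x0 a]]) auto
  define L where "L x = indicator (ball x0 R0) x * (max 0 (U x - k) * (g x (norm (V x)) * norm (V x)) * \<zeta> x ^ m)" for x
  have "b \<le> R0" using ab R by simp
  have b0Hd: "b0 \<le> H * d" using Hd hm h by linarith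
  have Li: "integrable lebesgue L" unfolding L_def[abs_def]
    by (rule caccioppoli(1)[OF C D \<zeta> out \<open>b \<le> R0\<close> bd[folded d_def] m d0 Hp b0Hd Ukb])
  have Lle: "(LINT x|lebesgue. L x) \<le> c1 * m ^ m * H * (LINT x|lebesgue. indicator A x * (g x (H * d) * (H * d)))"
    unfolding L_def A_def
    by (rule caccioppoli(2)[OF C D \<zeta> out \<open>b \<le> R0\<close> bd[folded d_def] m d0 Hp b0Hd Ukb])
  define K where "K = c1 * \<mu> ^ m * h * \<gamma> * g0"
  have mes: "emeasure lborel Z < \<infinity>" if "bounded Z" for Z :: "(real^'n) set"
    using emeasure_bounded_finite[OF that] by simp
  have up: "(LINT x|lebesgue. indicator A x * (g x (H * d) * (H * d))) \<le> K * measure lborel A"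
  proof -
    have pt: "indicator A x * (g x (H * d) * (H * d)) \<le> K * indicator A x" for x
    proof (cases "x \<in> A")
      case True
      then have xR: "x \<in> ball x0 R" using ab by (auto simp: A_def)
      then have xO: "x \<in> \<Omega>" by (rule RO)
      have "g x (h * \<mu>) \<le> c1 * \<mu> powr (q - 1) * g x h" using g1_mult[OF xO h hm] h by simp
      then have "g x (h * \<mu>) * (h * \<mu>) \<le> c1 * \<mu> powr (q - 1) * g x h * (h * \<mu>)"
        using h \<mu>1 by (intro mult_right_mono) auto
      also have "\<dots> = c1 * \<mu> powr q * h * g x h" using \<mu>1 by (simp add: powr_diff)
      also have "\<dots> \<le> c1 * \<mu> ^ m * h * (\<gamma> * g0)"
      proof (intro mult_mono)
        have "\<mu> powr q \<le> \<mu> powr m" using \<mu>1 m by (intro powr_mono) auto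
        also have "\<mu> powr m = \<mu> ^ m" using \<mu>1 by (simp add: powr_realpow)
        finally show "\<mu> powr q \<le> \<mu> ^ m" .
        show "g x h \<le> \<gamma> * g0" unfolding g0_def by (rule g3[OF xR x0R])
        show "0 \<le> g x h" using g_nonneg[OF xO, of h] h by simp
      qed (use c1_pos h \<mu>1 in auto)
      finally show ?thesis using True Hd by (simp add: K_def mult.assoc)
    qed simp
    have "(LINT x|lebesgue. indicator A x * (g x (H * d) * (H * d))) \<le> (LINT x|lebesgue. K * indicator A x)"
    proof (rule integral_mono_AE')
      show "integrable lebesgue (\<lambda>x. K * indicat_real A x)"
        using Ab mes[OF fin] by (intro integrable_mult_right integrable_real_indicator) auto
      have "K \<ge> 0" using c1_pos \<mu>1 h \<gamma> g0 by (simp add: K_def)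
      then show "AE x in lebesgue. 0 \<le> K * indicat_real A x" by simp
    qed (use pt in auto)
    also have "\<dots> = K * measure lborel A" using Ab by simp
    finally show ?thesis .
  qed
  have Lup: "(LINT x|lebesgue. L x) \<le> c1 * m ^ m * H * (K * measure lborel A)"
  proof -
    have "(LINT x|lebesgue. L x) \<le> c1 * m ^ m * H * (LINT x|lebesgue. indicator A x * (g x (H * d) * (H * d)))"
      by (rule Lle)
    also have "\<dots> \<le> c1 * m ^ m * H * (K * measure lborel A)"
      using up c1_pos Hp by (intro mult_left_mono) auto
    finally show ?thesis .
  qed
  \<comment> \<open>Chosen such that \<open>W * L x\<close> dominates the norm of \<open>V x\<close>
    at the points of \<open>S\<close> where it exceeds \<open>T * h\<close>.\<close>
  define W where "W = T powr (1 - p) * (\<gamma> / g0) / (l - k)"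
  have W0: "W \<ge> 0" using \<gamma> g0 kl by (simp add: W_def)
  have pt: "indicator S x * norm (V x) \<le> T * h * indicator S x + W * L x" for x
  proof (cases "x \<in> S")
    case False
    have "L x \<ge> 0"
    proof (cases "x \<in> ball x0 R0")
      case True
      then show ?thesis using g_nonneg[OF ball_in_domain[OF True], of "norm (V x)"] \<zeta>[of x] by (simp add: L_def)
    qed (simp add: L_def)
    then show ?thesis using False W0 by simp
  next
    case True
    then have xa: "x \<in> ball x0 a" "U x > l" using SA by auto
    then have xR: "x \<in> ball x0 R" "x \<in> ball x0 R0" using ab R by auto
    have xO: "x \<in> \<Omega>" by (rule RO[OF xR(1)])
    define t where "t = norm (V x)"
    have Gnn: "0 \<le> g x t * t" using g_nonneg[OF xO, of t] by (simp add: t_def)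
    have "\<zeta> x = 1" using xa \<zeta>1 by auto
    then have Lx: "L x = (U x - k) * (g x t * t)" using xR xa kl by (simp add: L_def t_def)
    have WL: "T powr (1 - p) * (\<gamma> / g0) * (g x t * t) \<le> W * L x"
    proof -
      have "T powr (1 - p) * (\<gamma> / g0) * (g x t * t) = W * ((l - k) * (g x t * t))" using kl by (simp add: W_def)
      also have "\<dots> \<le> W * L x" unfolding Lx using xa Gnn W0 by (intro mult_left_mono mult_right_mono) auto
      finally show ?thesis .
    qed
    have "t \<le> T * h + W * L x"
    proof (cases "t \<le> T * h")
      case True
      then show ?thesis using WL Gnn \<gamma> g0 by (smt (verit) divide_nonneg_nonneg mult_nonneg_nonneg powr_ge_zero)
    next
      case False
      then have th: "T * h < t" by simp
      have "h \<le> T * h" using T h by simp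
      then have ht: "h \<le> t" using th by linarith
      have "T powr (p - 1) \<le> (t / h) powr (p - 1)"
        using th h T p_gt_1 by (intro powr_mono2) (auto simp: field_simps)
      then have "T powr (p - 1) * g x h \<le> (t / h) powr (p - 1) * g x h"
        using g_nonneg[OF xO, of h] h by (intro mult_right_mono) auto
      also have "\<dots> \<le> g x t" by (rule g2_mult[OF xO h(1) ht])
      finally have 1: "T powr (p - 1) * g x h \<le> g x t" .
      have "g0 \<le> \<gamma> * g x h" unfolding g0_def by (rule g3[OF x0R xR(1)])
      then have "T powr (p - 1) * g0 \<le> T powr (p - 1) * (\<gamma> * g x h)" by (intro mult_left_mono) auto
      also have "\<dots> \<le> \<gamma> * g x t" using mult_left_mono[OF 1, of \<gamma>] \<gamma> by (simp add: mult_ac)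
      finally have "T powr (p - 1) * g0 \<le> \<gamma> * g x t" .
      then have "T powr (1 - p) * (T powr (p - 1) * g0) \<le> T powr (1 - p) * (\<gamma> * g x t)" by (intro mult_left_mono) auto
      moreover have "T powr (1 - p) * (T powr (p - 1) * g0) = g0"
        using T by (simp add: mult.assoc[symmetric] flip: powr_add)
      ultimately have "1 \<le> T powr (1 - p) * (\<gamma> / g0) * g x t" using g0 by (simp add: field_simps)
      then have "1 * t \<le> (T powr (1 - p) * (\<gamma> / g0) * g x t) * t" by (rule mult_right_mono) (simp add: t_def)
      also have "\<dots> \<le> W * L x" using WL by (simp add: mult.assoc)
      finally show ?thesis using T h by (simp add: add_increasing)
    qed
    then show ?thesis using True by (simp add: t_def)
  qed
  have "(LINT x:S|lborel. norm (V x)) = (LINT x|lebesgue. indicator S x * norm (V x))"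
  proof -
    have "(\<lambda>x. indicator S x *\<^sub>R norm (V x)) \<in> borel_measurable lborel"
      using Sb V_borel by measurable
    then show ?thesis unfolding set_lebesgue_integral_def by (simp add: integral_completion)
  qed
  also have "\<dots> \<le> (LINT x|lebesgue. T * h * indicator S x + W * L x)"
  proof (rule integral_mono_AE')
    show "integrable lebesgue (\<lambda>x. T * h * indicator S x + W * L x)"
      using Li Sb mes[OF finS]
      by (intro Bochner_Integration.integrable_add integrable_mult_right integrable_real_indicator) auto
    have "0 \<le> T * h * indicator S x + W * L x" for x
      by (rule order_trans[OF _ pt]) simp
    then show "AE x in lebesgue. 0 \<le> T * h * indicator S x + W * L x" by simp
  qed (use pt in auto)
  also have "\<dots> = T * h * measure lborel S + W * (LINT x|lebesgue. L x)"
    using Li Sb mes[OF finS]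
    by (subst Bochner_Integration.integral_add) (auto intro!: integrable_mult_right integrable_real_indicator)
  also have "\<dots> \<le> T * h * measure lborel S + W * (c1 * m ^ m * H * (K * measure lborel A))"
    using Lup W0 by (intro add_left_mono mult_left_mono)
  also have "W * (c1 * m ^ m * H * (K * measure lborel A)) =
      T powr (1 - p) * (c1\<^sup>2 * m ^ m * (c2 M)\<^sup>2 * B ^ m * (exp (lam R))\<^sup>2) * (R / (b - a)) ^ m * (H / (l - k)) * (H / R) * measure lborel A"
  proof -
    define e \<rho> where "e = l - k" and "\<rho> = R / (b - a)"
    have e: "e \<noteq> 0" using kl by (simp add: e_def)
    show ?thesis
      unfolding W_def K_def \<gamma>_def \<mu>_def h_def e_def[symmetric] \<rho>_def[symmetric]
      using g0 e R by (simp add: power_mult_distrib power2_eq_square field_simps)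
  qed
  finally show "(LINT x:S|lborel. norm (V x)) \<le> T * (H / R) * measure lborel S +
      T powr (1 - p) * (c1\<^sup>2 * m ^ m * (c2 M)\<^sup>2 * B ^ m * (exp (lam R))\<^sup>2) * (R / (b - a)) ^ m * (H / (l - k)) * (H / R) *
      measure lborel (super_level U k x0 b)"
    by (simp add: h_def A_def)
qed

end

section \<open>Localised solutions\<close>

lemma line_primitive_uminus:
  assumes "line_primitive U V"
  shows "line_primitive (\<lambda>x. - U x) (\<lambda>x. - V x)"
  unfolding line_primitive_def
proof (intro conjI allI)
  have "U \<in> borel_measurable borel" "V \<in> borel_measurable borel" "integrable lborel V"
    using assms unfolding line_primitive_def by blast+
  then show "(\<lambda>x. - U x) \<in> borel_measurable borel" "(\<lambda>x. - V x) \<in> borel_measurable borel" "integrable lborel (\<lambda>x. - V x)"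
    by auto
  fix h
  have "AE x in lborel. U (x + h) - U x = (LINT t:{0..1}|lborel. V (x + t *\<^sub>R h) \<bullet> h)"
    using assms unfolding line_primitive_def by blast
  then show "AE x in lborel. - U (x + h) - - U x = (LINT t:{0..1}|lborel. - V (x + t *\<^sub>R h) \<bullet> h)"
    by eventually_elim (simp add: set_lebesgue_integral_def)
qed

lemma line_primitive_borel:
  assumes "line_primitive U V"
  shows "U \<in> borel_measurable borel" "V \<in> borel_measurable borel"
  using assms unfolding line_primitive_def by blast+

lemma energy_est_mono:
  assumes e: "energy_est U V x0 R m \<Gamma> p k H" and "\<Gamma> \<le> \<Gamma>'" "0 < R" "0 \<le> H"
  shows "energy_est U V x0 R m \<Gamma>' p k H"
  unfolding energy_est_def
proof (intro allI impI, elim conjE)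
  fix l a b T :: real and S
  assume *: "k < l" "0 < a" "a < b" "b \<le> R" "1 \<le> T" "S \<in> sets borel" "S \<subseteq> super_level U l x0 a"
  have "(LINT x:S|lborel. norm (V x)) \<le> T * (H / R) * measure lborel S +
      T powr (1 - p) * \<Gamma> * (R / (b - a)) ^ m * (H / (l - k)) * (H / R) * measure lborel (super_level U k x0 b)"
    by (rule energy_estD[OF e *])
  also have "\<dots> \<le> T * (H / R) * measure lborel S +
      T powr (1 - p) * \<Gamma>' * (R / (b - a)) ^ m * (H / (l - k)) * (H / R) * measure lborel (super_level U k x0 b)"
    using assms(2-4) * by (intro add_left_mono mult_right_mono mult_left_mono) auto
  finally show "(LINT x:S|lborel. norm (V x)) \<le> T * (H / R) * measure lborel S +
      T powr (1 - p) * \<Gamma>' * (R / (b - a)) ^ m * (H / (l - k)) * (H / R) * measure lborel (super_level U k x0 b)" .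
qed

text \<open>The local hypotheses of the energy estimate, in a form that refers only to
  \<open>U\<close> and \<open>V\<close> and is invariant under a change of sign. Restricting to
  gradients \<open>D\<phi>\<close> that vanish off the ball is what allows \<open>Du\<close> to be
  replaced by \<open>V\<close>.\<close>

definition localized_solution ::
    "(real^'n \<Rightarrow> real \<Rightarrow> real) \<Rightarrow> (real^'n) set \<Rightarrow> real^'n \<Rightarrow> real \<Rightarrow> real \<Rightarrow> (real^'n \<Rightarrow> real) \<Rightarrow> (real^'n \<Rightarrow> real^'n) \<Rightarrow> bool" where
  "localized_solution g \<Omega> x0 R0 M U V \<longleftrightarrow> line_primitive U V \<and> (\<forall>x. \<bar>U x\<bar> \<le> M) \<and> R0 > 0 \<and> cball x0 R0 \<subseteq> \<Omega> \<and>
     (\<integral>\<^sup>+x\<in>ball x0 R0. ennreal (G_of g x (norm (V x))) \<partial>lebesgue) < \<infinity> \<and>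
     (\<forall>\<phi> D\<phi>. W1G_0 g \<Omega> \<phi> \<longrightarrow> weak_gradient \<Omega> \<phi> D\<phi> \<longrightarrow> D\<phi> \<in> borel_measurable lebesgue \<longrightarrow>
       (\<forall>x. x \<notin> ball x0 R0 \<longrightarrow> D\<phi> x = 0) \<longrightarrow>
       (LINT x|lebesgue. indicator (ball x0 R0) x * (g x (norm (V x)) * (((1 / norm (V x)) *\<^sub>R V x) \<bullet> D\<phi> x))) = 0)"

text \<open>This gives the statements about the infimum from those about the supremum.\<close>

lemma localized_solution_uminus:
  assumes "localized_solution g \<Omega> x0 R0 M U V"
  shows "localized_solution g \<Omega> x0 R0 M (\<lambda>x. - U x) (\<lambda>x. - V x)"
  using assms line_primitive_uminus[of U V] unfolding localized_solution_def by simp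

text \<open>The local energy bound is taken on a ball of intermediate radius, where it concerns some
  weak gradient \<open>Du'\<close>. Uniqueness identifies it with the \<open>Du\<close> of the
  equation, and the cutoff function keeps both \<open>u\<close> and \<open>Du\<close> unchanged on
  the smallest ball.\<close>

lemma exists_localized_solution:
  fixes u :: "real^'n \<Rightarrow> real"
  assumes \<Omega>: "open \<Omega>" "x0 \<in> \<Omega>" and sol: "bounded_weak_solution g \<Omega> u" and cg: "cond_g \<Omega> g"
    and bd: "AE x in lebesgue. x \<in> \<Omega> \<longrightarrow> \<bar>u x\<bar> \<le> M" and M: "M \<ge> 0"
  obtains R0 U V where "localized_solution g \<Omega> x0 R0 M U V" "AE x in lebesgue. x \<in> ball x0 R0 \<longrightarrow> U x = u x"
proof -
  obtain R2 where R2: "R2 > 0" "cball x0 R2 \<subseteq> \<Omega>" using open_contains_cball \<Omega> by blast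
  define R1 where "R1 = R2 / 2"
  define R0 where "R0 = R2 / 4"
  have R: "0 < R0" "R0 < R1" "R1 < R2" using R2 by (auto simp: R0_def R1_def)
  have sub1: "cball x0 R1 \<subseteq> \<Omega>" and sub0: "cball x0 R0 \<subseteq> \<Omega>" using R R2 by (auto intro: order_trans[OF subset_cball])
  obtain Du where wg: "weak_gradient \<Omega> u Du" and eq: "\<And>\<phi> D\<phi>. W1G_0 g \<Omega> \<phi> \<Longrightarrow> weak_gradient \<Omega> \<phi> D\<phi> \<Longrightarrow>
      (LINT x:\<Omega>|lebesgue. g x (norm (Du x)) * (((1 / norm (Du x)) *\<^sub>R Du x) \<bullet> D\<phi> x)) = 0"
    and loc: "W1G_loc g \<Omega> u"
    using sol unfolding bounded_weak_solution_def by blast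
  obtain U V where UV: "line_primitive U V" "\<And>x. \<bar>U x\<bar> \<le> M"
    "AE x in lebesgue. x \<in> ball x0 R0 \<longrightarrow> U x = u x \<and> V x = Du x"
    using localization[OF wg R(1,2) sub1 bd M] by blast
  have Vm: "V \<in> borel_measurable lebesgue"
    using line_primitive_borel(2)[OF UV(1)] by (simp add: measurable_completion)
  have "W1G g (ball x0 R1) u"
    using loc R sub1 unfolding W1G_loc_def by (metis closure_ball compact_cball open_ball order_less_trans less_irrefl)
  then obtain Du' where wg': "weak_gradient (ball x0 R1) u Du'"
    and fin: "(\<integral>\<^sup>+x\<in>ball x0 R1. ennreal (G_of g x (norm (Du' x))) \<partial>lebesgue) < \<infinity>"
    unfolding W1G_def by blast
  have wg1: "weak_gradient (ball x0 R1) u Du"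
    using wg by (rule weak_gradient_subset) (use sub1 ball_subset_cball in blast)
  have ae: "AE x in lebesgue. x \<in> ball x0 R1 \<longrightarrow> Du x = Du' x"
    by (rule weak_gradient_unique[OF open_ball wg1 wg'])
  have en: "(\<integral>\<^sup>+x\<in>ball x0 R0. ennreal (G_of g x (norm (V x))) \<partial>lebesgue) < \<infinity>"
  proof (rule le_less_trans[OF _ fin], rule nn_integral_mono_AE)
    show "AE x in lebesgue. ennreal (G_of g x (norm (V x))) * indicator (ball x0 R0) x \<le>
        ennreal (G_of g x (norm (Du' x))) * indicator (ball x0 R1) x"
      using ae UV(3)
    proof eventually_elim
      case (elim x)
      then show ?case using R by (cases "x \<in> ball x0 R0") auto
    qed
  qed
  have "localized_solution g \<Omega> x0 R0 M U V" unfolding localized_solution_def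
  proof (intro conjI allI impI)
    fix \<phi> D\<phi> assume \<phi>: "W1G_0 g \<Omega> \<phi>" "weak_gradient \<Omega> \<phi> D\<phi>" "D\<phi> \<in> borel_measurable lebesgue"
      and z: "\<forall>x. x \<notin> ball x0 R0 \<longrightarrow> D\<phi> x = 0"
    let ?f = "\<lambda>x. indicator (ball x0 R0) x * (g x (norm (V x)) * (((1 / norm (V x)) *\<^sub>R V x) \<bullet> D\<phi> x))"
    let ?h = "\<lambda>x. indicator \<Omega> x *\<^sub>R (g x (norm (Du x)) * (((1 / norm (Du x)) *\<^sub>R Du x) \<bullet> D\<phi> x))"
    have gm: "(\<lambda>x. indicator (ball x0 R0) x * g x (norm (V x))) \<in> borel_measurable lebesgue"
      by (rule cond_g_measurable[OF cg]) (use sub0 ball_subset_cball Vm in auto)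
    have "(\<lambda>x. (indicator (ball x0 R0) x * g x (norm (V x))) * (((1 / norm (V x)) *\<^sub>R V x) \<bullet> D\<phi> x)) \<in> borel_measurable lebesgue"
      by (rule borel_measurable_times[OF gm]) (use Vm \<phi>(3) in measurable)
    then have fm: "?f \<in> borel_measurable lebesgue" by (simp add: mult.assoc)
    have aefh: "AE x in lebesgue. ?f x = ?h x"
      using UV(3)
    proof eventually_elim
      case (elim x)
      show ?case
      proof (cases "x \<in> ball x0 R0")
        case True
        then have "x \<in> \<Omega>" using sub0 ball_subset_cball by blast
        then show ?thesis using elim True by simp
      next
        case False
        then have "D\<phi> x = 0" using z by blast
        then show ?thesis by simp
      qed
    qed
    have "(LINT x|lebesgue. ?f x) = (LINT x|lebesgue. ?h x)"
      by (rule integral_cong_AE[OF fm borel_measurable_lebesgue_AE[OF fm aefh] aefh])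
    also have "\<dots> = 0" using eq[OF \<phi>(1,2)] by (simp add: set_lebesgue_integral_def)
    finally show "(LINT x|lebesgue. ?f x) = 0" .
  qed (use UV en R sub0 in auto)
  moreover have "AE x in lebesgue. x \<in> ball x0 R0 \<longrightarrow> U x = u x" using UV(3) by eventually_elim blast
  ultimately show ?thesis using that by blast
qed

section \<open>Decay of the oscillation\<close>

text \<open>The part of \<Gamma> that does not depend on the radius; the maximum with 1 ensures
  \<Gamma> \<ge> 1.\<close>

definition deg_const :: "real \<Rightarrow> nat \<Rightarrow> real \<Rightarrow> real \<Rightarrow> real" where
  "deg_const c1 m c2 B = max 1 (c1\<^sup>2 * m ^ m * c2\<^sup>2 * B ^ m)"

text \<open>The lower bound on \<open>H / 2 ^ s\<close> contains both restrictions on a height h: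
  the summand 1 gives R \<le> h for (g3), the summand \<open>b0\<close> gives b0 \<le> h / R for
  (g1). Hence the energy estimate holds at all heights that occur.\<close>

lemma one_sided_reduction:
  fixes x0 :: "real^'n"
  assumes conds: "cond_g \<Omega> g" "cond_g1 \<Omega> g c1 q b0" "cond_g2 \<Omega> g p" "cond_g3 \<Omega> g rs lam c2"
    and sol: "localized_solution g \<Omega> x0 R0 M U V"
    and cut: "has_cutoffs x0 B" and m: "q \<le> m"
    and R: "0 < R" "R \<le> R0" "R < rs" "ball x0 (8 * R) \<subseteq> \<Omega>"
    and Uk: "AE x in lebesgue. x \<in> ball x0 R \<longrightarrow> U x \<le> k0 + H"
    and s: "s = deg_s CARD('n) m p (deg_const c1 m (c2 M) B * (exp (lam R))\<^sup>2)"
    and H: "R * (1 + b0) \<le> H / 2 ^ s" "H \<le> M"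
    and half: "measure lborel {x \<in> ball x0 (R / 2). U x \<le> k0} \<ge> measure lborel (ball x0 (R / 2)) / 2"
  shows "AE x in lebesgue. x \<in> ball x0 (R / 4) \<longrightarrow> U x \<le> k0 + H - H / 2 ^ (s + 1)"
proof -
  define \<Gamma> where "\<Gamma> = deg_const c1 m (c2 M) B * (exp (lam R))\<^sup>2"
  note s' = s[folded \<Gamma>_def]
  have lp: "line_primitive U V" using sol unfolding localized_solution_def by blast
  have b0: "b0 \<ge> 0" and p: "p > 1" using conds by (auto simp: cond_g1_def cond_g2_def)
  have lam: "lam R \<ge> 0" using conds(4) R by (auto simp: cond_g3_def)
  have \<Gamma>1: "\<Gamma> \<ge> 1"
  proof -
    have "1 * 1 \<le> deg_const c1 m (c2 M) B * (exp (lam R))\<^sup>2" using lam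
      by (intro mult_mono one_le_power) (auto simp: deg_const_def)
    then show ?thesis by (simp add: \<Gamma>_def)
  qed
  have Hp: "H > 0"
  proof -
    have "0 < R * (1 + b0)" using R b0 by simp
    then have "0 < H / 2 ^ s" using H by linarith
    then show ?thesis by (simp add: zero_less_divide_iff)
  qed
  have "measure lborel (super_level U (k0 + H - H / 2 ^ (deg_s DIM(real^'n) m p \<Gamma> + 1)) x0 (R / 4)) = 0"
  proof (rule oscillation_step[OF lp R(1) \<Gamma>1 p Hp _ half])
    fix k h assume k: "k0 \<le> k" and h: "H / 2 ^ deg_s DIM(real^'n) m p \<Gamma> \<le> h" "h \<le> H" "k0 + H \<le> k + h"
    have h': "R * (1 + b0) \<le> h" using h(1) H(1) s' by simp
    then have hR: "R \<le> h" "b0 \<le> h / R"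
      using R b0 by (auto simp: field_simps) (smt (verit) mult_nonneg_nonneg)
    have Uk': "AE x in lebesgue. x \<in> ball x0 R \<longrightarrow> U x \<le> k + h" using Uk by eventually_elim (use h in auto)
    have sol': "\<And>x. \<bar>U x\<bar> \<le> M" "R0 > 0" "cball x0 R0 \<subseteq> \<Omega>"
      "(\<integral>\<^sup>+x\<in>ball x0 R0. ennreal (G_of g x (norm (V x))) \<partial>lebesgue) < \<infinity>"
      "\<And>\<phi> D\<phi>. W1G_0 g \<Omega> \<phi> \<Longrightarrow> weak_gradient \<Omega> \<phi> D\<phi> \<Longrightarrow> D\<phi> \<in> borel_measurable lebesgue \<Longrightarrow>
       (\<And>x. x \<notin> ball x0 R0 \<Longrightarrow> D\<phi> x = 0) \<Longrightarrow>
       (LINT x|lebesgue. indicator (ball x0 R0) x * (g x (norm (V x)) * (((1 / norm (V x)) *\<^sub>R V x) \<bullet> D\<phi> x))) = 0"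
      using sol unfolding localized_solution_def by blast+
    have "energy_est U V x0 R m (c1\<^sup>2 * m ^ m * (c2 M)\<^sup>2 * B ^ m * (exp (lam R))\<^sup>2) p k h"
      by (rule energy_estimate[OF conds lp sol' cut m R hR(1) _ hR(2) Uk']) (use h H in auto)
    then show "energy_est U V x0 R m \<Gamma> p k h"
      by (rule energy_est_mono) (use R h' b0 hR in \<open>auto simp: \<Gamma>_def deg_const_def intro!: mult_right_mono\<close>)
  qed
  then have 0: "measure lborel (super_level U (k0 + H - H / 2 ^ (s + 1)) x0 (R / 4)) = 0" by (simp add: s')
  have Um: "U \<in> borel_measurable borel" by (rule line_primitive_borel[OF lp])
  let ?A = "super_level U (k0 + H - H / 2 ^ (s + 1)) x0 (R / 4)"
  have "bounded ?A" by (rule bounded_subset[OF bounded_ball[of x0 "R / 4"]]) auto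
  then have "emeasure lborel ?A = 0" using 0 emeasure_bounded_finite[of ?A]
    by (simp add: emeasure_eq_ennreal_measure less_top)
  moreover have "?A \<in> sets borel" using Um by measurable
  ultimately have "?A \<in> null_sets lborel" by (intro null_setsI) (simp_all only: sets_lborel)
  from AE_completion[OF AE_not_in[OF this]] show ?thesis by eventually_elim auto
qed

text \<open>De Giorgi's alternative: in the ball of radius \<open>R / 2\<close>, \<open>U\<close>
  lies below or above the middle value on at least half of the volume, and the one-sided result is
  applied to \<open>U\<close> or to \<open>- U\<close>. As \<open>H\<close> is half of the
  oscillation, the exponent becomes \<open>s + 2\<close>.\<close>

lemma oscillation_reduction:
  fixes x0 :: "real^'n"
  assumes conds: "cond_g \<Omega> g" "cond_g1 \<Omega> g c1 q b0" "cond_g2 \<Omega> g p" "cond_g3 \<Omega> g rs lam c2"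
    and sol: "localized_solution g \<Omega> x0 R0 M U V"
    and cut: "has_cutoffs x0 B" and m: "q \<le> m"
    and R: "0 < R" "R \<le> R0" "R < rs" "ball x0 (8 * R) \<subseteq> \<Omega>"
    and Uk: "AE x in lebesgue. x \<in> ball x0 R \<longrightarrow> a \<le> U x \<and> U x \<le> b"
    and s: "s = deg_s CARD('n) m p (deg_const c1 m (c2 M) B * (exp (lam R))\<^sup>2)"
    and w: "R * (1 + b0) \<le> (b - a) / 2 ^ (s + 1)" "b - a \<le> 2 * M"
  obtains a' b' where "AE x in lebesgue. x \<in> ball x0 (R / 4) \<longrightarrow> a' \<le> U x \<and> U x \<le> b'"
    "b' - a' = (b - a) * (1 - 1 / 2 ^ (s + 2))"
proof -
  define H where "H = (b - a) / 2"
  define k0 where "k0 = (a + b) / 2"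
  have H: "R * (1 + b0) \<le> H / 2 ^ s" "H \<le> M" using w by (auto simp: H_def)
  have "line_primitive U V" using sol unfolding localized_solution_def by blast
  then have Um: "U \<in> borel_measurable borel" by (rule line_primitive_borel)
  define X where "X = {x \<in> ball x0 (R / 2). U x \<le> k0}"
  define Y where "Y = {x \<in> ball x0 (R / 2). - U x \<le> - k0}"
  have XYm: "X \<in> sets borel" "Y \<in> sets borel" unfolding X_def Y_def using Um by measurable
  have sub: "AE x in lebesgue. x \<in> ball x0 (R / 4) \<longrightarrow> a \<le> U x \<and> U x \<le> b"
    using Uk by eventually_elim (use R in auto)
  have "X \<union> Y = ball x0 (R / 2)" unfolding X_def Y_def by fastforce
  then have "measure lborel (ball x0 (R / 2)) = measure lborel (X \<union> Y)" by (simp only:)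
  also have "\<dots> \<le> measure lborel X + measure lborel Y" using XYm by (intro measure_Un_le) auto
  finally consider "measure lborel X \<ge> measure lborel (ball x0 (R / 2)) / 2" | "measure lborel Y \<ge> measure lborel (ball x0 (R / 2)) / 2"
    by linarith
  then show ?thesis
  proof cases
    case 1
    have "AE x in lebesgue. x \<in> ball x0 R \<longrightarrow> U x \<le> k0 + H"
      using Uk by eventually_elim (auto simp: k0_def H_def field_simps)
    from one_sided_reduction[OF conds sol cut m R this s H 1[unfolded X_def]]
    have "AE x in lebesgue. x \<in> ball x0 (R / 4) \<longrightarrow> a \<le> U x \<and> U x \<le> k0 + H - H / 2 ^ (s + 1)"
      using sub by eventually_elim auto
    then show ?thesis by (rule that) (simp add: k0_def H_def field_simps)
  next
    case 2
    have "AE x in lebesgue. x \<in> ball x0 R \<longrightarrow> - U x \<le> - k0 + H"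
      using Uk by eventually_elim (auto simp: k0_def H_def field_simps)
    from one_sided_reduction[OF conds localized_solution_uminus[OF sol] cut m R this s H 2[unfolded Y_def]]
    have "AE x in lebesgue. x \<in> ball x0 (R / 4) \<longrightarrow> k0 - H + H / 2 ^ (s + 1) \<le> U x \<and> U x \<le> b"
      using sub by eventually_elim auto
    then show ?thesis by (rule that) (simp add: k0_def H_def field_simps)
  qed
qed

text \<open>\<open>deg_s\<close> is at most K \<Gamma>^e + 1: the factor \<open>deg_T\<close>
  contributes the exponent (n+1)/(p-1), and the n-th power of 1 / \<open>deg_eta\<close> contributes
  n. Inserting \<Gamma> = C exp(2t) gives an exponential in t.\<close>

lemma deg_s_exponential_bound:
  fixes C p :: real
  assumes C: "C \<ge> 1" and p: "p > 1"
  obtains c \<beta> :: real where "c > 0" "\<beta> > 0" "\<And>t. t \<ge> 0 \<Longrightarrow> deg_s n m p (C * (exp t)\<^sup>2) + 2 \<le> c * exp (\<beta> * t)"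
proof -
  define b where "b = deg_B m ^ (n + 4)"
  have b: "b > 0" by (simp add: b_def deg_B_def)
  define e where "e = n + (n + 1) / (p - 1)"
  have e: "e \<ge> 0" using p by (simp add: e_def)
  define K where "K = 2 ^ (n + 5) * (2 ^ (n + 5) * 4 ^ (m + 1) * (4 * b) ^ n) powr (1 / (p - 1)) * (4 * b) ^ n"
  have K: "K > 0" using b by (simp add: K_def)
  have bound: "deg_s n m p \<Gamma> \<le> K * \<Gamma> powr e + 1" if \<Gamma>: "\<Gamma> \<ge> 1" for \<Gamma>
  proof -
    have eta: "1 / deg_eta n m \<Gamma> ^ n = (4 * b) ^ n * \<Gamma> ^ n"
      by (simp add: deg_eta_def b_def power_divide power_mult_distrib mult_ac)
    have T: "deg_T n m p \<Gamma> = (2 ^ (n + 5) * 4 ^ (m + 1) * (4 * b) ^ n) powr (1 / (p - 1)) * \<Gamma> powr ((n + 1) / (p - 1))"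
    proof -
      have "2 ^ (n + 5) * \<Gamma> * 4 ^ (m + 1) / deg_eta n m \<Gamma> ^ n = 2 ^ (n + 5) * \<Gamma> * 4 ^ (m + 1) * (1 / deg_eta n m \<Gamma> ^ n)" by simp
      also have "\<dots> = (2 ^ (n + 5) * 4 ^ (m + 1) * (4 * b) ^ n) * \<Gamma> ^ (n + 1)" unfolding eta by (simp add: mult_ac)
      also have "\<Gamma> ^ (n + 1) = \<Gamma> powr (n + 1)" using \<Gamma> by (subst powr_realpow[symmetric]) (auto simp: add.commute)
      finally show ?thesis unfolding deg_T_def using b \<Gamma>
        by (simp add: powr_mult powr_powr)
    qed
    have "2 ^ (n + 5) * deg_T n m p \<Gamma> / deg_eta n m \<Gamma> ^ n = 2 ^ (n + 5) * deg_T n m p \<Gamma> * (1 / deg_eta n m \<Gamma> ^ n)" by simp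
    also have "\<dots> = K * (\<Gamma> powr ((n + 1) / (p - 1)) * \<Gamma> powr n)"
      unfolding eta T using \<Gamma> by (simp add: K_def powr_realpow mult_ac)
    also have "\<dots> = K * \<Gamma> powr e" by (simp add: e_def add.commute flip: powr_add)
    finally have eq: "2 ^ (n + 5) * deg_T n m p \<Gamma> / deg_eta n m \<Gamma> ^ n = K * \<Gamma> powr e" .
    have "0 \<le> K * \<Gamma> powr e" using K by simp
    then show ?thesis unfolding deg_s_def eq by linarith
  qed
  show ?thesis
  \<comment> \<open>The 3 collects the additive 1 of the polynomial bound and the 2 of the claim,
    absorbed by an exponential that is at least 1; the extra 1 in \<beta> makes positivity
    evident.\<close>
  proof (rule that[of "K * C powr e + 3" "2 * e + 1"])
    show "0 < K * C powr e + 3" "0 < 2 * e + 1" using K e by (auto intro: add_nonneg_pos)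
    fix t :: real assume t: "t \<ge> 0"
    have "1 * 1 \<le> C * (exp t)\<^sup>2" using C t by (intro mult_mono one_le_power) auto
    then have "deg_s n m p (C * (exp t)\<^sup>2) + 2 \<le> K * (C * (exp t)\<^sup>2) powr e + 3" using bound by fastforce
    also have "(C * (exp t)\<^sup>2) powr e = C powr e * exp (2 * e * t)"
      using C by (simp add: powr_mult powr_def ln_mult exp_add[symmetric] power2_eq_square algebra_simps)
    also have "K * (C powr e * exp (2 * e * t)) + 3 \<le> (K * C powr e) * exp ((2 * e + 1) * t) + 3 * exp ((2 * e + 1) * t)"
    proof (rule add_mono)
      have "exp (2 * e * t) \<le> exp ((2 * e + 1) * t)" using t by (simp add: algebra_simps)
      then show "K * (C powr e * exp (2 * e * t)) \<le> (K * C powr e) * exp ((2 * e + 1) * t)"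
        using K by (simp add: mult.assoc mult_left_mono)
      show "3 \<le> 3 * exp ((2 * e + 1) * t)" using t e by simp
    qed
    also have "\<dots> = (K * C powr e + 3) * exp ((2 * e + 1) * t)" by (simp add: algebra_simps)
    finally show "deg_s n m p (C * (exp t)\<^sup>2) + 2 \<le> (K * C powr e + 3) * exp ((2 * e + 1) * t)" by simp
  qed
qed

section \<open>Iteration over the radii R / 4^i\<close>

lemma two_power_le_exp: "2 ^ k \<le> exp (real k)"
proof -
  have "(2::real) ^ k \<le> exp 1 ^ k" using exp_ge_add_one_self[of 1] by (intro power_mono) auto
  then show ?thesis by (simp flip: exp_of_nat_mult)
qed

text \<open>By \<open>1 - \<delta> \<le> exp (- \<delta>)\<close> the product is at most the
  exponential of minus the partial sum, and the partial sums exceed every bound.\<close>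

lemma small_product:
  fixes \<delta> :: "nat \<Rightarrow> real"
  assumes "\<not> summable \<delta>" "\<And>i. 0 \<le> \<delta> i" "\<And>i. \<delta> i \<le> 1" "\<epsilon> > 0"
  obtains n where "K * (\<Prod>i<n. 1 - \<delta> i) \<le> \<epsilon>"
proof (cases "K > 0")
  case False
  then have "K * (\<Prod>i<0. 1 - \<delta> i) \<le> \<epsilon>" using assms by simp
  then show ?thesis by (rule that)
next
  case True
  obtain n where n: "(\<Sum>i<n. \<delta> i) > ln (K / \<epsilon>)"
    using summableI_nonneg_bounded[of \<delta> "ln (K / \<epsilon>)"] assms(1,2) by (meson not_le)
  have "(\<Prod>i<n. 1 - \<delta> i) \<le> (\<Prod>i<n. exp (- \<delta> i))"
    using exp_ge_add_one_self[of "- \<delta> _"] assms(3) by (intro prod_mono) auto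
  also have "\<dots> = exp (- (\<Sum>i<n. \<delta> i))" by (simp add: exp_sum sum_negf[symmetric])
  also have "\<dots> \<le> exp (- ln (K / \<epsilon>))" using n by simp
  also have "\<dots> = \<epsilon> / K" using True assms by (simp add: exp_minus)
  finally have "K * (\<Prod>i<n. 1 - \<delta> i) \<le> \<epsilon>" using True by (simp add: field_simps)
  then show ?thesis by (rule that)
qed

lemma quarter_scale:
  fixes r R :: real
  assumes "0 < r" "r < R"
  obtains i :: nat where "R / 4 ^ i / 4 < r" "r \<le> R / 4 ^ i"
proof -
  have "\<exists>i. R / 4 ^ Suc i < r"
  proof -
    obtain i where "(1 / 4) ^ i < r / R" using real_arch_pow_inv[of "r / R" "1/4"] assms by auto
    then have "R / 4 ^ i < r" using assms by (simp add: field_simps power_divide)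
    moreover have "R / 4 ^ Suc i \<le> R / 4 ^ i" using assms by (intro divide_left_mono) auto
    ultimately show ?thesis by (intro exI[of _ i]) linarith
  qed
  define i where "i = (LEAST i. R / 4 ^ Suc i < r)"
  have i: "R / 4 ^ Suc i < r" unfolding i_def by (rule LeastI_ex) fact
  have "r \<le> R / 4 ^ i"
  proof (cases i)
    case 0
    then show ?thesis using assms by simp
  next
    case (Suc j)
    then have "\<not> R / 4 ^ Suc j < r" unfolding i_def by (metis lessI not_less_Least)
    then show ?thesis using Suc by simp
  qed
  then show ?thesis using that[of i] i by (simp add: field_simps)
qed

text \<open>Integral test on the intervals from r_i / 4 to r_i with r_i = R / 4^i: there f(r)/r is
  at most 4 f(r_i) / r_i by monotonicity, and the length is 3 r_i / 4, so each interval contributes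
  at most 3 f(r_i).\<close>

lemma divergence_dyadic:
  assumes dv: "diverges_at_0 (\<lambda>r. f r / r)" and f: "\<And>r. 0 \<le> f r" and R: "R > 0"
    and mono: "\<And>r s. 0 < r \<Longrightarrow> r \<le> s \<Longrightarrow> s \<le> R \<Longrightarrow> f r \<le> f s"
  shows "\<not> summable (\<lambda>i. f (R / 4 ^ i))"
proof
  assume sm: "summable (\<lambda>i. f (R / 4 ^ i))"
  obtain e where e: "e > 0" "\<And>\<epsilon>. 0 < \<epsilon> \<Longrightarrow> \<epsilon> < e \<Longrightarrow> (\<integral>\<^sup>+r\<in>{0<..<\<epsilon>}. ennreal (f r / r) \<partial>lborel) = \<infinity>"
    using dv by (auto simp: diverges_at_0_def eventually_at_right_field)
  define \<epsilon> where "\<epsilon> = min e R / 2"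
  have \<epsilon>: "0 < \<epsilon>" "\<epsilon> < e" "\<epsilon> < R" using e R by (auto simp: \<epsilon>_def)
  define I where "I i = {R / 4 ^ i / 4<..R / 4 ^ i}" for i :: nat
  define C where "C i = 4 * f (R / 4 ^ i) / (R / 4 ^ i)" for i :: nat
  have Cnn: "C i \<ge> 0" for i using f R by (simp add: C_def)
  have "(\<integral>\<^sup>+r\<in>{0<..<\<epsilon>}. ennreal (f r / r) \<partial>lborel) \<le> (\<integral>\<^sup>+r. (\<Sum>i. ennreal (C i) * indicator (I i) r) \<partial>lborel)"
  proof (rule nn_integral_mono)
    fix r :: real
    show "ennreal (f r / r) * indicator {0<..<\<epsilon>} r \<le> (\<Sum>i. ennreal (C i) * indicator (I i) r)"
    proof (cases "r \<in> {0<..<\<epsilon>}")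
      case True
      then obtain i where i: "R / 4 ^ i / 4 < r" "r \<le> R / 4 ^ i" using quarter_scale[of r R] \<epsilon> by auto
      have "f r / r \<le> f (R / 4 ^ i) / (R / 4 ^ i / 4)"
        using True i R f by (intro frac_le mono) (auto simp: divide_le_eq_1 field_simps one_le_power)
      also have "\<dots> = C i" by (simp add: C_def)
      finally have "ennreal (f r / r) \<le> ennreal (C i) * indicator (I i) r"
        using i by (simp add: I_def ennreal_leI)
      also have "\<dots> \<le> (\<Sum>i. ennreal (C i) * indicator (I i) r)"
      proof -
        define h where "h i = ennreal (C i) * indicator (I i) r" for i
        have "h i \<le> suminf h" using sum_le_suminf[of h "{i}"] by simp
        then show ?thesis unfolding h_def[abs_def] .
      qed
      finally show ?thesis using True by simp
    qed simp
  qed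
  also have "\<dots> = (\<Sum>i. \<integral>\<^sup>+r. ennreal (C i) * indicator (I i) r \<partial>lborel)"
    by (rule nn_integral_suminf) (simp add: I_def)
  also have "\<dots> = (\<Sum>i. ennreal (3 * f (R / 4 ^ i)))"
  proof (rule suminf_cong)
    fix i
    have "(\<integral>\<^sup>+r. ennreal (C i) * indicator (I i) r \<partial>lborel) = ennreal (C i) * ennreal (R / 4 ^ i - R / 4 ^ i / 4)"
    proof -
      have "emeasure lborel (I i) = ennreal (R / 4 ^ i - R / 4 ^ i / 4)"
        unfolding I_def using R by (intro emeasure_lborel_Ioc) (simp add: field_simps)
      moreover have "I i \<in> sets lborel" by (simp add: I_def)
      ultimately show ?thesis by (simp only: nn_integral_cmult_indicator)
    qed
    also have "\<dots> = ennreal (C i * (R / 4 ^ i - R / 4 ^ i / 4))" by (rule ennreal_mult'[OF Cnn, symmetric])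
    also have "C i * (R / 4 ^ i - R / 4 ^ i / 4) = 3 * f (R / 4 ^ i)" using R by (simp add: C_def field_simps)
    finally show "(\<integral>\<^sup>+r. ennreal (C i) * indicator (I i) r \<partial>lborel) = ennreal (3 * f (R / 4 ^ i))" .
  qed
  also have "\<dots> = ennreal (\<Sum>i. 3 * f (R / 4 ^ i))"
    using sm f by (intro suminf_ennreal2) (auto intro: summable_mult)
  also have "\<dots> < \<infinity>" by simp
  finally show False using e(2)[OF \<epsilon>(1,2)] by simp
qed

text \<open>Besides the upper bound, the oscillation must be shown nonnegative and the extended real
  difference must not be degenerate. As a ball has positive measure, some point satisfies both
  essential bounds, which settles this.\<close>

lemma ess_continuous_atI:
  fixes u :: "real^'n \<Rightarrow> real"
  assumes \<Omega>: "open \<Omega>" "x0 \<in> \<Omega>" and u: "u \<in> borel_measurable (lebesgue_on \<Omega>)"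
    and osc: "\<And>\<epsilon>. \<epsilon> > 0 \<Longrightarrow> \<exists>R a b. R > 0 \<and> b - a \<le> \<epsilon> \<and> (AE x in lebesgue. x \<in> ball x0 R \<longrightarrow> a \<le> u x \<and> u x \<le> b)"
  shows "ess_continuous_at u x0"
proof -
  define F where "F r = ess_sup_on (ball x0 r) u - ess_inf_on (ball x0 r) u" for r
  obtain R\<Omega> where R\<Omega>: "R\<Omega> > 0" "ball x0 R\<Omega> \<subseteq> \<Omega>" using \<Omega> open_contains_ball by blast
  have bound: "\<forall>\<^sub>F r in at_right 0. 0 \<le> F r \<and> F r \<le> ereal \<epsilon>" if \<epsilon>: "\<epsilon> > 0" for \<epsilon>
  proof -
    obtain R a b where R: "R > 0" "b - a \<le> \<epsilon>" "AE x in lebesgue. x \<in> ball x0 R \<longrightarrow> a \<le> u x \<and> u x \<le> b"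
      using osc[OF \<epsilon>] by blast
    have "0 \<le> F r \<and> F r \<le> ereal \<epsilon>" if r: "0 < r" "r < min R R\<Omega>" for r
    proof -
      let ?M = "lebesgue_on (ball x0 r)"
      have sub: "ball x0 r \<subseteq> \<Omega>" "ball x0 r \<subseteq> ball x0 R" using r R\<Omega> by auto
      have um: "u \<in> borel_measurable ?M" using u sub(1) by (rule measurable_restrict_mono)
      have ae: "AE x in ?M. a \<le> u x \<and> u x \<le> b"
      proof -
        have "AE x in lebesgue. x \<in> ball x0 r \<longrightarrow> a \<le> u x \<and> u x \<le> b"
          using R(3) by eventually_elim (use sub in blast)
        then show ?thesis by (subst AE_restrict_space_iff) auto
      qed
      define S where "S = esssup ?M (\<lambda>x. ereal (u x))"
      define S' where "S' = esssup ?M (\<lambda>x. ereal (- u x))"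
      have F: "F r = S - (- S')" by (simp add: F_def ess_sup_on_def ess_inf_on_def S_def S'_def)
      have S: "S \<le> ereal b" unfolding S_def using um ae by (intro esssup_I) auto
      have S': "S' \<le> ereal (- a)" unfolding S'_def using um ae by (intro esssup_I) auto
      have "emeasure ?M (space ?M) \<noteq> 0"
      proof -
        have "measure lborel (ball x0 r) > 0" using r by (simp add: content_ball_pos)
        then have "emeasure lborel (ball x0 r) \<noteq> 0" by (auto simp: measure_def)
        then show ?thesis by (simp add: emeasure_restrict_space)
      qed
      then have nb: "ae_filter ?M \<noteq> bot" by (simp add: ae_filter_eq_bot_iff)
      have "AE x in ?M. ereal (u x) \<le> S \<and> ereal (- u x) \<le> S'"
        unfolding S_def S'_def by (intro AE_conjI esssup_AE)
      then obtain x where "ereal (u x) \<le> S" "ereal (- u x) \<le> S'"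
        using eventually_happens'[OF nb] by blast
      then show ?thesis unfolding F using S S' R(2) by (cases S; cases S') auto
    qed
    then show ?thesis unfolding eventually_at_right_field using R R\<Omega> by (intro exI[of _ "min R R\<Omega>"]) auto
  qed
  have "(F \<longlongrightarrow> 0) (at_right 0)"
  proof (rule order_tendstoI)
    fix a :: ereal assume "a < 0"
    show "\<forall>\<^sub>F r in at_right 0. a < F r" using bound[of 1] by (auto elim!: eventually_mono intro: less_le_trans[OF \<open>a < 0\<close>])
  next
    fix a :: ereal assume "0 < a"
    then obtain \<epsilon> where \<epsilon>: "0 < ereal \<epsilon>" "ereal \<epsilon> < a" using ereal_dense2 by blast
    then show "\<forall>\<^sub>F r in at_right 0. F r < a" using bound[of \<epsilon>] by (auto elim!: eventually_mono intro: le_less_trans)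
  qed
  then show ?thesis by (simp add: ess_continuous_at_def F_def[abs_def])
qed

text \<open>On the way from one radius to the next, an oscillation above \<epsilon> loses the factor
  \<open>1 - \<delta> j\<close>. Divergence of the sum of the \<open>\<delta> j\<close> makes the
  product of these factors small, so \<epsilon> is reached after finitely many radii.\<close>

lemma continuity_criterion:
  fixes u :: "real^'n \<Rightarrow> real" and M :: real
  assumes \<Omega>: "open \<Omega>" "x0 \<in> \<Omega>"
    and conds: "cond_g \<Omega> g" "cond_g1 \<Omega> g c1 q b0" "cond_g2 \<Omega> g p" "cond_g3 \<Omega> g rs lam c2"
    and sol: "bounded_weak_solution g \<Omega> u" and M: "ess_sup_on \<Omega> (\<lambda>x. \<bar>u x\<bar>) = ereal M"
    and cut: "\<And>x0 :: real^'n. has_cutoffs x0 B" and m: "q \<le> m" and cb: "c > 0" "\<beta> > 0"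
    and s: "\<And>t. t \<ge> 0 \<Longrightarrow> deg_s CARD('n) m p (deg_const c1 m (c2 M) B * (exp t)\<^sup>2) + 2 \<le> c * exp (\<beta> * t)"
    and dv: "diverges_at_0 (\<lambda>r. Lam lam (- c) \<beta> r / r)"
    and lim: "((\<lambda>r. r * Lam lam c \<beta> r) \<longlongrightarrow> 0) (at_right 0)"
  shows "ess_continuous_at u x0"
proof (rule ess_continuous_atI[OF \<Omega>])
  have um: "u \<in> borel_measurable (lebesgue_on \<Omega>)" using sol by (simp add: bounded_weak_solution_def L_infinity_def)
  then show "u \<in> borel_measurable (lebesgue_on \<Omega>)" .
  have \<Omega>m: "\<Omega> \<in> sets lebesgue" using \<Omega>(1) by simp
  have bd: "AE x in lebesgue. x \<in> \<Omega> \<longrightarrow> \<bar>u x\<bar> \<le> M"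
  proof -
    have "AE x in lebesgue_on \<Omega>. ereal \<bar>u x\<bar> \<le> ereal M"
      using esssup_AE[of "\<lambda>x. ereal \<bar>u x\<bar>" "lebesgue_on \<Omega>"] M by (simp add: ess_sup_on_def)
    then show ?thesis using \<Omega>m by (subst (asm) AE_restrict_space_iff) auto
  qed
  have M0: "M \<ge> 0"
  proof (rule ccontr)
    assume "\<not> M \<ge> 0"
    then have "AE x in lebesgue. x \<notin> \<Omega>" using bd by (auto elim!: eventually_mono)
    then have "\<Omega> \<in> null_sets lebesgue" using \<Omega>m by (simp add: AE_iff_null_sets)
    then show False using open_not_negligible[OF \<Omega>(1)] \<Omega>(2) by (auto simp: negligible_iff_null_sets)
  qed
  obtain R0 U V where loc: "localized_solution g \<Omega> x0 R0 M U V" and Uu: "AE x in lebesgue. x \<in> ball x0 R0 \<longrightarrow> U x = u x"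
    using exists_localized_solution[OF \<Omega> sol conds(1) bd M0] by metis
  have R0: "R0 > 0" "\<And>x. \<bar>U x\<bar> \<le> M" using loc unfolding localized_solution_def by blast+
  have rs: "rs > 0" "antimono_on {0<..<rs} lam" "\<And>r. 0 < r \<Longrightarrow> r < rs \<Longrightarrow> lam r \<ge> 0"
    using conds(4) by (auto simp: cond_g3_def)
  have b0: "b0 \<ge> 0" using conds(2) by (simp add: cond_g1_def)
  fix \<epsilon> :: real assume \<epsilon>: "\<epsilon> > 0"
  obtain R1 where R1: "R1 > 0" "ball x0 R1 \<subseteq> \<Omega>" using \<Omega> open_contains_ball by blast
  have "\<forall>\<^sub>F r in at_right 0. r * Lam lam c \<beta> r < \<epsilon> / (1 + b0)"
    using lim \<epsilon> b0 by (intro order_tendstoD(2)) auto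
  then obtain R2 where R2: "R2 > 0" "\<And>r. 0 < r \<Longrightarrow> r < R2 \<Longrightarrow> r * Lam lam c \<beta> r < \<epsilon> / (1 + b0)"
    by (auto simp: eventually_at_right_field)
  define R where "R = min (min R0 (R1 / 8)) (min (rs / 2) (R2 / 2))"
  have R: "0 < R" "R \<le> R0" "8 * R \<le> R1" "R < rs" "R < R2"
    using R0 R1 R2 rs by (auto simp: R_def)
  define r where "r i = R / 4 ^ i" for i :: nat
  have r: "0 < r i" "r i \<le> R" for i using R by (auto simp: r_def divide_le_eq one_le_power)
  have r_Suc: "r (Suc i) = r i / 4" for i by (simp add: r_def)
  define \<delta> where "\<delta> i = Lam lam (- c) \<beta> (r i)" for i
  have \<delta>: "0 \<le> \<delta> i" "\<delta> i \<le> 1" for i using cb by (auto simp: \<delta>_def Lam_def)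
  have nsum: "\<not> summable \<delta>"
    unfolding \<delta>_def r_def
  proof (rule divergence_dyadic[OF dv _ R(1)])
    show "0 \<le> Lam lam (- c) \<beta> r" for r by (simp add: Lam_def)
    fix r s assume rs': "0 < r" "r \<le> s" "s \<le> R"
    have "lam s \<le> lam r" using rs(2) rs' R by (auto simp: monotone_on_def)
    then show "Lam lam (- c) \<beta> r \<le> Lam lam (- c) \<beta> s" using cb by (simp add: Lam_def)
  qed
  \<comment> \<open>Once at most \<epsilon>, the oscillation bound is inherited by smaller balls;
    before that, \<open>oscillation_reduction\<close> applies. The bound \<open>2 * M\<close> is
    carried along because (g3) is used with the constant for M.\<close>
  have step: "\<exists>a b. (AE x in lebesgue. x \<in> ball x0 (r j) \<longrightarrow> a \<le> U x \<and> U x \<le> b) \<and> b - a \<le> 2 * M \<and>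
      (b - a \<le> \<epsilon> \<or> b - a \<le> 2 * M * (\<Prod>i<j. 1 - \<delta> i))" for j
  proof (induction j)
    case 0
    show ?case using R0(2) by (intro exI[of _ "- M"] exI[of _ M]) (auto simp: abs_le_iff minus_le_iff)
  next
    case (Suc j)
    then obtain a b where ab: "AE x in lebesgue. x \<in> ball x0 (r j) \<longrightarrow> a \<le> U x \<and> U x \<le> b" "b - a \<le> 2 * M"
      "b - a \<le> \<epsilon> \<or> b - a \<le> 2 * M * (\<Prod>i<j. 1 - \<delta> i)" by blast
    show ?case
    proof (cases "b - a \<le> \<epsilon>")
      case True
      have "AE x in lebesgue. x \<in> ball x0 (r (Suc j)) \<longrightarrow> a \<le> U x \<and> U x \<le> b"
        using ab(1) by eventually_elim (use r(1)[of j] in \<open>auto simp: r_Suc\<close>)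
      then show ?thesis using True ab by blast
    next
      case False
      define t where "t = lam (r j)"
      have t: "t \<ge> 0" unfolding t_def using r[of j] R by (intro rs) auto
      define k where "k = deg_s CARD('n) m p (deg_const c1 m (c2 M) B * (exp (lam (r j)))\<^sup>2)"
      have k: "real k + 2 \<le> c * exp (\<beta> * t)" using s[OF t] by (simp add: k_def t_def)
      \<comment> \<open>The threshold holds as long as the oscillation exceeds \<epsilon>: the power
        of 2 is at most \<Lambda>(c,\<beta>,r), and r \<Lambda>(c,\<beta>,r) is below \<epsilon> /
        (1 + b0).\<close>
      have big: "r j * (1 + b0) \<le> (b - a) / 2 ^ (k + 1)"
      proof -
        have "(2::real) ^ (k + 1) \<le> exp (real (k + 1))" by (rule two_power_le_exp)
        also have "\<dots> \<le> Lam lam c \<beta> (r j)" using k by (simp add: Lam_def t_def)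
        finally have "r j * (1 + b0) * 2 ^ (k + 1) \<le> r j * (1 + b0) * Lam lam c \<beta> (r j)"
          using r[of j] b0 by (intro mult_left_mono) auto
        also have "\<dots> = (1 + b0) * (r j * Lam lam c \<beta> (r j))" by simp
        also have "\<dots> \<le> (1 + b0) * (\<epsilon> / (1 + b0))"
          using R2(2)[of "r j"] r[of j] R b0 by (intro mult_left_mono) auto
        also have "\<dots> \<le> b - a" using False b0 by simp
        finally show ?thesis by (simp add: pos_le_divide_eq)
      qed
      have sub: "ball x0 (8 * r j) \<subseteq> \<Omega>" using R1 R r[of j] by auto
      obtain a' b' where ab': "AE x in lebesgue. x \<in> ball x0 (r j / 4) \<longrightarrow> a' \<le> U x \<and> U x \<le> b'"
        "b' - a' = (b - a) * (1 - 1 / 2 ^ (k + 2))"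
        by (rule oscillation_reduction[OF conds loc cut m r(1) _ _ sub ab(1) k_def big ab(2)])
          (use r[of j] R in auto)
      \<comment> \<open>The summand 2 in the hypothesis on \<open>deg_s\<close> matches the exponent
        of \<open>oscillation_reduction\<close>.\<close>
      have "\<delta> j \<le> 1 / 2 ^ (k + 2)"
      proof -
        have "\<delta> j \<le> exp (- real (k + 2))" using k by (simp add: \<delta>_def Lam_def t_def)
        also have "exp (- real (k + 2)) = 1 / exp (real (k + 2))" by (simp only: exp_minus inverse_eq_divide)
        also have "\<dots> \<le> 1 / 2 ^ (k + 2)" by (rule divide_left_mono[OF two_power_le_exp]) auto
        finally show ?thesis .
      qed
      then have le: "b' - a' \<le> (b - a) * (1 - \<delta> j)" unfolding ab'(2) using False \<epsilon> by (intro mult_left_mono) auto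
      moreover have "(b - a) * (1 - \<delta> j) \<le> 2 * M * (\<Prod>i<j. 1 - \<delta> i) * (1 - \<delta> j)"
        using ab(3) False \<delta>[of j] by (intro mult_right_mono) auto
      ultimately have "b' - a' \<le> 2 * M * (\<Prod>i<Suc j. 1 - \<delta> i)" by (simp add: mult_ac)
      moreover have "(b - a) * (1 - \<delta> j) \<le> b - a" using False \<epsilon> \<delta>[of j] by (intro mult_left_le) auto
      then have "b' - a' \<le> 2 * M" using le ab(2) by (meson order_trans)
      ultimately show ?thesis using ab'(1) unfolding r_Suc by blast
    qed
  qed
  obtain n where n: "2 * M * (\<Prod>i<n. 1 - \<delta> i) \<le> \<epsilon>" using small_product[OF nsum \<delta> \<epsilon>] by blast
  obtain a b where ab: "AE x in lebesgue. x \<in> ball x0 (r n) \<longrightarrow> a \<le> U x \<and> U x \<le> b" "b - a \<le> \<epsilon>"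
    using step[of n] n by fastforce
  have "AE x in lebesgue. x \<in> ball x0 (r n) \<longrightarrow> a \<le> u x \<and> u x \<le> b"
    using ab(1) Uu by eventually_elim (use r[of n] R in auto)
  then show "\<exists>R a b. R > 0 \<and> b - a \<le> \<epsilon> \<and> (AE x in lebesgue. x \<in> ball x0 R \<longrightarrow> a \<le> u x \<and> u x \<le> b)"
    using ab(2) r(1) by blast
qed

section \<open>The triple logarithm\<close>

text \<open>For the triple logarithm and \<kappa> = \<beta> L, the function exp(\<beta>
  \<lambda>(r)) is (ln ln (1/r))^\<kappa>. The increment between \<open>r\<close> and
  \<open>2 * r\<close> is the logarithm of the ratio in the doubling condition, divided by
  c.\<close>

lemma powr_lnln_increment:
  assumes "0 < \<kappa>" "\<kappa> < 1"
  shows "((\<lambda>r::real. (ln (ln (1 / r))) powr \<kappa> - (ln (ln (1 / (2 * r)))) powr \<kappa>) \<longlongrightarrow> 0) (at_right 0)"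
  using assms by real_asymp

lemma r_exp_powr_lnln:
  assumes "0 < \<kappa>" "\<kappa> < 1" "c > 0"
  shows "((\<lambda>r::real. r * exp (c * (ln (ln (1 / r))) powr \<kappa>)) \<longlongrightarrow> 0) (at_right 0)"
  using assms by real_asymp

text \<open>Here \<kappa> < 1, that is L < 1/\<beta>, enters: it bounds \<Lambda>(-c,\<beta>,r) from
  below by 1 / ln (1/r).\<close>

lemma powr_lnln_le:
  assumes "0 < \<kappa>" "\<kappa> < 1" "c > 0"
  shows "\<forall>\<^sub>F r::real in at_right 0. c * (ln (ln (1 / r))) powr \<kappa> \<le> ln (ln (1 / r))"
  using assms by real_asymp

lemma lnln_at_top: "filterlim (\<lambda>r::real. ln (ln (1 / r))) at_top (at_right 0)"
  by real_asymp

text \<open>The antiderivative - ln (ln (1/r)) is unbounded near 0. The bound on \<epsilon> keeps ln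
  (1/r) above 1.\<close>

lemma nn_integral_inverse_r_ln:
  assumes "0 < \<epsilon>" "\<epsilon> < exp (- 1)"
  shows "(\<integral>\<^sup>+r\<in>{0<..<\<epsilon>}. ennreal (1 / (r * ln (1 / r))) \<partial>lborel) = \<infinity>"
proof (rule ccontr)
  assume "\<not> ?thesis"
  then obtain K where K: "K \<ge> 0" "(\<integral>\<^sup>+r\<in>{0<..<\<epsilon>}. ennreal (1 / (r * ln (1 / r))) \<partial>lborel) = ennreal K"
    by (cases "\<integral>\<^sup>+r\<in>{0<..<\<epsilon>}. ennreal (1 / (r * ln (1 / r))) \<partial>lborel" rule: ennreal_cases) auto
  define F where "F r = - ln (ln (1 / r))" for r :: real
  define e where "e = \<epsilon> / 2"
  have e: "0 < e" "e < \<epsilon>" using assms by (auto simp: e_def)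
  have ln1: "ln (1 / r) > 1" if "0 < r" "r < \<epsilon>" for r
  proof -
    have "r < exp (- 1)" using that assms by simp
    then have "ln r < -1" using that by (metis exp_ln exp_less_cancel_iff)
    then show ?thesis using that by (simp add: ln_div)
  qed
  have "ln (ln (1 / a)) \<le> K - F e" if a: "0 < a" "a < e" for a
  proof -
    have "(\<integral>\<^sup>+r\<in>{a..e}. ennreal (1 / (r * ln (1 / r))) \<partial>lborel) = ennreal (F e - F a)"
    proof (rule nn_integral_FTC_Icc)
      fix r assume "r \<in> {a..e}"
      then have r: "a \<le> r" "r \<le> e" by auto
      then have r': "0 < r" "ln (1 / r) > 1" using a e ln1[of r] by auto
      have "exp (- 1) < (1::real)" by simp
      then have r1: "r < 1" using r e assms by linarith
      show "DERIV F r :> 1 / (r * ln (1 / r))" unfolding F_def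
        using r' r1 by (auto intro!: derivative_eq_intros simp: divide_simps)
      show "0 \<le> 1 / (r * ln (1 / r))" using r' r1 by (intro divide_nonneg_nonneg mult_nonneg_nonneg) auto
    qed (use a in auto)
    moreover have "(\<integral>\<^sup>+r\<in>{a..e}. ennreal (1 / (r * ln (1 / r))) \<partial>lborel) \<le> ennreal K"
      unfolding K(2)[symmetric] using a e by (intro nn_integral_mono) (auto simp: indicator_def)
    ultimately have "F e - F a \<le> K" using K by (simp add: ennreal_le_iff)
    then show ?thesis by (simp add: F_def)
  qed
  then have "\<forall>\<^sub>F a in at_right 0. ln (ln (1 / a)) \<le> K - F e"
    unfolding eventually_at_right_field using e by (intro exI[of _ e]) auto
  moreover have "\<forall>\<^sub>F a in at_right 0. ln (ln (1 / a)) > K - F e"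
    using lnln_at_top by (auto simp: filterlim_at_top_dense)
  ultimately have "\<forall>\<^sub>F a in at_right (0::real). False" by eventually_elim auto
  then show False by simp
qed

lemma triple_log:
  fixes c \<beta> L :: real
  assumes cb: "c > 0" "\<beta> > 0" and L: "0 < L" "L < 1 / \<beta>"
    and lam: "\<And>r. 0 < r \<Longrightarrow> r < exp (- exp 1) \<Longrightarrow> lam r = L * ln (ln (ln (1 / r)))"
  shows "\<exists>\<rho>max>0. \<forall>\<rho>0. 0 < \<rho>0 \<and> \<rho>0 \<le> \<rho>max \<longrightarrow> Lam_doubling lam c \<beta> \<rho>0" (is ?A)
    "diverges_at_0 (\<lambda>r. Lam lam (- c) \<beta> r / r)" (is ?B)
    "((\<lambda>r. r * Lam lam c \<beta> r) \<longlongrightarrow> 0) (at_right 0)" (is ?C)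
proof -
  define \<kappa> where "\<kappa> = \<beta> * L"
  have \<kappa>: "0 < \<kappa>" "\<kappa> < 1" using cb L by (auto simp: \<kappa>_def field_simps)
  define f where "f r = (ln (ln (1 / r))) powr \<kappa>" for r :: real
  have f: "Lam lam d \<beta> r = exp (d * f r)" if "0 < r" "r < exp (- exp 1)" for r d
  proof -
    have "ln r < - exp 1" using that by (metis exp_ln exp_less_cancel_iff)
    then have "ln (1 / r) > exp 1" using that by (simp add: ln_div)
    then have "ln (ln (1 / r)) > 1" by (metis exp_gt_zero exp_less_cancel_iff exp_ln less_trans)
    then have "f r = exp (\<beta> * lam r)" by (simp add: f_def powr_def lam[OF that] \<kappa>_def)
    then show ?thesis by (simp add: Lam_def)
  qed
  have small: "\<forall>\<^sub>F r in at_right 0. 0 < r \<and> r < exp (- exp 1 :: real)"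
    unfolding eventually_at_right_field by (intro exI[of _ "exp (- exp 1)"]) auto
  show ?C
  proof (rule Lim_transform_eventually)
    show "((\<lambda>r. r * exp (c * f r)) \<longlongrightarrow> 0) (at_right 0)"
      unfolding f_def by (rule r_exp_powr_lnln[OF \<kappa> cb(1)])
    show "\<forall>\<^sub>F r in at_right 0. r * exp (c * f r) = r * Lam lam c \<beta> r"
      using small by eventually_elim (simp add: f)
  qed
  show ?A
  proof -
    have "\<forall>\<^sub>F r in at_right 0. f r - f (2 * r) < ln (3 / 2) / c"
      unfolding f_def using powr_lnln_increment[OF \<kappa>] cb by (intro order_tendstoD(2)) auto
    then obtain e where e: "e > 0" "\<And>r. 0 < r \<Longrightarrow> r < e \<Longrightarrow> f r - f (2 * r) < ln (3 / 2) / c"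
      by (auto simp: eventually_at_right_field)
    have "Lam_doubling lam c \<beta> \<rho>0" if "0 < \<rho>0" "\<rho>0 \<le> min e (exp (- exp 1))" for \<rho>0
      unfolding Lam_doubling_def
    proof (intro allI impI, elim conjE)
      fix r \<rho> assume r: "0 < r" "r \<le> \<rho> / 2" "\<rho> / 2 < \<rho>0 / 2"
      have "c * f r \<le> ln (3 / 2) + c * f (2 * r)" using e(2)[of r] r that cb by (simp add: field_simps)
      then have "exp (c * f r) \<le> exp (ln (3 / 2) + c * f (2 * r))" by simp
      also have "\<dots> = 3 / 2 * exp (c * f (2 * r))" by (simp add: exp_add)
      finally show "Lam lam c \<beta> r \<le> 3 / 2 * Lam lam c \<beta> (2 * r)" using r that by (simp add: f)
    qed
    then show ?thesis using e by (intro exI[of _ "min e (exp (- exp 1))"]) auto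
  qed
  show ?B
  proof -
    have "\<forall>\<^sub>F r in at_right 0. c * f r \<le> ln (ln (1 / r)) \<and> 0 < ln (ln (1 / r)) \<and> (0 < r \<and> r < exp (- exp 1 :: real))"
    proof -
      have "\<forall>\<^sub>F r in at_right 0. 0 < ln (ln (1 / r :: real))"
        using lnln_at_top unfolding filterlim_at_top_dense by blast
      then show ?thesis
        unfolding f_def using powr_lnln_le[OF \<kappa> cb(1)] small by eventually_elim auto
    qed
    then obtain e where e: "e > 0" "\<And>r. 0 < r \<Longrightarrow> r < e \<Longrightarrow> c * f r \<le> ln (ln (1 / r)) \<and> 0 < ln (ln (1 / r)) \<and> r < exp (- exp 1)"
      by (auto simp: eventually_at_right_field)
    have "(\<integral>\<^sup>+r\<in>{0<..<\<epsilon>}. ennreal (Lam lam (- c) \<beta> r / r) \<partial>lborel) = \<infinity>" if \<epsilon>: "0 < \<epsilon>" "\<epsilon> < min e (exp (- 1))" for \<epsilon>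
    proof -
      have "(\<integral>\<^sup>+r\<in>{0<..<\<epsilon>}. ennreal (1 / (r * ln (1 / r))) \<partial>lborel) \<le> (\<integral>\<^sup>+r\<in>{0<..<\<epsilon>}. ennreal (Lam lam (- c) \<beta> r / r) \<partial>lborel)"
      proof (rule nn_integral_mono)
        fix r :: real
        show "ennreal (1 / (r * ln (1 / r))) * indicator {0<..<\<epsilon>} r \<le> ennreal (Lam lam (- c) \<beta> r / r) * indicator {0<..<\<epsilon>} r"
        proof (cases "r \<in> {0<..<\<epsilon>}")
          case True
          then have r: "c * f r \<le> ln (ln (1 / r))" "0 < ln (ln (1 / r))" "r < exp (- exp 1)" "0 < r"
            using e(2)[of r] \<epsilon> by auto
          have "r < 1" using r(3) by (meson exp_gt_zero exp_le_one_iff less_le_trans neg_le_0_iff_le less_imp_le)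
          then have lp: "ln (1 / r) > 0" using r by simp
          have "1 / ln (1 / r) = exp (- ln (ln (1 / r)))" using lp by (simp add: exp_minus divide_inverse)
          also have "\<dots> \<le> exp (- (c * f r))" using r by simp
          finally have "1 / ln (1 / r) / r \<le> exp (- (c * f r)) / r" using r by (intro divide_right_mono) auto
          then have "1 / (r * ln (1 / r)) \<le> Lam lam (- c) \<beta> r / r" using r f[of r "- c"] by (simp add: mult.commute)
          then show ?thesis using True by (simp add: ennreal_leI)
        qed simp
      qed
      then show ?thesis using nn_integral_inverse_r_ln[of \<epsilon>] \<epsilon> by (simp add: top_unique)
    qed
    then show ?thesis unfolding diverges_at_0_def eventually_at_right_field
      using e by (intro exI[of _ "min e (exp (- 1))"]) auto
  qed
qed

section \<open>The corollary: choice of the constants\<close>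

theorem corollary1p1:
  fixes M p q c1 c2M :: real
  assumes "CARD('n::finite) \<ge> 2"
  shows "\<exists>c>0. \<exists>\<beta>>0.
    (\<forall>(\<Omega> :: (real^'n) set) g b0 rs lam c2 u x0.
       domain_of_space \<Omega> \<and> bounded \<Omega> \<and>
       cond_g \<Omega> g \<and> cond_g1 \<Omega> g c1 q b0 \<and> cond_g2 \<Omega> g p \<and> cond_g3 \<Omega> g rs lam c2 \<and>
       bounded_weak_solution g \<Omega> u \<and> (AE x in lebesgue_on \<Omega>. 0 \<le> u x) \<and>
       ess_sup_on \<Omega> (\<lambda>x. \<bar>u x\<bar>) = ereal M \<and> c2 M = c2M \<and> x0 \<in> \<Omega> \<longrightarrow>
       (\<exists>\<rho>max>0. \<forall>\<rho>0. 0 < \<rho>0 \<and> \<rho>0 \<le> \<rho>max \<and> ball x0 (8 * \<rho>0) \<subseteq> \<Omega> \<and>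
          Lam_doubling lam c \<beta> \<rho>0 \<and>
          diverges_at_0 (\<lambda>r. Lam lam (- c) \<beta> r / r) \<and>
          ((\<lambda>r. r * Lam lam c \<beta> r) \<longlongrightarrow> 0) (at_right 0) \<longrightarrow>
          ess_continuous_at u x0)) \<and>
    (\<forall>L lam. 0 < L \<and> L < 1 / \<beta> \<and>
       (\<forall>r. 0 < r \<and> r < exp (- exp 1) \<longrightarrow> lam r = L * ln (ln (ln (1 / r)))) \<longrightarrow>
       (\<exists>\<rho>max>0. \<forall>\<rho>0. 0 < \<rho>0 \<and> \<rho>0 \<le> \<rho>max \<longrightarrow> Lam_doubling lam c \<beta> \<rho>0) \<and>
       diverges_at_0 (\<lambda>r. Lam lam (- c) \<beta> r / r) \<and>
       ((\<lambda>r. r * Lam lam c \<beta> r) \<longlongrightarrow> 0) (at_right 0))"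
proof -
  obtain B where cut: "\<And>x0 :: real^'n. has_cutoffs x0 B" using radial_cutoff by metis
  \<comment> \<open>An integer exponent keeps the power of the cutoff smooth; it depends on q
    only.\<close>
  define m where "m = nat \<lceil>q\<rceil>"
  have m: "q \<le> m" by (simp add: m_def) linarith
  have C: "deg_const c1 m c2M B \<ge> 1" by (simp add: deg_const_def)
  \<comment> \<open>The constants must be fixed before \<Omega> and g are given, while p > 1 is
    known only from (g2); hence the implication and the arbitrary witnesses otherwise.\<close>
  have "\<exists>c \<beta>. c > 0 \<and> \<beta> > 0 \<and>
    (p > 1 \<longrightarrow> (\<forall>t\<ge>0. deg_s CARD('n) m p (deg_const c1 m c2M B * (exp t)\<^sup>2) + 2 \<le> c * exp (\<beta> * t)))"
  proof (cases "p > 1")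
    case True
    show ?thesis using deg_s_exponential_bound[OF C True, of "CARD('n)" m] by metis
  next
    case False
    then show ?thesis by (intro exI[of _ 1]) simp
  qed
  then obtain c \<beta> where cb: "c > 0" "\<beta> > 0" and
    s: "p > 1 \<longrightarrow> (\<forall>t\<ge>0. deg_s CARD('n) m p (deg_const c1 m c2M B * (exp t)\<^sup>2) + 2 \<le> c * exp (\<beta> * t))"
    by blast
  show ?thesis
  proof (rule exI[of _ c], rule conjI[OF cb(1)], rule exI[of _ \<beta>], rule conjI[OF cb(2)], rule conjI, goal_cases)
    case 1
    show ?case
    proof (intro allI impI, goal_cases)
      case (1 \<Omega> g b0 rs lam c2 u x0)
      then have h: "open \<Omega>" "x0 \<in> \<Omega>" "cond_g \<Omega> g" "cond_g1 \<Omega> g c1 q b0" "cond_g2 \<Omega> g p" "cond_g3 \<Omega> g rs lam c2"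
        "bounded_weak_solution g \<Omega> u" "ess_sup_on \<Omega> (\<lambda>x. \<bar>u x\<bar>) = ereal M" "c2 M = c2M"
        by (simp_all add: domain_of_space_def)
      have p: "p > 1" using h(5) by (simp add: cond_g2_def)
      have "ess_continuous_at u x0"
        if "diverges_at_0 (\<lambda>r. Lam lam (- c) \<beta> r / r)" "((\<lambda>r. r * Lam lam c \<beta> r) \<longlongrightarrow> 0) (at_right 0)"
        by (rule continuity_criterion[OF h(1-8) cut m cb _ that]) (use s p h(9) in auto)
      then show ?case by (intro exI[of _ 1]) auto
    qed
  next
    case 2
    show ?case
    proof (intro allI impI, goal_cases)
      case (1 L lam)
      then show ?case using triple_log[OF cb, of L lam] by blast
    qed
  qed
qed

end
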